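(* Let $G$ be a finite group and $\mathcal{H}$ a reduced set of subgroups of $G$ with $\#\mathcal{H}\geq2$ and $d_G(\mathcal{H})\geq3$. Assume that $\mathcal{H}$ has a special subset $\mathcal{H}'$ with $\#\mathcal{H}'=2$. Then the $G$-lattice $J_{G/\mathcal{H}}$ is not quasi-invertible.
   Context: A $G$-lattice is a finitely generated free abelian group with a left $G$-action; $M^\circ:=\mathrm{Hom}_{\mathbb{Z}}(M,\mathbb{Z})$ with $(gf)(x)=f(g^{-1}x)$. Permutation: has a $\mathbb{Z}$-basis permuted by $G$; quasi-permutation: there is an exact sequence $0\to M\to R\to F\to0$ with $R,F$ permutation; quasi-invertible: direct summand of a quasi-permutation lattice. For a set $\mathcal{H}$ of subgroups, $I_{G/\mathcal{H}}:=\ker(\bigoplus_{H\in\mathcal{H}}\mathbb{Z}[G/H]\to\mathbb{Z})$ (sum of augmentation maps) and $J_{G/\mathcal{H}}:=I_{G/\mathcal{H}}^\circ$. $d_G(\mathcal{H}):=\gcd((G:H)\mid H\in\mathcal{H})$. A set of subgroups is reduced if no element is contained in a different element. $N^G(H):=\bigcap_{g}gHg^{-1}$. A set $\mathcal{H}$ of subgroups of $G$ is special if $G\notin\mathcal{H}$, $\#\mathcal{H}\geq2$, and for all distinct $H,H'\in\mathcal{H}$, $N^G(H)H'=G$ or $N^G(H')H=G$. *)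

theory Defs
  imports "HOL-Algebra.Algebra"
begin

(* A G-lattice is encoded in coordinates: a pair (n, a) where the underlying
   free abelian group is Z^n = vecs n (functions nat => int vanishing from n on)
   and a g is the (additive) action of g. *)

type_synonym 'g glat = "nat \<times> ('g \<Rightarrow> (nat \<Rightarrow> int) \<Rightarrow> (nat \<Rightarrow> int))"

definition vecs :: "nat \<Rightarrow> (nat \<Rightarrow> int) set" where
  "vecs n = {v. \<forall>i\<ge>n. v i = 0}"

definition glattice :: "('g, 'b) monoid_scheme \<Rightarrow> 'g glat \<Rightarrow> bool" where
  "glattice G M = (case M of (n, a) \<Rightarrow>
     (\<forall>g\<in>carrier G. \<forall>v\<in>vecs n. a g v \<in> vecs n) \<and>
     (\<forall>g\<in>carrier G. \<forall>v\<in>vecs n. \<forall>w\<in>vecs n. a g (\<lambda>i. v i + w i) = (\<lambda>i. a g v i + a g w i)) \<and>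
     (\<forall>v\<in>vecs n. a \<one>\<^bsub>G\<^esub> v = v) \<and>
     (\<forall>g\<in>carrier G. \<forall>h\<in>carrier G. \<forall>v\<in>vecs n. a (g \<otimes>\<^bsub>G\<^esub> h) v = a g (a h v)))"

definition gmap :: "('g, 'b) monoid_scheme \<Rightarrow> 'g glat \<Rightarrow> 'g glat \<Rightarrow> ((nat \<Rightarrow> int) \<Rightarrow> (nat \<Rightarrow> int)) \<Rightarrow> bool" where
  "gmap G M N f = (case M of (n, a) \<Rightarrow> case N of (m, b) \<Rightarrow>
     (\<forall>v\<in>vecs n. f v \<in> vecs m) \<and>
     (\<forall>v\<in>vecs n. \<forall>w\<in>vecs n. f (\<lambda>i. v i + w i) = (\<lambda>i. f v i + f w i)) \<and>
     (\<forall>g\<in>carrier G. \<forall>v\<in>vecs n. f (a g v) = b g (f v)))"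

definition glat_iso :: "('g, 'b) monoid_scheme \<Rightarrow> 'g glat \<Rightarrow> 'g glat \<Rightarrow> bool" where
  "glat_iso G M N = (\<exists>f. gmap G M N f \<and> bij_betw f (vecs (fst M)) (vecs (fst N)))"

definition dsum :: "'g glat \<Rightarrow> 'g glat \<Rightarrow> 'g glat" where
  "dsum M N = (case M of (n, a) \<Rightarrow> case N of (m, b) \<Rightarrow>
     (n + m, \<lambda>g v i. if i < n then a g (\<lambda>k. if k < n then v k else 0) i
                    else if i < n + m then b g (\<lambda>k. v (k + n)) (i - n) else 0))"

definition permutation_lattice :: "('g, 'b) monoid_scheme \<Rightarrow> 'g glat \<Rightarrow> bool" where
  "permutation_lattice G M = (case M of (n, a) \<Rightarrow>
     \<exists>\<beta> :: nat \<Rightarrow> nat \<Rightarrow> int.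
       (\<forall>i<n. \<beta> i \<in> vecs n) \<and>
       (\<forall>v\<in>vecs n. \<exists>!c. (\<forall>i\<ge>n. c i = 0) \<and> v = (\<lambda>k. \<Sum>i<n. c i * \<beta> i k)) \<and>
       (\<forall>g\<in>carrier G. \<forall>i<n. \<exists>j<n. a g (\<beta> i) = \<beta> j))"

definition short_exact :: "('g, 'b) monoid_scheme \<Rightarrow> 'g glat \<Rightarrow> 'g glat \<Rightarrow> 'g glat \<Rightarrow> bool" where
  "short_exact G M R F = (\<exists>f h. gmap G M R f \<and> gmap G R F h \<and>
     inj_on f (vecs (fst M)) \<and> h ` vecs (fst R) = vecs (fst F) \<and>
     {x \<in> vecs (fst R). h x = (\<lambda>_. 0)} = f ` vecs (fst M))"

definition quasi_permutation :: "('g, 'b) monoid_scheme \<Rightarrow> 'g glat \<Rightarrow> bool" where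
  "quasi_permutation G M = (glattice G M \<and> (\<exists>R F. glattice G R \<and> glattice G F \<and>
     permutation_lattice G R \<and> permutation_lattice G F \<and> short_exact G M R F))"

definition quasi_invertible :: "('g, 'b) monoid_scheme \<Rightarrow> 'g glat \<Rightarrow> bool" where
  "quasi_invertible G M = (glattice G M \<and> (\<exists>M' N. glattice G M' \<and>
     quasi_permutation G N \<and> glat_iso G N (dsum M M')))"

(* dual lattice M\<degree> = Hom(M, Z), in the dual basis coordinates:
   (g f)(e_i) = f(g^-1 e_i) = \<Sum>_j f(e_j) * (g^-1 e_i)_j *)
definition dual_lattice :: "('g, 'b) monoid_scheme \<Rightarrow> 'g glat \<Rightarrow> 'g glat" where
  "dual_lattice G M = (case M of (n, a) \<Rightarrow>
     (n, \<lambda>g v i. if i < n then (\<Sum>j<n. v j * a (inv\<^bsub>G\<^esub> g) (\<lambda>k. if k = i then 1 else 0) j) else 0))"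

(* index set of the permutation basis of \<Oplus>_{H\<in>\<H>} Z[G/H]: pairs (H, gH) *)
definition coset_basis :: "('g, 'b) monoid_scheme \<Rightarrow> 'g set set \<Rightarrow> ('g set \<times> 'g set) set" where
  "coset_basis G \<H> = {(H, g <#\<^bsub>G\<^esub> H) | H g. H \<in> \<H> \<and> g \<in> carrier G}"

definition perm_vecs :: "('g, 'b) monoid_scheme \<Rightarrow> 'g set set \<Rightarrow> ('g set \<times> 'g set \<Rightarrow> int) set" where
  "perm_vecs G \<H> = {x. \<forall>b. b \<notin> coset_basis G \<H> \<longrightarrow> x b = 0}"

definition perm_act :: "('g, 'b) monoid_scheme \<Rightarrow> 'g set set \<Rightarrow> 'g \<Rightarrow> ('g set \<times> 'g set \<Rightarrow> int) \<Rightarrow> ('g set \<times> 'g set \<Rightarrow> int)" where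
  "perm_act G \<H> g x = (\<lambda>(H, C). if (H, C) \<in> coset_basis G \<H> then x (H, inv\<^bsub>G\<^esub> g <#\<^bsub>G\<^esub> C) else 0)"

(* M is (a coordinate model of) I_{G/\<H>} = ker(\<Oplus>_H Z[G/H] -> Z) *)
definition is_I_lattice :: "('g, 'b) monoid_scheme \<Rightarrow> 'g set set \<Rightarrow> 'g glat \<Rightarrow> bool" where
  "is_I_lattice G \<H> M = (glattice G M \<and> (\<exists>f.
     (\<forall>v\<in>vecs (fst M). f v \<in> perm_vecs G \<H>) \<and>
     (\<forall>v\<in>vecs (fst M). \<forall>w\<in>vecs (fst M). f (\<lambda>i. v i + w i) = (\<lambda>b. f v b + f w b)) \<and>
     (\<forall>g\<in>carrier G. \<forall>v\<in>vecs (fst M). f (snd M g v) = perm_act G \<H> g (f v)) \<and>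
     inj_on f (vecs (fst M)) \<and>
     f ` vecs (fst M) = {x \<in> perm_vecs G \<H>. (\<Sum>b\<in>coset_basis G \<H>. x b) = 0}))"

definition dG :: "('g, 'b) monoid_scheme \<Rightarrow> 'g set set \<Rightarrow> nat" where
  "dG G \<H> = Gcd ((\<lambda>H. card (carrier G) div card H) ` \<H>)"

definition reduced :: "'g set set \<Rightarrow> bool" where
  "reduced \<H> = (\<forall>H\<in>\<H>. \<forall>H'\<in>\<H>. H \<subseteq> H' \<longrightarrow> H = H')"

definition core :: "('g, 'b) monoid_scheme \<Rightarrow> 'g set \<Rightarrow> 'g set" where
  "core G H = (\<Inter>g\<in>carrier G. (g <#\<^bsub>G\<^esub> H) #>\<^bsub>G\<^esub> inv\<^bsub>G\<^esub> g)"

definition special :: "('g, 'b) monoid_scheme \<Rightarrow> 'g set set \<Rightarrow> bool" where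
  "special G \<H> = (carrier G \<notin> \<H> \<and> card \<H> \<ge> 2 \<and>
     (\<forall>H\<in>\<H>. \<forall>H'\<in>\<H>. H \<noteq> H' \<longrightarrow>
        core G H <#>\<^bsub>G\<^esub> H' = carrier G \<or> core G H' <#>\<^bsub>G\<^esub> H = carrier G))"

end

theory Submission
  imports Defs "HOL-Library.Function_Algebras" "HOL-Library.Indicator_Function"
    "HOL-Computational_Algebra.Primes" "HOL-Algebra.Left_Coset"
begin

text \<open>
  Suppose that \<open>J\<close> is quasi-invertible.  Dualizing, one gets permutation lattices and an exact
  sequence \<open>0 \<rightarrow> \<int>[Y] \<rightarrow> \<int>[T] \<rightarrow> I \<oplus> M \<rightarrow> 0\<close>, where \<open>I\<close> consists of the vectors of coordinate sum
  zero on the disjoint union \<open>\<Omega>\<close> of the coset spaces.  Let \<open>p ^ k\<close> divide all orbit lengths on \<open>\<Omega>\<close>,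
  with \<open>p\<close> odd or \<open>k = 2\<close>.

  The class of the extension in the second cohomology of \<open>\<int>[Y]\<close> is a family of characters of point
  stabilizers, so its order is detected on a single element \<open>t\<close>: all orbits of \<open>t\<close> on \<open>\<Omega>\<close> have
  length divisible by \<open>p ^ k\<close>.  It remains to treat the group generated by \<open>t\<close> and the normal
  subgroup \<open>N\<close>, enlarged by the largest possible group of powers of \<open>t\<close> such that it still has an
  orbit on \<open>\<Omega>\<close> of length prime to \<open>p\<close>.  Let \<open>E\<close> be the sum over such an orbit.
  Let \<open>v\<close> be an \<open>N\<close>-invariant lift of \<open>t E - E\<close> to \<open>\<int>[T]\<close>.  Because \<open>N\<close> is transitive on the orbit
  of some point \<open>x2\<close>, the lift can be chosen such that its norm over the cyclic quotient vanishes modulo \<open>p\<close> and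
  traces from subgroups of \<open>N\<close> of index divisible by \<open>p\<close>.  Counting each \<open>N\<close>-orbit with its position
  in the cyclic order given by \<open>t\<close> defines a functional \<open>lam\<close> on the \<open>N\<close>-invariants of \<open>I\<close> with
  values modulo \<open>p\<close>; it is \<open>t\<close>-invariant and kills those traces and everything invariant under a
  larger group.  The last point uses that \<open>k = 2\<close> if \<open>p = 2\<close>.  Hence \<open>lam\<close> kills \<open>t E - E\<close>, although
  its value there is the length of the chosen orbit.
\<close>

section \<open>Adjoined powers, translates of functions, orbits and free abelian groups on
  sets\<close>

definition adjoin :: "('g, 'b) monoid_scheme \<Rightarrow> 'g set \<Rightarrow> 'g \<Rightarrow> 'g set" where
  "adjoin G N t = {n \<otimes>\<^bsub>G\<^esub> t [^]\<^bsub>G\<^esub> i | n (i::nat). n \<in> N}"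

text \<open>The left action on integer functions that sends the basis vector at \<open>x\<close> to
  the basis vector at \<open>a g x\<close>.\<close>

definition shift :: "('g, 'b) monoid_scheme \<Rightarrow> ('g \<Rightarrow> 'x \<Rightarrow> 'x) \<Rightarrow> 'g \<Rightarrow> ('x \<Rightarrow> int) \<Rightarrow> 'x \<Rightarrow> int" where
  "shift G a g v = (\<lambda>x. v (a (inv\<^bsub>G\<^esub> g) x))"

definition orb :: "('g \<Rightarrow> 'x \<Rightarrow> 'x) \<Rightarrow> 'g set \<Rightarrow> 'x \<Rightarrow> 'x set" where
  "orb a K x = (\<lambda>k. a k x) ` K"

text \<open>The free abelian group on \<Omega>, kept as functions on the whole type so that its
  addition is the pointwise one.\<close>

definition supported :: "'x set \<Rightarrow> ('x \<Rightarrow> int) set" where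
  "supported \<Omega> = {v. \<forall>x. x \<notin> \<Omega> \<longrightarrow> v x = 0}"

lemma sum_fun_apply: "(\<Sum>i\<in>A. f i) x = (\<Sum>i\<in>A. f i x :: 'b :: comm_monoid_add)"
  by (induction A rule: infinite_finite_induct) auto

lemma supported_0 [simp]: "0 \<in> supported \<Omega>"
  by (simp add: supported_def)

lemma supported_add: "v \<in> supported \<Omega> \<Longrightarrow> w \<in> supported \<Omega> \<Longrightarrow> v + w \<in> supported \<Omega>"
  by (simp add: supported_def)

lemma supported_diff: "v \<in> supported \<Omega> \<Longrightarrow> w \<in> supported \<Omega> \<Longrightarrow> v - w \<in> supported \<Omega>"
  by (simp add: supported_def)

lemma supported_sum: "(\<And>i. i \<in> A \<Longrightarrow> f i \<in> supported \<Omega>) \<Longrightarrow> (\<Sum>i\<in>A. f i) \<in> supported \<Omega>"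
  by (simp add: supported_def sum_fun_apply)

lemma supported_scale: "v \<in> supported \<Omega> \<Longrightarrow> (\<lambda>x. c * v x) \<in> supported \<Omega>"
  by (simp add: supported_def)

lemma supported_div: "v \<in> supported \<Omega> \<Longrightarrow> (\<lambda>x. v x div c) \<in> supported \<Omega>"
  by (simp add: supported_def)

lemma supported_indicator: "S \<subseteq> \<Omega> \<Longrightarrow> indicator S \<in> supported \<Omega>"
  by (auto simp: supported_def indicator_def)

section \<open>Subgroups normalized by an element of a finite group\<close>

locale normalized_subgroup = group G for G (structure) +
  fixes N :: "'a set" and t :: 'a
  assumes fin: "finite (carrier G)" and subN: "subgroup N G" and t_in: "t \<in> carrier G"
    and conj_in: "\<And>n. n \<in> N \<Longrightarrow> t \<otimes> n \<otimes> inv t \<in> N"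
begin

lemma N_in: "n \<in> N \<Longrightarrow> n \<in> carrier G"
  using subN subgroup.mem_carrier by metis

lemma pow_in: "t [^] (i::nat) \<in> carrier G"
  using t_in by simp

lemma pow_push: 
  assumes "n \<in> N" shows "\<exists>n'\<in>N. t [^] (i::nat) \<otimes> n = n' \<otimes> t [^] i"
proof (induction i)
  case 0 then show ?case using assms N_in by auto
next
  case (Suc i)
  then obtain n' where n': "n' \<in> N" "t [^] i \<otimes> n = n' \<otimes> t [^] i" by blast
  have "t [^] Suc i \<otimes> n = t \<otimes> (t [^] i \<otimes> n)"
    using assms N_in t_in nat_pow_Suc2 by (simp add: m_assoc)
  also have "\<dots> = t \<otimes> n' \<otimes> t [^] i" using n' N_in t_in by (simp add: m_assoc)
  also have "\<dots> = (t \<otimes> n' \<otimes> inv t) \<otimes> t [^] Suc i"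
  proof -
    have "inv t \<otimes> t [^] Suc i = t [^] i"
      using t_in nat_pow_Suc2 by (simp add: inv_solve_left')
    then show ?thesis using n' N_in t_in by (simp add: m_assoc del: nat_pow_Suc)
  qed
  finally show ?case using conj_in n' by blast
qed

text \<open>Inverses of powers become powers with natural exponents; this is why
  \<open>adjoin\<close>, which has only such exponents, is closed under inverses.\<close>

lemma inv_pow: "inv (t [^] (i::nat)) = t [^] (order G * i - i)"
proof -
  have o: "order G > 0" using fin by (simp add: order_gt_0_iff_finite)
  have "t [^] (order G * i - i) \<otimes> t [^] i = t [^] (order G * i)"
    using t_in o by (simp add: nat_pow_mult)
  also have "\<dots> = \<one>" using t_in pow_order_eq_1 by (simp add: nat_pow_pow[symmetric])
  finally show ?thesis using t_in inv_equality by simp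
qed

text \<open>The inverse of a power of \<open>t\<close> is again a power, so \<open>pow_push\<close>
  applies to it. The one-sided hypothesis \<open>conj_in\<close> thus works in both
  directions.\<close>

lemma pow_pull: 
  assumes "n \<in> N" shows "\<exists>n'\<in>N. n \<otimes> t [^] (i::nat) = t [^] i \<otimes> n'"
proof -
  obtain n' where n': "n' \<in> N" "inv (t [^] i) \<otimes> n = n' \<otimes> inv (t [^] i)"
    using pow_push[OF assms] inv_pow by metis
  have "n \<otimes> t [^] i = t [^] i \<otimes> (inv (t [^] i) \<otimes> n) \<otimes> t [^] i"
    using assms N_in t_in by (simp add: m_assoc[symmetric])
  also have "\<dots> = t [^] i \<otimes> n'" using n' N_in t_in by (simp add: m_assoc)
  finally show ?thesis using n' by blast
qed

lemma adjoin_subgroup: "subgroup (adjoin G N t) G"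
proof (rule subgroupI)
  show "adjoin G N t \<subseteq> carrier G" using N_in t_in by (auto simp: adjoin_def)
  have "\<one> \<otimes> t [^] (0::nat) \<in> adjoin G N t"
    unfolding adjoin_def using subN subgroup.one_closed by blast
  then show "adjoin G N t \<noteq> {}" by blast
next
  fix x assume "x \<in> adjoin G N t"
  then obtain n and i :: nat where x: "x = n \<otimes> t [^] i" "n \<in> N" by (auto simp: adjoin_def)
  have "inv x = t [^] (order G * i - i) \<otimes> inv n"
    using x N_in t_in by (simp add: inv_mult_group inv_pow)
  moreover have "inv n \<in> N" using x subN subgroup.m_inv_closed by metis
  ultimately show "inv x \<in> adjoin G N t"
    unfolding adjoin_def using pow_push by fastforce
next
  fix x y assume "x \<in> adjoin G N t" "y \<in> adjoin G N t"
  then obtain n n' and i j :: nat where x: "x = n \<otimes> t [^] i" "n \<in> N" "y = n' \<otimes> t [^] j" "n' \<in> N"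
    by (auto simp: adjoin_def)
  obtain n'' where n'': "n'' \<in> N" "t [^] i \<otimes> n' = n'' \<otimes> t [^] i" using pow_push x by blast
  have "x \<otimes> y = n \<otimes> (t [^] i \<otimes> n') \<otimes> t [^] j" using x N_in t_in by (simp add: m_assoc)
  also have "\<dots> = (n \<otimes> n'') \<otimes> t [^] (i + j)"
    using x n'' N_in t_in by (simp add: m_assoc nat_pow_mult[symmetric])
  finally show "x \<otimes> y \<in> adjoin G N t"
    unfolding adjoin_def using subgroup.m_closed[OF subN] x n'' by blast
qed

lemma adjoin_mem: "n \<in> N \<Longrightarrow> n \<otimes> t [^] (i::nat) \<in> adjoin G N t"
  by (auto simp: adjoin_def)

lemma N_subset_adjoin: "N \<subseteq> adjoin G N t"
proof
  fix n assume "n \<in> N"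
  then show "n \<in> adjoin G N t" using adjoin_mem[of n 0] N_in by simp
qed

lemma pow_in_adjoin: "t [^] (i::nat) \<in> adjoin G N t"
  using adjoin_mem[of \<one> i] subgroup.one_closed[OF subN] t_in by simp

lemma normalized_pow: "normalized_subgroup G N (t [^] (j::nat))"
proof (intro normalized_subgroup.intro normalized_subgroup_axioms.intro)
  fix n assume n: "n \<in> N"
  obtain n' where n': "n' \<in> N" "t [^] j \<otimes> n = n' \<otimes> t [^] j" using pow_push n by blast
  then show "t [^] j \<otimes> n \<otimes> inv (t [^] j) \<in> N" using t_in N_in by (simp add: m_assoc)
qed (use fin subN t_in in simp_all)

end

section \<open>Finite sets with a group action and integer functions on them\<close>

locale finite_gset = group G for G (structure) +
  fixes \<Omega> :: "'x set" and a :: "'a \<Rightarrow> 'x \<Rightarrow> 'x"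
  assumes fin_set: "finite \<Omega>"
    and act_in: "\<And>g x. g \<in> carrier G \<Longrightarrow> x \<in> \<Omega> \<Longrightarrow> a g x \<in> \<Omega>"
    and act_one [simp]: "\<And>x. a \<one> x = x"
    and act_mult: "\<And>g h x. g \<in> carrier G \<Longrightarrow> h \<in> carrier G \<Longrightarrow> a (g \<otimes> h) x = a g (a h x)"
begin

abbreviation sh where "sh \<equiv> shift G a"

lemma act_inv1 [simp]: "g \<in> carrier G \<Longrightarrow> a (inv g) (a g x) = x"
  by (metis act_mult act_one inv_closed l_inv)

lemma act_inv2 [simp]: "g \<in> carrier G \<Longrightarrow> a g (a (inv g) x) = x"
  by (metis act_mult act_one inv_closed r_inv)

lemma act_eq_iff: "g \<in> carrier G \<Longrightarrow> a g x = a g y \<longleftrightarrow> x = y"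
  by (metis act_inv1)

lemma act_in_iff: "g \<in> carrier G \<Longrightarrow> a g x \<in> \<Omega> \<longleftrightarrow> x \<in> \<Omega>"
  by (metis act_in act_inv1 inv_closed)

lemma act_bij: "g \<in> carrier G \<Longrightarrow> bij_betw (a g) \<Omega> \<Omega>"
  by (rule bij_betw_byWitness[where f' = "a (inv g)"]) (auto simp: act_in)

lemma sh_one [simp]: "sh \<one> v = v"
  by (simp add: shift_def)

lemma sh_mult: "g \<in> carrier G \<Longrightarrow> h \<in> carrier G \<Longrightarrow> sh (g \<otimes> h) v = sh g (sh h v)"
  by (simp add: shift_def inv_mult_group act_mult)

lemma sh_add: "sh g (v + w) = sh g v + sh g w" by (auto simp: shift_def)
lemma sh_diff: "sh g (v - w) = sh g v - sh g w" by (auto simp: shift_def)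
lemma sh_minus: "sh g (- w) = - sh g w" by (auto simp: shift_def)
lemma sh_sum: "sh g (\<Sum>i\<in>A. f i) = (\<Sum>i\<in>A. sh g (f i))" by (auto simp: shift_def sum_fun_apply)
lemma sh_scale: "sh g (\<lambda>x. c * v x) = (\<lambda>x. c * sh g v x)" by (auto simp: shift_def)

lemma sh_supported: "g \<in> carrier G \<Longrightarrow> v \<in> supported \<Omega> \<Longrightarrow> sh g v \<in> supported \<Omega>"
  by (auto simp: supported_def shift_def act_in_iff)

lemma sh_apply_act: "g \<in> carrier G \<Longrightarrow> sh g v (a g x) = v x"
  by (simp add: shift_def)

lemma sh_fixed_apply: 
  assumes "g \<in> carrier G" "a g x = x" shows "sh g v x = v x"
  using sh_apply_act[of g v x] assms by simp

lemma sh_eq_iff: "g \<in> carrier G \<Longrightarrow> sh g v = v \<longleftrightarrow> (\<forall>x. v (a g x) = v x)"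
  by (metis (no_types, opaque_lifting) act_inv2 ext sh_apply_act)

lemma sum_sh: "g \<in> carrier G \<Longrightarrow> (\<Sum>x\<in>\<Omega>. sh g v x * w x) = (\<Sum>x\<in>\<Omega>. v x * w (a g x))"
  using sum.reindex_bij_betw[OF act_bij[of g], of "\<lambda>x. sh g v x * w x"] by (simp add: sh_apply_act)

lemma sum_sh_1: "g \<in> carrier G \<Longrightarrow> (\<Sum>x\<in>\<Omega>. sh g v x) = (\<Sum>x\<in>\<Omega>. v x)"
  using sum_sh[of g v "\<lambda>_. 1"] by simp

lemma sh_telescope:
  assumes "g \<in> carrier G"
  shows "(\<Sum>i<n. sh (g [^] i) (sh g v - v)) = sh (g [^] (n::nat)) v - v"
proof -
  have "sh (g [^] i) (sh g v - v) = sh (g [^] Suc i) v - sh (g [^] i) v" for i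
    using assms by (simp add: sh_diff sh_mult[symmetric])
  then show ?thesis using sum_lessThan_telescope[of "\<lambda>i. sh (g [^] i) v" n] by simp
qed

lemma sh_indicator: 
  assumes "g \<in> carrier G" shows "sh g (indicator S) = indicator (a g ` S)"
proof
  fix x
  have "a (inv g) x \<in> S \<longleftrightarrow> x \<in> a g ` S"
    using assms act_inv2[of g x] by force
  then show "sh g (indicator S) x = (indicator (a g ` S) x :: int)"
    by (simp add: shift_def indicator_def)
qed

lemma pow_fix: "g \<in> carrier G \<Longrightarrow> a g x = x \<Longrightarrow> a (g [^] (i::nat)) x = x"
  by (induction i) (auto simp: act_mult)

lemma orb_self: "subgroup K G \<Longrightarrow> x \<in> orb a K x"
  unfolding orb_def using subgroup.one_closed act_one by (metis image_eqI)

lemma orb_subset: "subgroup K G \<Longrightarrow> x \<in> \<Omega> \<Longrightarrow> orb a K x \<subseteq> \<Omega>"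
  by (auto simp: orb_def intro: act_in dest: subgroup.mem_carrier)

lemma finite_orb: "subgroup K G \<Longrightarrow> x \<in> \<Omega> \<Longrightarrow> finite (orb a K x)"
  using fin_set finite_subset orb_subset by metis

lemma orb_eq:
  assumes K: "subgroup K G" and y: "y \<in> orb a K x"
  shows "orb a K y = orb a K x"
proof -
  obtain k where k: "k \<in> K" "y = a k x" using y by (auto simp: orb_def)
  have c: "\<And>h. h \<in> K \<Longrightarrow> h \<in> carrier G" using K subgroup.mem_carrier by metis
  show ?thesis
  proof
    show "orb a K y \<subseteq> orb a K x"
    proof
      fix z assume "z \<in> orb a K y"
      then obtain h where "h \<in> K" "z = a h y" by (auto simp: orb_def)
      then have "z = a (h \<otimes> k) x" "h \<otimes> k \<in> K" using k c K act_mult subgroup.m_closed by metis+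
      then show "z \<in> orb a K x" by (auto simp: orb_def)
    qed
    show "orb a K x \<subseteq> orb a K y"
    proof
      fix z assume "z \<in> orb a K x"
      then obtain h where h: "h \<in> K" "z = a h x" by (auto simp: orb_def)
      have "a (h \<otimes> inv k) y = z" using h k c by (simp add: act_mult)
      moreover have "h \<otimes> inv k \<in> K" using h k K subgroup.m_closed subgroup.m_inv_closed by metis
      ultimately show "z \<in> orb a K y" by (auto simp: orb_def)
    qed
  qed
qed

text \<open>The set \<Omega> is the disjoint union of its \<open>K\<close>-orbits, so divisibility
  can be tested orbit by orbit.\<close>

lemma dvd_sum_orbits:
  assumes K: "subgroup K G" and M: "\<And>x. x \<in> \<Omega> \<Longrightarrow> (M::int) dvd (\<Sum>z\<in>orb a K x. g z)"
  shows "M dvd (\<Sum>x\<in>\<Omega>. g x)"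
proof -
  let ?C = "orb a K ` \<Omega>"
  have U: "\<Union>?C = \<Omega>" using orb_self[OF K] orb_subset[OF K] by blast
  have "sum g (\<Union>?C) = (\<Sum>Q\<in>?C. sum g Q)"
  proof (subst sum.Union_disjoint)
    show "\<forall>Q\<in>?C. finite Q" using finite_orb[OF K] by auto
    show "\<forall>A\<in>?C. \<forall>B\<in>?C. A \<noteq> B \<longrightarrow> A \<inter> B = {}" using orb_eq[OF K] by blast
  qed simp
  moreover have "M dvd (\<Sum>Q\<in>?C. sum g Q)" by (rule dvd_sum) (use M in auto)
  ultimately show ?thesis using U by simp
qed

lemma sum_orb_invariant:
  assumes "\<And>k. k \<in> K \<Longrightarrow> g (a k x) = g x"
  shows "(\<Sum>z\<in>orb a K x. g z) = of_nat (card (orb a K x)) * (g x :: int)"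
proof -
  have "\<And>z. z \<in> orb a K x \<Longrightarrow> g z = g x" using assms by (auto simp: orb_def)
  then show ?thesis by simp
qed

lemma dvd_sum_invariant:
  assumes K: "subgroup K G" and inv: "\<And>k x. k \<in> K \<Longrightarrow> g (a k x) = g x"
    and M: "\<And>x. x \<in> \<Omega> \<Longrightarrow> (M::int) dvd of_nat (card (orb a K x)) * g x"
  shows "M dvd (\<Sum>x\<in>\<Omega>. g x)"
  by (rule dvd_sum_orbits[OF K]) (use M inv sum_orb_invariant[of K g] in simp)

text \<open>The pointwise quotient of minus the sum of all values by the group order splits an
  integral cocycle, because that sum changes under the action by multiples of the order.\<close>

lemma cocycle_coboundary:
  assumes K: "subgroup K G" "finite K"
    and c: "\<And>k. k \<in> K \<Longrightarrow> c k \<in> supported \<Omega>"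
    and coc: "\<And>k l. k \<in> K \<Longrightarrow> l \<in> K \<Longrightarrow> c (k \<otimes> l) = c k + sh k (c l)"
  shows "\<exists>w\<in>supported \<Omega>. \<forall>k\<in>K. c k = sh k w - w"
proof -
  define Z where "Z = - (\<Sum>l\<in>K. c l)"
  define w where "w = (\<lambda>x. Z x div int (card K))"
  have Kc: "\<And>k. k \<in> K \<Longrightarrow> k \<in> carrier G" using K subgroup.mem_carrier by metis
  have pos: "card K > 0" using K subgroup.one_closed card_gt_0_iff by blast
  have Zs: "Z \<in> supported \<Omega>" unfolding Z_def using supported_sum[of K c \<Omega>] c by (simp add: supported_def)
  \<comment> \<open>Left translation by \<open>k\<close> permutes \<open>K\<close>, so the cocycle
    identity turns the translated sum into the old one plus \<open>card K\<close> copies of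
    \<open>c k\<close>.\<close>
  have *: "sh k Z x = Z x + int (card K) * c k x" if k: "k \<in> K" for k x
  proof -
    have bij: "bij_betw ((\<otimes>) k) K K"
    proof (rule bij_betw_byWitness[where f' = "(\<otimes>) (inv k)"])
      show "\<forall>a\<in>K. inv k \<otimes> (k \<otimes> a) = a" using k Kc by (simp add: m_assoc[symmetric])
      show "\<forall>a\<in>K. k \<otimes> (inv k \<otimes> a) = a" using k Kc by (simp add: m_assoc[symmetric])
      show "(\<otimes>) k ` K \<subseteq> K" using k subgroup.m_closed[OF K(1)] by blast
      show "(\<otimes>) (inv k) ` K \<subseteq> K" using k subgroup.m_closed[OF K(1)] subgroup.m_inv_closed[OF K(1)] by blast
    qed
    have "sh k Z = - (\<Sum>l\<in>K. sh k (c l))" by (simp add: Z_def sh_minus sh_sum)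
    also have "\<dots> = - (\<Sum>l\<in>K. c (k \<otimes> l) - c k)" using coc k by simp
    also have "\<dots> = - (\<Sum>l\<in>K. c (k \<otimes> l)) + (\<Sum>l\<in>K. c k)" by (simp add: sum_subtractf)
    also have "(\<Sum>l\<in>K. c (k \<otimes> l)) = (\<Sum>l\<in>K. c l)" using sum.reindex_bij_betw[OF bij, of c] .
    finally have "sh k Z = Z + (\<Sum>l\<in>K. c k)" unfolding Z_def .
    then show ?thesis by (simp add: sum_fun_apply)
  qed
  have "c k = sh k w - w" if k: "k \<in> K" for k
  proof
    fix x
    have "sh k w x = sh k Z x div int (card K)" by (simp add: w_def shift_def)
    also have "\<dots> = w x + c k x" using *[OF k] pos by (simp add: w_def)
    finally show "c k x = (sh k w - w) x" by simp
  qed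
  moreover have "w \<in> supported \<Omega>" unfolding w_def using Zs by (rule supported_div)
  ultimately show ?thesis by blast
qed

end

section \<open>Orbits of a cyclic extension of a subgroup\<close>

text \<open>Division with remainder: the remainder of a member by the least positive member is a
  member too, hence zero.\<close>

lemma nat_closed_under_diff_iff_dvd:
  fixes P :: "nat \<Rightarrow> bool"
  assumes ex: "P m" "m > 0" and add: "\<And>i j. P i \<Longrightarrow> P j \<Longrightarrow> P (i + j)"
    and cancel: "\<And>i j. P (i + j) \<Longrightarrow> P i \<Longrightarrow> P j" and zero: "P 0"
  defines "k \<equiv> LEAST k. k > 0 \<and> P k"
  shows "k > 0" "P i \<longleftrightarrow> k dvd i"
proof -
  have k: "k > 0 \<and> P k" unfolding k_def by (rule LeastI[of _ m]) (use ex in auto)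
  then show "k > 0" by simp
  have mult: "P (k * j)" for j by (induction j) (use k zero add in auto)
  have "k dvd i" if i: "P i"
  proof -
    have "P (k * (i div k) + i mod k)" using i by simp
    then have "P (i mod k)" using cancel mult by blast
    moreover have lt: "i mod k < k" using k by simp
    have "\<not> (i mod k > 0 \<and> P (i mod k))" using lt unfolding k_def by (rule not_less_Least)
    ultimately have "i mod k = 0" by simp
    then show ?thesis by (simp add: dvd_eq_mod_eq_0)
  qed
  then show "P i \<longleftrightarrow> k dvd i" using mult by (auto elim: dvdE)
qed

locale normalized_gset = normalized_subgroup G N t + finite_gset G \<Omega> a
  for G :: "('a, 'm) monoid_scheme" (structure) and N t \<Omega> and a :: "'a \<Rightarrow> 'x \<Rightarrow> 'x"
begin

abbreviation A where "A \<equiv> adjoin G N t"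

text \<open>The cycle length of \<open>t\<close> on the set of \<open>N\<close>-orbits, at the orbit
  of \<open>x\<close>.\<close>

definition per :: "'x \<Rightarrow> nat" where
  "per x = (LEAST k. k > 0 \<and> a (t [^] k) x \<in> orb a N x)"

text \<open>As \<open>t\<close> normalizes \<open>N\<close>, its powers permute the
  \<open>N\<close>-orbits. The properties of \<open>per\<close> rest on this.\<close>

lemma pow_orb: "z \<in> orb a N x \<longleftrightarrow> a (t [^] (i::nat)) z \<in> orb a N (a (t [^] i) x)"
proof
  assume "z \<in> orb a N x"
  then obtain n where n: "n \<in> N" "z = a n x" by (auto simp: orb_def)
  then obtain n' where n': "n' \<in> N" "t [^] i \<otimes> n = n' \<otimes> t [^] i" using pow_push by blast
  then have "a (t [^] i) z = a n' (a (t [^] i) x)" using n N_in pow_in act_mult by metis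
  then show "a (t [^] i) z \<in> orb a N (a (t [^] i) x)" using n' by (auto simp: orb_def)
next
  assume "a (t [^] i) z \<in> orb a N (a (t [^] i) x)"
  then obtain n where n: "n \<in> N" "a (t [^] i) z = a n (a (t [^] i) x)" by (auto simp: orb_def)
  then obtain n' where n': "n' \<in> N" "n \<otimes> t [^] i = t [^] i \<otimes> n'" using pow_pull by blast
  then have "a (t [^] i) z = a (t [^] i) (a n' x)" using n N_in pow_in act_mult by metis
  then have "z = a n' x" using pow_in act_eq_iff by metis
  then show "z \<in> orb a N x" using n' by (auto simp: orb_def)
qed

lemma orb_sym: "y \<in> orb a N x \<longleftrightarrow> orb a N y = orb a N x"
  using orb_eq[OF subN] orb_self[OF subN] by metis

lemma act_pow_add: "a (t [^] (i + j :: nat)) x = a (t [^] i) (a (t [^] j) x)"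
  using act_mult pow_in nat_pow_mult t_in by metis

lemma
  shows per_pos: "per x > 0" 
    and per_iff: "a (t [^] i) x \<in> orb a N x \<longleftrightarrow> per x dvd i"
proof -
  have o: "order G > 0" using fin by (simp add: order_gt_0_iff_finite)
  have 0: "a (t [^] order G) x \<in> orb a N x" using pow_order_eq_1 t_in orb_self[OF subN] by simp
  have 1: "a (t [^] (i + j)) x \<in> orb a N x" 
    if "a (t [^] i) x \<in> orb a N x" "a (t [^] j) x \<in> orb a N x" for i j :: nat
    using that pow_orb[of "a (t [^] j) x" x i] by (metis act_pow_add orb_sym)
  have 2: "a (t [^] j) x \<in> orb a N x" 
    if "a (t [^] (i + j)) x \<in> orb a N x" "a (t [^] i) x \<in> orb a N x" for i j :: nat
    using that pow_orb[of "a (t [^] j) x" x i] by (metis act_pow_add orb_sym)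
  have 3: "a (t [^] (0::nat)) x \<in> orb a N x" using orb_self[OF subN] by simp
  note L = nat_closed_under_diff_iff_dvd[of "\<lambda>i. a (t [^] i) x \<in> orb a N x" "order G", OF 0 o]
  show "per x > 0" unfolding per_def by (rule L(1)) (use 1 2 3 in blast)+
  show "a (t [^] i) x \<in> orb a N x \<longleftrightarrow> per x dvd i"
    unfolding per_def by (rule L(2)) (use 1 2 3 in blast)+
qed

lemma per_eqI: "(\<And>i. a (t [^] (i::nat)) x \<in> orb a N x \<longleftrightarrow> a (t [^] i) y \<in> orb a N y) \<Longrightarrow> per x = per y"
  by (simp add: per_def)

lemma per_N: "y \<in> orb a N x \<Longrightarrow> per y = per x"
  by (rule per_eqI) (metis pow_orb orb_sym)

lemma per_pow: "per (a (t [^] (i::nat)) x) = per x"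
proof (rule per_eqI)
  fix j :: nat
  have "a (t [^] j) (a (t [^] i) x) = a (t [^] i) (a (t [^] j) x)"
    using act_pow_add by (metis add.commute)
  then show "a (t [^] j) (a (t [^] i) x) \<in> orb a N (a (t [^] i) x) \<longleftrightarrow> a (t [^] j) x \<in> orb a N x"
    using pow_orb by metis
qed

lemma orb_adjoin_iff: "y \<in> orb a A x \<longleftrightarrow> (\<exists>i. y \<in> orb a N (a (t [^] (i::nat)) x))"
proof
  assume "y \<in> orb a A x"
  then obtain n and i :: nat where "n \<in> N" "y = a (n \<otimes> t [^] i) x" by (auto simp: orb_def adjoin_def)
  then have "y = a n (a (t [^] i) x)" "n \<in> N" using act_mult N_in pow_in by metis+
  then show "\<exists>i. y \<in> orb a N (a (t [^] (i::nat)) x)" by (auto simp: orb_def)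
next
  assume "\<exists>i. y \<in> orb a N (a (t [^] (i::nat)) x)"
  then obtain i :: nat and n where "n \<in> N" "y = a n (a (t [^] i) x)" by (auto simp: orb_def)
  then have "y = a (n \<otimes> t [^] i) x" "n \<otimes> t [^] i \<in> A" using act_mult N_in pow_in adjoin_mem by metis+
  then show "y \<in> orb a A x" by (auto simp: orb_def)
qed

lemma per_A: "y \<in> orb a A x \<Longrightarrow> per y = per x"
  using orb_adjoin_iff per_N per_pow by metis

lemma pow_dvd_diff:
  assumes "a (t [^] (i::nat)) x \<in> orb a N (a (t [^] (j::nat)) x)"
  shows "int (per x) dvd int i - int j"
proof -
  have *: "int (per x) dvd int l - int k"
    if "k \<le> l" "a (t [^] (l::nat)) x \<in> orb a N (a (t [^] (k::nat)) x)" for k l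
  proof -
    have "a (t [^] (l - k)) (a (t [^] k) x) \<in> orb a N (a (t [^] k) x)"
      using that act_pow_add[of "l - k" k x] by simp
    then have "per x dvd l - k" using per_iff per_pow by metis
    then show ?thesis using that by (metis int_dvd_int_iff of_nat_diff)
  qed
  show ?thesis
  proof (cases "j \<le> i")
    case True then show ?thesis using * assms by blast
  next
    case False
    have "a (t [^] j) x \<in> orb a N (a (t [^] i) x)" using assms orb_sym by metis
    then show ?thesis using *[of i j] False by (simp add: dvd_diff_commute)
  qed
qed

lemma orb_pow_mod: "orb a N (a (t [^] (i::nat)) x) = orb a N (a (t [^] (i mod per x)) x)"
proof -
  have "a (t [^] (per x * (i div per x))) x \<in> orb a N x" by (simp add: per_iff)
  then have "a (t [^] (i mod per x)) (a (t [^] (per x * (i div per x))) x)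
      \<in> orb a N (a (t [^] (i mod per x)) x)"
    using pow_orb by blast
  then show ?thesis by (simp add: act_pow_add[symmetric] orb_sym add.commute)
qed

lemma orb_adjoin: "orb a A x = (\<Union>i<per x. orb a N (a (t [^] i) x))"
proof -
  have "\<exists>j<per x. y \<in> orb a N (a (t [^] j) x)" if "y \<in> orb a N (a (t [^] i) x)" for y and i :: nat
    using that orb_pow_mod[of i x] per_pos[of x] by (intro exI[of _ "i mod per x"]) auto
  then show ?thesis by (auto simp: orb_adjoin_iff set_eq_iff)
qed

lemma orb_pow_image: "orb a N (a (t [^] (i::nat)) x) = a (t [^] i) ` orb a N x"
proof -
  have "y \<in> a (t [^] i) ` orb a N x" if "y \<in> orb a N (a (t [^] i) x)" for y
  proof -
    have "a (t [^] i) (a (inv (t [^] i)) y) = y" using pow_in by simp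
    then show ?thesis using that pow_orb[of "a (inv (t [^] i)) y" x i] by (metis image_eqI)
  qed
  then show ?thesis using pow_orb[of _ x i] by blast
qed

lemma card_orb_pow: "card (orb a N (a (t [^] (i::nat)) x)) = card (orb a N x)"
  unfolding orb_pow_image by (rule card_image) (use act_eq_iff pow_in in \<open>auto simp: inj_on_def\<close>)

lemma card_orb_N: "y \<in> orb a N x \<Longrightarrow> card (orb a N y) = card (orb a N x)"
  using orb_sym by metis

text \<open>The orbit under \<open>A\<close> falls into \<open>per x\<close> disjoint
  \<open>N\<close>-orbits of equal size, reached by the powers of \<open>t\<close> below
  \<open>per x\<close>.\<close>

lemma sum_orb_adjoin:
  assumes x: "x \<in> \<Omega>" and g: "\<And>n x. n \<in> N \<Longrightarrow> g (a n x) = (g x :: int)"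
  shows "(\<Sum>z\<in>orb a A x. g z) = int (card (orb a N x)) * (\<Sum>i<per x. g (a (t [^] i) x))"
proof -
  have "(\<Sum>z\<in>orb a A x. g z) = (\<Sum>i<per x. \<Sum>z\<in>orb a N (a (t [^] i) x). g z)"
    unfolding orb_adjoin
  proof (rule sum.UNION_disjoint)
    show "\<forall>i\<in>{..<per x}. finite (orb a N (a (t [^] i) x))"
      using finite_orb[OF subN] act_in pow_in x by blast
    show "\<forall>i\<in>{..<per x}. \<forall>j\<in>{..<per x}. i \<noteq> j \<longrightarrow>
        orb a N (a (t [^] i) x) \<inter> orb a N (a (t [^] j) x) = {}"
    proof (intro ballI impI)
      fix i j assume ij: "i \<in> {..<per x}" "j \<in> {..<per x}" "i \<noteq> j"
      show "orb a N (a (t [^] i) x) \<inter> orb a N (a (t [^] j) x) = {}"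
      proof (rule ccontr)
        assume "orb a N (a (t [^] i) x) \<inter> orb a N (a (t [^] j) x) \<noteq> {}"
        then have "orb a N (a (t [^] i) x) = orb a N (a (t [^] j) x)" using orb_sym by (metis disjoint_iff)
        then have "int (per x) dvd int i - int j" using pow_dvd_diff orb_sym by blast
        \<comment> \<open>Distinct indices below \<open>per x\<close> differ by a nonzero number
          smaller than \<open>per x\<close>, which \<open>per x\<close> cannot divide.\<close>
        then show False using ij zdvd_not_zless[of "int i - int j" "int (per x)"]
            zdvd_not_zless[of "int j - int i" "int (per x)"] 
          by (cases "i < j") (auto simp: dvd_diff_commute)
      qed
    qed
  qed simp
  also have "\<dots> = (\<Sum>i<per x. int (card (orb a N x)) * g (a (t [^] i) x))"
    using sum_orb_invariant[of N g] g card_orb_pow by simp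
  finally show ?thesis by (simp add: sum_distrib_left)
qed

lemma card_orb_adjoin: "x \<in> \<Omega> \<Longrightarrow> card (orb a A x) = card (orb a N x) * per x"
proof -
  assume "x \<in> \<Omega>"
  then have "int (card (orb a A x)) = int (card (orb a N x)) * int (per x)"
    using sum_orb_adjoin[of x "\<lambda>_. 1"] by simp
  then show ?thesis by (metis of_nat_eq_iff of_nat_mult)
qed

text \<open>Choose a representative in each \<open>A\<close>-orbit and count how many steps of
  \<open>t\<close> lead from its \<open>N\<close>-orbit to that of \<open>x\<close>. Steps are
  determined only modulo \<open>per x\<close>, hence the congruence.\<close>

lemma ex_label:
  "\<exists>l :: 'x \<Rightarrow> int. (\<forall>n\<in>N. \<forall>x. l (a n x) = l x) \<and>
     (\<forall>x (i::nat). int (per x) dvd l (a (t [^] i) x) - l x - int i)"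
proof -
  define r where "r x = (SOME z. z \<in> orb a A x)" for x
  define k where "k x = (LEAST i. x \<in> orb a N (a (t [^] (i::nat)) (r x)))" for x
  have r: "r x \<in> orb a A x" for x
    unfolding r_def using orb_self[OF adjoin_subgroup] by (rule someI)
  have k: "x \<in> orb a N (a (t [^] k x) (r x))" for x
  proof -
    have "x \<in> orb a A (r x)" using r orb_eq[OF adjoin_subgroup] orb_self[OF adjoin_subgroup] by metis
    then have "\<exists>i::nat. x \<in> orb a N (a (t [^] i) (r x))" using orb_adjoin_iff by blast
    then show ?thesis unfolding k_def by (rule LeastI_ex)
  qed
  have rA: "r y = r x" if "y \<in> orb a A x" for x y
    using orb_eq[OF adjoin_subgroup that] by (simp add: r_def)
  have nA: "a n x \<in> orb a A x" if "n \<in> N" for n x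
    using that N_subset_adjoin by (auto simp: orb_def)
  have tA: "a (t [^] i) x \<in> orb a A x" for x and i :: nat
    using pow_in_adjoin by (auto simp: orb_def)
  have "k (a n x) = k x" if n: "n \<in> N" for n x
  proof -
    have "a n x \<in> orb a N x" using n by (auto simp: orb_def)
    then have "a n x \<in> orb a N z \<longleftrightarrow> x \<in> orb a N z" for z using orb_sym by metis
    then show ?thesis unfolding k_def using rA[OF nA[OF n, of x]] by simp
  qed
  moreover have "int (per x) dvd int (k (a (t [^] i) x)) - int (k x) - int i" for x and i :: nat
  proof -
    have "a (t [^] i) x \<in> orb a N (a (t [^] i) (a (t [^] k x) (r x)))" using k pow_orb by blast
    then have 1: "a (t [^] i) x \<in> orb a N (a (t [^] (i + k x)) (r x))" by (simp add: act_pow_add)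
    have "a (t [^] i) x \<in> orb a N (a (t [^] k (a (t [^] i) x)) (r x))"
      using k[of "a (t [^] i) x"] rA[OF tA[of i x]] by simp
    then have "a (t [^] k (a (t [^] i) x)) (r x) \<in> orb a N (a (t [^] (i + k x)) (r x))" 
      using 1 orb_sym by metis
    then have "int (per (r x)) dvd int (k (a (t [^] i) x)) - int (i + k x)" by (rule pow_dvd_diff)
    then show ?thesis using per_A[OF r, of x] by (simp add: algebra_simps)
  qed
  ultimately show ?thesis by (intro exI[of _ "\<lambda>x. int (k x)"]) simp
qed

end

context finite_gset
begin

text \<open>If \<open>p\<close> divided the length of every cycle of \<open>h\<close> on
  \<open>S\<close>, it would divide the cardinality of \<open>S\<close>. The exponent
  \<open>r\<close> is the length of a cycle for which this fails.\<close>

lemma ex_pow_fixing: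
  assumes fin: "finite (carrier G)" and h: "h \<in> carrier G" and S: "S \<subseteq> \<Omega>" and hS: "\<And>x. x \<in> S \<Longrightarrow> a h x \<in> S"
    and p: "\<not> p dvd card S"
  shows "\<exists>x\<in>S. \<exists>r::nat. \<not> p dvd r \<and> a (h [^] r) x = x"
proof -
  \<comment> \<open>With the trivial subgroup in place of \<open>N\<close>, \<open>per\<close> is
    the ordinary cycle length of \<open>h\<close>.\<close>
  interpret C: normalized_gset G "{\<one>}" h \<Omega> a
    by unfold_locales (use fin h triv_subgroup in \<open>auto simp: subgroup_def\<close>)
  have orb1: "orb a {\<one>} x = {x}" for x by (simp add: orb_def)
  have fixp: "a (h [^] C.per x) x = x" for x
    using C.per_iff[of "C.per x" x] orb1 by simp
  have powS: "a (h [^] i) x \<in> S" if "x \<in> S" for x and i :: nat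
    using that by (induction i arbitrary: x) (use hS h in \<open>auto simp: act_mult\<close>)
  have orbS: "orb a C.A x \<subseteq> S" if "x \<in> S" for x
    using that powS orb1 by (auto simp: C.orb_adjoin)
  have "int p dvd (\<Sum>z\<in>\<Omega>. indicator S z)" if *: "\<forall>x\<in>S. p dvd C.per x"
  proof (rule dvd_sum_orbits[OF C.adjoin_subgroup])
    fix x assume x: "x \<in> \<Omega>"
    show "int p dvd (\<Sum>z\<in>orb a C.A x. indicator S z)"
    proof (cases "x \<in> S")
      case True
      have "(\<Sum>z\<in>orb a C.A x. indicator S z) = (\<Sum>z\<in>orb a C.A x. 1::int)"
        by (rule sum.cong) (use orbS[OF True] in auto)
      also have "\<dots> = int (C.per x)" using C.card_orb_adjoin[OF x] orb1 by simp
      finally show ?thesis using * True by simp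
    next
      case False
      have "z \<notin> S" if "z \<in> orb a C.A x" for z
        using orbS[of z] orb_eq[OF C.adjoin_subgroup that] orb_self[OF C.adjoin_subgroup] False by blast
      then have "(\<Sum>z\<in>orb a C.A x. indicator S z) = (0::int)" by (intro sum.neutral) auto
      then show ?thesis by simp
    qed
  qed
  moreover have "(\<Sum>z\<in>\<Omega>. indicator S z) = int (card S)"
    using S fin_set by (simp add: indicator_def sum.If_cases Int_absorb1)
  ultimately have "\<exists>x\<in>S. \<not> p dvd C.per x" using p by auto
  then show ?thesis using fixp by blast
qed

end

section \<open>Permutation resolutions\<close>

text \<open>The number \<open>r\<close> contains at most \<open>k - 1\<close> factors
  \<open>p\<close>, and its part prime to \<open>p\<close> is invertible modulo
  \<open>p ^ e\<close>.\<close>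

lemma prime_power_dvd_cancel:
  fixes p k e r :: nat and u :: int
  assumes p: "Factorial_Ring.prime p" and r: "\<not> p ^ k dvd r" and d: "int (p ^ e) dvd int r * u"
  shows "int (p ^ e) dvd int (p ^ (k - 1)) * u"
proof -
  have r0: "r \<noteq> 0" using r by (metis dvd_0_right)
  obtain i s where rs: "r = p ^ i * s" "\<not> p dvd s"
    using multiplicity_decompose'[of r p] r0 p not_prime_unit by metis
  have "i < k" using r rs le_imp_power_dvd by (metis dvd_mult2 leI)
  have "int (p ^ e) dvd int s * (int (p ^ i) * u)" using d rs by (simp add: mult.assoc mult.left_commute)
  moreover have "coprime (int (p ^ e)) (int s)"
    using rs p prime_imp_coprime by (metis coprime_int_iff coprime_power_left_iff)
  ultimately have "int (p ^ e) dvd int (p ^ i) * u" using coprime_dvd_mult_right_iff by blast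
  moreover have "int (p ^ i) dvd int (p ^ (k - 1))" using \<open>i < k\<close> by (simp add: le_imp_power_dvd)
  ultimately show ?thesis by (metis dvd_trans mult_dvd_mono dvd_refl)
qed

text \<open>\<open>ma\<close> is the matrix of the injection \<int>[Y] \<rightarrow> \<int>[T],
  \<open>mq\<close> that of the map from \<int>[T] to the vectors of sum zero on \<Omega>. The other
  summand of the quotient matters only through the vanishing of a component, so the relation
  \<open>Rel\<close> (with \<open>Rel w v\<close> for a lift \<open>v\<close> of
  \<open>(w, 0)\<close>) replaces the quotient map.\<close>

locale permutation_resolution =
  X: finite_gset G \<Omega> aX + T: finite_gset G T aT + Y: finite_gset G Y aY
  for G :: "('g, 'm) monoid_scheme" (structure)
    and \<Omega> :: "'x set" and aX and T :: "'t set" and aT and Y :: "'y set" and aY +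
  fixes Rel :: "('x \<Rightarrow> int) \<Rightarrow> ('t \<Rightarrow> int) \<Rightarrow> bool"
    and ma :: "'t \<Rightarrow> 'y \<Rightarrow> int" and mq :: "'x \<Rightarrow> 't \<Rightarrow> int"
  assumes finG: "finite (carrier G)"
    and ma_equiv: "\<And>g \<tau> y. g \<in> carrier G \<Longrightarrow> ma (aT g \<tau>) (aY g y) = ma \<tau> y"
    and ma_inj: "\<And>u. u \<in> supported Y \<Longrightarrow> (\<And>\<tau>. (\<Sum>y\<in>Y. ma \<tau> y * u y) = 0) \<Longrightarrow> u = 0"
    and mq_equiv: "\<And>g \<xi> \<tau>. g \<in> carrier G \<Longrightarrow> mq (aX g \<xi>) (aT g \<tau>) = mq \<xi> \<tau>"
    and mq_sum: "\<And>\<tau>. (\<Sum>\<xi>\<in>\<Omega>. mq \<xi> \<tau>) = 0"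
    and rel_ex: "\<And>w. w \<in> supported \<Omega> \<Longrightarrow> (\<Sum>\<xi>\<in>\<Omega>. w \<xi>) = 0 \<Longrightarrow> \<exists>v. Rel w v"
    and rel_diff: "\<And>w v w' v'. Rel w v \<Longrightarrow> Rel w' v' \<Longrightarrow> Rel (w - w') (v - v')"
    and rel_sh: "\<And>g w v. g \<in> carrier G \<Longrightarrow> Rel w v \<Longrightarrow> Rel (X.sh g w) (T.sh g v)"
    and rel_zero: "\<And>v. Rel 0 v \<Longrightarrow> \<exists>u\<in>supported Y. v = (\<lambda>\<tau>. \<Sum>y\<in>Y. ma \<tau> y * u y)"
    and rel_image: "\<And>u. u \<in> supported Y \<Longrightarrow> Rel 0 (\<lambda>\<tau>. \<Sum>y\<in>Y. ma \<tau> y * u y)"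
    and rel_q: "\<And>w v \<xi>. Rel w v \<Longrightarrow> (\<Sum>\<tau>\<in>T. mq \<xi> \<tau> * v \<tau>) = w \<xi>"
begin

definition alpha :: "('y \<Rightarrow> int) \<Rightarrow> 't \<Rightarrow> int" where
  "alpha u = (\<lambda>\<tau>. \<Sum>y\<in>Y. ma \<tau> y * u y)"

definition q :: "('t \<Rightarrow> int) \<Rightarrow> 'x \<Rightarrow> int" where
  "q v = (\<lambda>\<xi>. \<Sum>\<tau>\<in>T. mq \<xi> \<tau> * v \<tau>)"

lemma alpha_add: "alpha (u + v) = alpha u + alpha v"
  by (auto simp: alpha_def fun_eq_iff sum.distrib distrib_left)
lemma alpha_diff: "alpha (u - v) = alpha u - alpha v"
  by (auto simp: alpha_def fun_eq_iff sum_subtractf right_diff_distrib)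
lemma alpha_scale: "alpha (\<lambda>y. c * u y) = (\<lambda>\<tau>. c * alpha u \<tau>)"
  by (auto simp: alpha_def fun_eq_iff sum_distrib_left mult.left_commute)
lemma alpha_zero [simp]: "alpha 0 = 0"
  by (auto simp: alpha_def fun_eq_iff)
lemma alpha_sum: "alpha (\<Sum>i\<in>I. f i) = (\<Sum>i\<in>I. alpha (f i))"
  by (induction I rule: infinite_finite_induct)
    (simp_all add: alpha_add del: plus_fun_apply zero_fun_apply)

lemma alpha_sh:
  assumes g: "g \<in> carrier G" shows "alpha (Y.sh g u) = T.sh g (alpha u)"
proof
  fix \<tau>
  have "(\<Sum>y\<in>Y. Y.sh g u y * ma \<tau> y) = (\<Sum>y\<in>Y. u y * ma \<tau> (aY g y))"
    using Y.sum_sh[OF g] by simp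
  moreover have "ma \<tau> (aY g y) = ma (aT (inv g) \<tau>) y" for y
    using ma_equiv[OF g, of "aT (inv g) \<tau>" y] g by simp
  ultimately show "alpha (Y.sh g u) \<tau> = T.sh g (alpha u) \<tau>"
    by (simp add: alpha_def shift_def mult.commute)
qed

lemma alpha_inj: 
  assumes "u \<in> supported Y" "v \<in> supported Y" "alpha u = alpha v" shows "u = v"
proof -
  have "u - v = 0"
  proof (rule ma_inj)
    show "u - v \<in> supported Y" using assms supported_diff by blast
    have "alpha (u - v) = 0" using assms by (simp add: alpha_diff)
    then show "(\<Sum>y\<in>Y. ma \<tau> y * (u - v) y) = 0" for \<tau>
      unfolding alpha_def by (simp add: fun_eq_iff)
  qed
  then show ?thesis by simp
qed

lemma q_add: "q (u + v) = q u + q v"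
  by (auto simp: q_def fun_eq_iff sum.distrib distrib_left)
lemma q_diff: "q (u - v) = q u - q v"
  by (auto simp: q_def fun_eq_iff sum_subtractf right_diff_distrib)
lemma q_scale: "q (\<lambda>y. c * u y) = (\<lambda>\<tau>. c * q u \<tau>)"
  by (auto simp: q_def fun_eq_iff sum_distrib_left mult.left_commute)

lemma q_sh:
  assumes g: "g \<in> carrier G" shows "q (T.sh g u) = X.sh g (q u)"
proof
  fix \<xi>
  have "(\<Sum>y\<in>T. T.sh g u y * mq \<xi> y) = (\<Sum>y\<in>T. u y * mq \<xi> (aT g y))"
    using T.sum_sh[OF g] by simp
  moreover have "mq \<xi> (aT g y) = mq (aX (inv g) \<xi>) y" for y
    using mq_equiv[OF g, of "aX (inv g) \<xi>" y] g by simp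
  ultimately show "q (T.sh g u) \<xi> = X.sh g (q u) \<xi>"
    by (simp add: q_def shift_def mult.commute)
qed

lemma sum_q: "(\<Sum>\<xi>\<in>\<Omega>. q v \<xi>) = 0"
proof -
  have "(\<Sum>\<xi>\<in>\<Omega>. q v \<xi>) = (\<Sum>\<tau>\<in>T. \<Sum>\<xi>\<in>\<Omega>. mq \<xi> \<tau> * v \<tau>)"
    unfolding q_def by (rule sum.swap)
  also have "\<dots> = 0" by (simp add: sum_distrib_right[symmetric] mq_sum)
  finally show ?thesis .
qed

lemma relq: "Rel w v \<Longrightarrow> q v = w"
  by (auto simp: q_def fun_eq_iff rel_q)

lemma rel_alpha: "u \<in> supported Y \<Longrightarrow> Rel 0 (alpha u)"
  using rel_image by (simp add: alpha_def)

lemma rel_zeroE: assumes "Rel 0 v" obtains u where "u \<in> supported Y" "alpha u = v"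
  using rel_zero[OF assms] by (auto simp: alpha_def)

lemma q_alpha: "u \<in> supported Y \<Longrightarrow> q (alpha u) = 0"
  using relq rel_alpha by blast

lemma rel_add: assumes "Rel w v" "Rel w' v'" shows "Rel (w + w') (v + v')"
proof -
  have "Rel (0 - w') (0 - v')" using rel_diff[OF _ assms(2), of 0 0] rel_alpha[of 0] by simp
  then show ?thesis using rel_diff[OF assms(1)] by fastforce
qed

lemma rel_sum: "(\<And>i. i \<in> I \<Longrightarrow> Rel (w i) (v i)) \<Longrightarrow> Rel (\<Sum>i\<in>I. w i) (\<Sum>i\<in>I. v i)"
proof (induction I rule: infinite_finite_induct)
  case (insert x F) then show ?case by (simp add: rel_add del: plus_fun_apply)
qed (use rel_alpha[of 0] in \<open>simp_all del: zero_fun_apply\<close>)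

text \<open>Summing over the powers of \<open>g\<close> kills \<open>g z - z\<close> and multiplies \<open>u y\<close> by the group order.\<close>

lemma alpha_coboundary_vanishes_at_fixed:
  assumes g: "g \<in> carrier G" and u: "u \<in> supported Y" and eq: "alpha u = T.sh g z - z"
    and y: "aY g y = y"
  shows "u y = 0"
proof -
  let ?n = "order G"
  have o: "?n > 0" using finG by (simp add: X.order_gt_0_iff_finite)
  let ?U = "\<Sum>i<?n. Y.sh (g [^] i) u"
  have "alpha ?U = (\<Sum>i<?n. T.sh (g [^] i) (T.sh g z - z))"
    using g eq by (simp add: alpha_sum alpha_sh)
  also have "\<dots> = 0" using T.sh_telescope[OF g, of z ?n] X.pow_order_eq_1[OF g] by simp
  finally have "?U = 0"
    using alpha_inj[of ?U 0] u g by (simp add: supported_sum Y.sh_supported)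
  then have "(\<Sum>i<?n. Y.sh (g [^] i) u y) = 0" by (metis sum_fun_apply zero_fun_apply)
  moreover have "Y.sh (g [^] i) u y = u y" for i :: nat
    using Y.sh_fixed_apply Y.pow_fix g y by simp
  ultimately show ?thesis using o by simp
qed

end

context permutation_resolution
begin

text \<open>The extension class of the resolution is a second cohomology class with values in the
  permutation lattice \<open>\<int>[Y]\<close>, that is, a family of characters of point stabilizers.  Its order is
  the greatest common divisor of the orbit lengths on \<open>\<Omega>\<close>, and a family of characters attains the
  \<open>p\<close>-part of its order on a single element.  The function \<open>u\<close> below is this class, multiplied by
  the group order so as to stay integral.\<close>

lemma ex_element_with_long_orbits:
  assumes p: "Factorial_Ring.prime p" and k: "k \<ge> 1" and x0: "x0 \<in> \<Omega>"
    and orbs: "\<And>x. x \<in> \<Omega> \<Longrightarrow> p ^ k dvd card (orb aX (carrier G) x)"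
  shows "\<exists>t\<in>carrier G. \<forall>(r::nat). \<forall>x\<in>\<Omega>. aX (t [^] r) x = x \<longrightarrow> p ^ k dvd r"
proof (rule ccontr)
  assume "\<not> ?thesis"
  then have no: "\<exists>(r::nat). \<exists>x\<in>\<Omega>. aX (t [^] r) x = x \<and> \<not> p ^ k dvd r" if "t \<in> carrier G" for t
    using that by blast
  define gn where "gn = int (order G)"
  have gn0: "gn > 0" using finG X.order_gt_0_iff_finite by (simp add: gn_def)
  define e :: "'x \<Rightarrow> int" where "e = indicator {x0}"
  have e_supp: "e \<in> supported \<Omega>" unfolding e_def using x0 by (intro supported_indicator) auto
  have e_sum: "(\<Sum>\<xi>\<in>\<Omega>. e \<xi>) = 1" using x0 X.fin_set by (simp add: e_def indicator_def)
  \<comment> \<open>\<open>e\<close> has coordinate sum one and so is no element of I, but its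
    translates differ from it by elements of I, and those lift.\<close>
  have "\<exists>v. Rel (X.sh g e - e) v" if "g \<in> carrier G" for g
    by (rule rel_ex) (use that e_supp in \<open>auto simp: supported_diff X.sh_supported sum_subtractf X.sum_sh_1\<close>)
  then obtain yh where yh: "\<And>g. g \<in> carrier G \<Longrightarrow> Rel (X.sh g e - e) (yh g)" by metis
  \<comment> \<open>The lifts satisfy the cocycle identity up to the kernel; the defect is a
    2-cocycle with values in \<int>[Y].\<close>
  have rel_cocycle: "Rel 0 (yh g + T.sh g (yh h) - yh (g \<otimes> h))" if "g \<in> carrier G" "h \<in> carrier G" for g h
  proof -
    have "Rel ((X.sh g e - e) + X.sh g (X.sh h e - e) - (X.sh (g \<otimes> h) e - e))
        (yh g + T.sh g (yh h) - yh (g \<otimes> h))"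
      using that by (intro rel_diff rel_add rel_sh yh) auto
    moreover have "(X.sh g e - e) + X.sh g (X.sh h e - e) - (X.sh (g \<otimes> h) e - e) = 0"
      using that by (simp only: X.sh_diff X.sh_mult) simp
    ultimately show ?thesis by simp
  qed
  \<comment> \<open>Summing a 2-cocycle over its second argument gives a cochain whose coboundary is
    \<open>gn\<close> times the 2-cocycle.\<close>
  have "\<exists>u\<in>supported Y. alpha u = (\<Sum>h\<in>carrier G. yh g + T.sh g (yh h) - yh (g \<otimes> h))"
    if "g \<in> carrier G" for g
  proof -
    have "Rel (\<Sum>h\<in>carrier G. 0) (\<Sum>h\<in>carrier G. yh g + T.sh g (yh h) - yh (g \<otimes> h))"
      by (rule rel_sum) (use that rel_cocycle in auto)
    then have "Rel 0 (\<Sum>h\<in>carrier G. yh g + T.sh g (yh h) - yh (g \<otimes> h))"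
      by (simp only: sum.neutral_const)
    then show ?thesis by (elim rel_zeroE) blast
  qed
  then obtain u where u_supp: "\<And>g. g \<in> carrier G \<Longrightarrow> u g \<in> supported Y"
    and u: "\<And>g. g \<in> carrier G \<Longrightarrow> alpha (u g) = (\<Sum>h\<in>carrier G. yh g + T.sh g (yh h) - yh (g \<otimes> h))"
    by metis
  define E where "E = - (\<Sum>h\<in>carrier G. yh h)"
  have alpha_u: "alpha (u g) \<tau> = gn * yh g \<tau> - T.sh g E \<tau> + E \<tau>" if g: "g \<in> carrier G" for g \<tau>
  proof -
    have bij: "bij_betw ((\<otimes>) g) (carrier G) (carrier G)"
      by (rule bij_betw_byWitness[where f' = "(\<otimes>) (inv g)"])
        (use g in \<open>auto simp: X.m_assoc[symmetric]\<close>)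
    have "(\<Sum>h\<in>carrier G. yh (g \<otimes> h)) = (\<Sum>h\<in>carrier G. yh h)"
      using sum.reindex_bij_betw[OF bij, of yh] .
    then have "(\<Sum>h\<in>carrier G. yh (g \<otimes> h) \<tau>) = - E \<tau>" by (metis E_def sum_fun_apply minus_minus fun_Compl_def)
    moreover have "(\<Sum>h\<in>carrier G. T.sh g (yh h) \<tau>) = - T.sh g E \<tau>"
      unfolding E_def T.sh_minus T.sh_sum by (simp add: sum_fun_apply)
    ultimately show ?thesis
      using u[OF g] by (simp add: sum_fun_apply sum.distrib sum_subtractf gn_def order_def)
  qed
  \<comment> \<open>After division by \<open>gn\<close>, \<open>u\<close> is a 1-cocycle with values
    in the rationals modulo the integers.\<close>
  have cocycle: "gn dvd u (g \<otimes> h) y - u g y - u h (aY (inv g) y)"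
    if gh: "g \<in> carrier G" "h \<in> carrier G" for g h y
  proof -
    obtain w where w: "w \<in> supported Y" "alpha w = yh g + T.sh g (yh h) - yh (g \<otimes> h)"
      using rel_zeroE[OF rel_cocycle[OF gh]] by blast
    have "alpha (u g + Y.sh g (u h) - u (g \<otimes> h)) = alpha (\<lambda>y. gn * w y)"
    proof
      fix \<tau>
      have "alpha (u g + Y.sh g (u h) - u (g \<otimes> h)) \<tau>
          = alpha (u g) \<tau> + T.sh g (alpha (u h)) \<tau> - alpha (u (g \<otimes> h)) \<tau>"
        using gh by (simp only: alpha_add alpha_diff alpha_sh) simp
      also have "T.sh g (alpha (u h)) \<tau> = alpha (u h) (aT (inv g) \<tau>)" by (simp add: shift_def)
      also have "\<dots> = gn * T.sh g (yh h) \<tau> - T.sh (g \<otimes> h) E \<tau> + T.sh g E \<tau>"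
        using alpha_u[OF gh(2)] gh by (simp add: T.sh_mult) (simp add: shift_def)
      finally have eq: "alpha (u g + Y.sh g (u h) - u (g \<otimes> h)) \<tau> = alpha (u g) \<tau>
          + (gn * T.sh g (yh h) \<tau> - T.sh (g \<otimes> h) E \<tau> + T.sh g E \<tau>) - alpha (u (g \<otimes> h)) \<tau>" .
      have aw: "alpha w \<tau> = yh g \<tau> + T.sh g (yh h) \<tau> - yh (g \<otimes> h) \<tau>" using w by simp
      show "alpha (u g + Y.sh g (u h) - u (g \<otimes> h)) \<tau> = alpha (\<lambda>y. gn * w y) \<tau>"
        unfolding eq alpha_scale aw using alpha_u[of g \<tau>] alpha_u[of "g \<otimes> h" \<tau>] gh
        by (simp add: algebra_simps)
    qed
    then have "u g + Y.sh g (u h) - u (g \<otimes> h) = (\<lambda>y. gn * w y)"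
      by (rule alpha_inj[rotated 2])
        (use gh u_supp w in \<open>simp_all add: supported_add supported_diff supported_scale Y.sh_supported\<close>)
    then have "(u g + Y.sh g (u h) - u (g \<otimes> h)) y = gn * w y" by simp
    then have "u (g \<otimes> h) y - u g y - u h (aY (inv g) y) = gn * (- w y)" by (simp add: shift_def)
    then show ?thesis by simp
  qed
  \<comment> \<open>Any point \<open>x\<close> can take the place of \<open>x0\<close>:
    \<open>e - indicator {x}\<close> lifts to some \<open>wh\<close>, and if \<open>s\<close> fixes
    \<open>x\<close>, then \<open>yh s\<close> is the coboundary of \<open>wh\<close> up to the
    image of \<open>alpha\<close>.\<close>
  have stab: "gn dvd u s y" if s: "s \<in> carrier G" and x: "x \<in> \<Omega>" "aX s x = x" and y: "aY s y = y" for s x y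
  proof -
    let ?d = "e - indicator {x}"
    have "(\<Sum>\<xi>\<in>\<Omega>. indicator {x} \<xi>) = (1::int)" using x X.fin_set by (simp add: indicator_def)
    then have "(\<Sum>\<xi>\<in>\<Omega>. ?d \<xi>) = 0" using e_sum by (simp add: sum_subtractf)
    moreover have "?d \<in> supported \<Omega>" using e_supp x by (intro supported_diff supported_indicator) auto
    ultimately obtain wh where wh: "Rel ?d wh" using rel_ex by blast
    have "X.sh s ?d - ?d = X.sh s e - e" using s x by (simp add: X.sh_diff X.sh_indicator)
    moreover have "Rel ((X.sh s e - e) - (X.sh s ?d - ?d)) (yh s - (T.sh s wh - wh))"
      using s by (intro rel_diff rel_sh yh wh)
    ultimately have "Rel 0 (yh s - (T.sh s wh - wh))" by (simp only: diff_self)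
    then obtain v where v: "v \<in> supported Y" "alpha v = yh s - (T.sh s wh - wh)" using rel_zeroE by blast
    define z where "z = (\<lambda>\<tau>. gn * wh \<tau>) - E"
    have eq: "alpha (u s - (\<lambda>y. gn * v y)) = T.sh s z - z"
    proof
      fix \<tau>
      have "alpha (u s - (\<lambda>y. gn * v y)) \<tau> = alpha (u s) \<tau> - gn * alpha v \<tau>"
        by (simp only: alpha_diff alpha_scale) simp
      also have "\<dots> = (T.sh s z - z) \<tau>"
        unfolding v(2) alpha_u[OF s] z_def T.sh_diff T.sh_scale by (simp add: algebra_simps)
      finally show "alpha (u s - (\<lambda>y. gn * v y)) \<tau> = (T.sh s z - z) \<tau>" .
    qed
    have "u s - (\<lambda>y. gn * v y) \<in> supported Y"
      using u_supp s v by (intro supported_diff supported_scale)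
    then have "(u s - (\<lambda>y. gn * v y)) y = 0"
      using eq y by (rule alpha_coboundary_vanishes_at_fixed[OF s])
    then show ?thesis by simp
  qed
  \<comment> \<open>On elements that fix \<open>y\<close> the value at \<open>y\<close> is additive
    modulo \<open>gn\<close>: this is the character of the stabilizer.\<close>
  have pow: "gn dvd u (s [^] r) y - int r * u s y" if s: "s \<in> carrier G" and y: "aY s y = y" for s y and r :: nat
  proof (induction r)
    case 0
    then show ?case using cocycle[of \<one> \<one> y] by simp
  next
    case (Suc r)
    have "aY (inv (s [^] r)) y = y" using Y.pow_fix[OF s y, of r] s Y.act_inv1[of "s [^] r" y] by simp
    then have "gn dvd u (s [^] Suc r) y - u (s [^] r) y - u s y" using cocycle[of "s [^] r" s y] s by simp
    then have "gn dvd (u (s [^] Suc r) y - u (s [^] r) y - u s y) + (u (s [^] r) y - int r * u s y)"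
      using Suc by (rule dvd_add)
    then show ?case by (simp add: algebra_simps)
  qed
  obtain ee b where gnb: "order G = p ^ ee * b" "\<not> p dvd b"
    using multiplicity_decompose'[of "order G" p] gn0 p not_prime_unit by (metis gn_def of_nat_0 less_irrefl)
  \<comment> \<open>The factor \<open>b\<close> disposes of the primes other than \<open>p\<close>,
    and \<open>p ^ (k - 1)\<close> suffices for \<open>p\<close> by the assumption
    \<open>no\<close>. Yet \<open>c\<close> is not divisible by \<open>p ^ k\<close>, which gives
    the contradiction at the end.\<close>
  define c where "c = int (p ^ (k - 1) * b)"
  have kill: "gn dvd c * u s y" if s: "s \<in> carrier G" and y: "aY s y = y" for s y
  proof -
    obtain r :: nat and x where r: "x \<in> \<Omega>" "aX (s [^] r) x = x" "\<not> p ^ k dvd r" using no[OF s] by blast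
    have "gn dvd u (s [^] r) y" using stab[OF _ r(1,2) Y.pow_fix[OF s y]] s by simp
    then have "gn dvd int r * u s y" using pow[OF s y, of r] by (metis dvd_diff_right_iff)
    then have "int (p ^ ee) dvd int r * u s y" using gnb by (simp add: gn_def dvd_mult_left)
    then have "int (p ^ ee) dvd int (p ^ (k - 1)) * u s y" by (rule prime_power_dvd_cancel[OF p r(3)])
    then have "int (p ^ ee) * int b dvd int (p ^ (k - 1)) * u s y * int b" by (rule mult_dvd_mono) simp
    then show ?thesis by (simp add: gn_def gnb c_def mult_ac)
  qed
  \<comment> \<open>Orbit representatives in \<open>Y\<close>, with \<open>s y\<close> carrying the
    representative to \<open>y\<close>. As in Shapiro's lemma, a cocycle that vanishes on the point
    stabilizers is a coboundary, here of \<open>w\<close> modulo \<open>gn\<close>.\<close>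
  define r where "r y = (SOME z. z \<in> orb aY (carrier G) y)" for y
  have r: "r y \<in> orb aY (carrier G) y" for y
    unfolding r_def by (rule someI[of _ y]) (rule Y.orb_self[OF X.subgroup_self])
  have "\<exists>g\<in>carrier G. y = aY g (r y)" for y
  proof -
    have "y \<in> orb aY (carrier G) (r y)" 
      using Y.orb_eq[OF X.subgroup_self r] Y.orb_self[OF X.subgroup_self] by blast
    then show ?thesis by (auto simp: orb_def)
  qed
  then obtain s where s: "\<And>y. s y \<in> carrier G" "\<And>y. y = aY (s y) (r y)" by metis
  define w where "w y = - c * u (s y) y" for y
  have w_supp: "w \<in> supported Y" using u_supp s by (auto simp: supported_def w_def)
  have cob: "gn dvd c * u g y - (w (aY (inv g) y) - w y)" if g: "g \<in> carrier G" for g y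
  proof -
    let ?y = "aY (inv g) y"
    have "?y \<in> orb aY (carrier G) y" using g by (auto simp: orb_def)
    then have ry: "r ?y = r y" using Y.orb_eq[OF X.subgroup_self] by (simp add: r_def)
    define h where "h = inv (s y) \<otimes> (g \<otimes> s ?y)"
    have h: "h \<in> carrier G" "g \<otimes> s ?y = s y \<otimes> h" using s g by (simp_all add: h_def X.m_assoc[symmetric])
    have "aY (g \<otimes> s ?y) (r y) = y" using s(2)[of ?y] ry g s(1) by (simp add: Y.act_mult)
    then have "aY (s y) (aY h (r y)) = aY (s y) (r y)" using h s by (metis Y.act_mult)
    then have hr: "aY h (r y) = r y" using Y.act_eq_iff s(1) by blast
    have inv: "aY (inv (s y)) y = r y" using s(2)[of y] s(1)[of y] Y.act_inv1 by metis
    have 1: "gn dvd u (s y \<otimes> h) y - u g y - u (s ?y) ?y" using cocycle[OF g s(1), of ?y y] h by simp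
    have 2: "gn dvd u (s y \<otimes> h) y - u (s y) y - u h (r y)" using cocycle[OF s(1) h(1), of y y] inv by simp
    have 3: "gn dvd c * u h (r y)" using kill[OF h(1) hr] .
    have "c * u g y - (w ?y - w y) = c * (u (s y \<otimes> h) y - u (s y) y - u h (r y)) 
       - c * (u (s y \<otimes> h) y - u g y - u (s ?y) ?y) + c * u h (r y)"
      by (simp add: w_def algebra_simps)
    then show ?thesis using 1 2 3 by (metis dvd_add dvd_diff dvd_mult)
  qed
  define w' where "w' g = (\<lambda>y. (c * u g y - (w (aY (inv g) y) - w y)) div gn)" for g
  have w'_supp: "w' g \<in> supported Y" if "g \<in> carrier G" for g
  proof -
    have "(\<lambda>y. c * u g y) - (Y.sh g w - w) \<in> supported Y"
      using that u_supp w_supp by (intro supported_diff supported_scale Y.sh_supported)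
    then show ?thesis unfolding w'_def by (auto simp: supported_def shift_def)
  qed
  have w': "(\<lambda>y. c * u g y) = (Y.sh g w - w) + (\<lambda>y. gn * w' g y)" if "g \<in> carrier G" for g
    using cob[OF that] by (auto simp: fun_eq_iff w'_def shift_def)
  \<comment> \<open>Translation changes \<open>B\<close> by multiples of \<open>gn\<close>, so the
    pointwise quotient \<open>b'\<close> transforms exactly although \<open>B\<close> itself may not
    be divisible by \<open>gn\<close>.\<close>
  define B where "B \<tau> = c * E \<tau> + alpha w \<tau>" for \<tau>
  define b' where "b' = (\<lambda>\<tau>. B \<tau> div gn)"
  have b'eq: "T.sh g b' = b' + ((\<lambda>\<tau>. c * yh g \<tau>) - alpha (w' g))" if g: "g \<in> carrier G" for g
  proof
    fix \<tau>
    have "c * alpha (u g) \<tau> = alpha (\<lambda>y. c * u g y) \<tau>" by (simp add: alpha_scale)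
    also have "\<dots> = T.sh g (alpha w) \<tau> - alpha w \<tau> + gn * alpha (w' g) \<tau>"
      unfolding w'[OF g] by (simp add: alpha_add alpha_diff alpha_sh[OF g] alpha_scale)
    finally have "B (aT (inv g) \<tau>) = B \<tau> + gn * (c * yh g \<tau> - alpha (w' g) \<tau>)"
      unfolding B_def alpha_u[OF g] by (simp add: shift_def algebra_simps)
    then show "T.sh g b' \<tau> = (b' + ((\<lambda>\<tau>. c * yh g \<tau>) - alpha (w' g))) \<tau>"
      using gn0 by (simp add: b'_def shift_def)
  qed
  \<comment> \<open>Subtracting \<open>q b'\<close> makes \<open>c * e\<close> invariant and keeps
    its coordinate sum \<open>c\<close>, because everything in the image of \<open>q\<close> has sum
    zero. An invariant vector has a sum divisible by \<open>p ^ k\<close>.\<close>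
  define x where "x = (\<lambda>\<xi>. c * e \<xi>) - q b'"
  have x_inv: "X.sh g x = x" if g: "g \<in> carrier G" for g
  proof -
    have "X.sh g (q b') = q (T.sh g b')" by (simp only: q_sh[OF g])
    also have "\<dots> = q b' + ((\<lambda>\<xi>. c * q (yh g) \<xi>) - q (alpha (w' g)))"
      unfolding b'eq[OF g] by (simp only: q_add q_diff q_scale)
    also have "\<dots> = q b' + ((\<lambda>\<xi>. c * (X.sh g e - e) \<xi>) - 0)"
      by (simp only: q_alpha[OF w'_supp[OF g]] relq[OF yh[OF g]])
    finally show ?thesis unfolding x_def X.sh_diff X.sh_scale
      by (auto simp: fun_eq_iff algebra_simps)
  qed
  have "int (p ^ k) dvd (\<Sum>\<xi>\<in>\<Omega>. x \<xi>)"
  proof (rule X.dvd_sum_invariant[OF X.subgroup_self])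
    show "x (aX g \<xi>) = x \<xi>" if "g \<in> carrier G" for g \<xi>
      using x_inv[OF that] X.sh_eq_iff that by blast
    show "int (p ^ k) dvd int (card (orb aX (carrier G) \<xi>)) * x \<xi>" if "\<xi> \<in> \<Omega>" for \<xi>
      using orbs[OF that] by (simp add: dvd_mult2 del: of_nat_power)
  qed
  moreover have "(\<Sum>\<xi>\<in>\<Omega>. x \<xi>) = c"
    using e_sum sum_q[of b'] by (simp add: x_def sum_subtractf sum_distrib_left[symmetric])
  ultimately have "p ^ k dvd p ^ (k - 1) * b" unfolding c_def by (simp only: int_dvd_int_iff)
  moreover have "p ^ k = p ^ (k - 1) * p" using k by (metis power_minus_mult less_eq_Suc_le One_nat_def)
  ultimately have "p dvd b" using p prime_gt_0_nat by simp
  then show False using gnb by blast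
qed

end

section \<open>The cyclic case\<close>

lemma sum_lessThan_mult:
  fixes F :: "nat \<Rightarrow> 'a :: comm_monoid_add"
  shows "(\<Sum>l<L. \<Sum>i<M. F (M * l + i)) = (\<Sum>i<M * L. F i)"
proof (induction L)
  case (Suc L)
  have "(\<Sum>i<M * L + m. F i) = (\<Sum>i<M * L. F i) + (\<Sum>i<m. F (M * L + i))" for m
    by (induction m) (simp_all add: add.assoc)
  from this[of M] show ?case using Suc by (simp add: add.commute)
qed simp

text \<open>Each block of \<open>k\<close> consecutive indices contains exactly one that is
  congruent to \<open>c\<close>, and there are \<open>f div k\<close> blocks.\<close>

lemma sum_residue_count:
  assumes k: "k > 0" "k dvd f"
  shows "(\<Sum>i<f. if int k dvd c - int i then (1::int) else 0) = int (f div k)"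
proof -
  obtain L where f: "f = k * L" using k by auto
  define m where "m = nat (c mod int k)"
  have m: "m < k" "int m = c mod int k" using k by (simp_all add: m_def nat_less_iff)
  have "(\<Sum>i<k. if int k dvd c - int (k * l + i) then (1::int) else 0) = 1" for l
  proof -
    have "int k dvd c - int (k * l + i) \<longleftrightarrow> i = m" if "i < k" for i
    proof -
      have "int k dvd c - int (k * l + i) \<longleftrightarrow> c mod int k = int (k * l + i) mod int k"
        by (rule mod_eq_dvd_iff[symmetric])
      also have "int (k * l + i) mod int k = int i" using that by simp
      finally show ?thesis using m by auto
    qed
    then have "(\<Sum>i<k. if int k dvd c - int (k * l + i) then (1::int) else 0) = (\<Sum>i<k. if i = m then 1 else 0)"
      by (intro sum.cong) auto
    then show ?thesis using m by simp
  qed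
  then show ?thesis
    unfolding f using sum_lessThan_mult[of "\<lambda>i. if int k dvd c - int i then (1::int) else 0" k L] k by simp
qed

context normalized_subgroup
begin

lemma coset_pow:
  assumes "n \<in> N" shows "\<exists>m\<in>N. (n \<otimes> t [^] (j::nat)) [^] (r::nat) = m \<otimes> t [^] (j * r)"
proof (induction r)
  case 0 then show ?case using subgroup.one_closed[OF subN] by (auto intro!: bexI[of _ \<one>])
next
  case (Suc r)
  then obtain m where m: "m \<in> N" "(n \<otimes> t [^] j) [^] r = m \<otimes> t [^] (j * r)" by blast
  obtain n' where n': "n' \<in> N" "t [^] (j * r) \<otimes> n = n' \<otimes> t [^] (j * r)" using pow_push[OF assms] by blast
  have "(n \<otimes> t [^] j) [^] Suc r = m \<otimes> (t [^] (j * r) \<otimes> n) \<otimes> t [^] j"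
    using m assms N_in t_in by (simp add: m_assoc)
  also have "\<dots> = (m \<otimes> n') \<otimes> (t [^] (j * r) \<otimes> t [^] j)" using m n' N_in t_in by (simp add: m_assoc)
  also have "\<dots> = (m \<otimes> n') \<otimes> t [^] (j * Suc r)" using t_in by (simp add: nat_pow_mult add.commute)
  finally show ?case using m n' subgroup.m_closed[OF subN] by blast
qed

end

context normalized_gset
begin

lemma sh_pow_fixed:
  assumes v: "\<And>n. n \<in> N \<Longrightarrow> sh n v = v" and n: "n \<in> N"
  shows "sh n (sh (t [^] (i::nat)) v) = sh (t [^] i) v"
proof -
  obtain n' where n': "n' \<in> N" "n \<otimes> t [^] i = t [^] i \<otimes> n'" using pow_pull[OF n] by blast
  have "sh n (sh (t [^] i) v) = sh (n \<otimes> t [^] i) v" using n N_in t_in by (simp add: sh_mult)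
  also have "\<dots> = sh (t [^] i) (sh n' v)" using n' N_in t_in by (simp add: sh_mult)
  finally show ?thesis using v n' by simp
qed

lemma sh_coset_pow:
  assumes v: "\<And>n. n \<in> N \<Longrightarrow> sh n v = v" and n: "n \<in> N"
  shows "sh (n \<otimes> t [^] (j::nat)) (sh (t [^] (i::nat)) v) = sh (t [^] (j + i)) v"
proof -
  have "sh (n \<otimes> t [^] j) (sh (t [^] i) v) = sh n (sh (t [^] j \<otimes> t [^] i) v)"
    using n N_in t_in by (simp add: sh_mult)
  also have "t [^] j \<otimes> t [^] i = t [^] (j + i)" using t_in by (simp add: nat_pow_mult)
  finally show ?thesis using sh_pow_fixed[OF v n] by simp
qed

lemma sh_indicator_orb: "sh (t [^] (i::nat)) (indicator (orb a N x)) = indicator (orb a N (a (t [^] i) x))"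
  using sh_indicator[OF pow_in] orb_pow_image by metis

lemma sh_indicator_orb_N: "n \<in> N \<Longrightarrow> sh n (indicator (orb a N x)) = indicator (orb a N x)"
proof -
  assume n: "n \<in> N"
  have "indicator (orb a N x) (a n z) = (indicator (orb a N x) z :: int)" for z
  proof -
    have "a n z \<in> orb a N z" using n by (auto simp: orb_def)
    then have "a n z \<in> orb a N x \<longleftrightarrow> z \<in> orb a N x" using orb_sym by metis
    then show ?thesis by (simp add: indicator_def)
  qed
  then show ?thesis using sh_eq_iff N_in[OF n] by blast
qed

lemma act_orb_N: "n \<in> N \<Longrightarrow> a n z \<in> orb a N x \<longleftrightarrow> z \<in> orb a N x"
proof -
  assume n: "n \<in> N"
  have "a n z \<in> orb a N z" using n by (auto simp: orb_def)
  then show ?thesis using orb_sym by metis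
qed

end

text \<open>The group under study is \<open>N\<close> extended by powers of \<open>t\<close>, a
  cyclic extension of order dividing the prime power \<open>f\<close>. By \<open>minimal\<close>,
  every intermediate enlargement of \<open>N\<close> loses the orbits of length prime to
  \<open>p\<close>, of which \<open>x1\<close> provides one for \<open>N\<close>; the
  \<open>N\<close>-orbit of \<open>x2\<close> is stable under \<open>t\<close>.\<close>

locale cyclic_situation = permutation_resolution G \<Omega> aX T aT Y aY Rel ma mq +
  XN: normalized_gset G N t \<Omega> aX + TN: normalized_gset G N t T aT + YN: normalized_gset G N t Y aY
  for G :: "('g, 'm) monoid_scheme" (structure)
    and \<Omega> :: "'x set" and aX and T :: "'t set" and aT and Y :: "'y set" and aY and Rel ma mq and N t +
  fixes p k f :: nat and x1 x2 :: 'x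
  assumes prime_p: "Factorial_Ring.prime p" and pk: "k \<ge> 1" "odd p \<or> k \<ge> 2"
    and f_power: "\<exists>c. f = p ^ c" and tf: "t [^] f \<in> N"
    and long: "\<And>x. x \<in> \<Omega> \<Longrightarrow> p ^ k dvd card (orb aX (adjoin G N t) x)"
    and minimal: "\<And>j x. j dvd f \<Longrightarrow> j < f \<Longrightarrow> x \<in> \<Omega> \<Longrightarrow> p dvd card (orb aX (adjoin G N (t [^] j)) x)"
    and x1: "x1 \<in> \<Omega>" "\<not> p dvd card (orb aX N x1)"
    and x2: "x2 \<in> \<Omega>" "\<And>i::nat. aX (t [^] i) x2 \<in> orb aX N x2"
begin

section \<open>The functional counting positions in the cyclic order, modulo
  \<open>p\<close>\<close>

lemma f_pos: "f > 0"
  using f_power prime_p prime_gt_0_nat by auto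

lemma p_cancel: "\<not> p dvd n \<Longrightarrow> int p dvd int n * z \<Longrightarrow> int p dvd z"
  using prime_p by (metis prime_dvd_mult_iff prime_nat_int_transfer int_dvd_int_iff)

definition lab :: "'x \<Rightarrow> int" where
  "lab = (SOME l. (\<forall>n\<in>N. \<forall>x. l (aX n x) = l x) \<and>
     (\<forall>x (i::nat). int (XN.per x) dvd l (aX (t [^] i) x) - l x - int i))"

lemma lab_N: "n \<in> N \<Longrightarrow> lab (aX n x) = lab x"
  and lab_pow: "int (XN.per x) dvd lab (aX (t [^] i) x) - lab x - int i"
  using someI_ex[OF XN.ex_label] unfolding lab_def[symmetric] by blast+

definition lam :: "('x \<Rightarrow> int) \<Rightarrow> int" where
  "lam w = (\<Sum>\<xi>\<in>\<Omega>. w \<xi> * lab \<xi>)"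

lemma long_per: "x \<in> \<Omega> \<Longrightarrow> p ^ k dvd card (orb aX N x) * XN.per x"
  using long XN.card_orb_adjoin by metis

text \<open>This makes the ambiguity of the labels harmless: altering \<open>lab\<close> on an
  \<open>N\<close>-orbit by a multiple of \<open>per\<close> alters \<open>lam\<close> of an
  \<open>N\<close>-invariant function by a multiple of \<open>p\<close>.\<close>

lemma p_dvd_per: "x \<in> \<Omega> \<Longrightarrow> int p dvd int (card (orb aX N x)) * int (XN.per x)"
proof -
  assume "x \<in> \<Omega>"
  then have "p dvd card (orb aX N x) * XN.per x"
    using long_per pk dvd_power[of k p] dvd_trans by (metis One_nat_def less_eq_Suc_le)
  then show ?thesis by (metis int_dvd_int_iff of_nat_mult)
qed

text \<open>Applying \<open>t\<close> to a point raises its label by one, up to multiples of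
  \<open>per\<close>. In particular \<open>lam\<close> is \<open>t\<close>-invariant modulo
  \<open>p\<close> on invariant functions of sum zero.\<close>

lemma lam_sh_t:
  assumes w: "\<And>n x. n \<in> N \<Longrightarrow> w (aX n x) = w x"
  shows "int p dvd lam (X.sh t w) - lam w - (\<Sum>\<xi>\<in>\<Omega>. w \<xi>)"
proof -
  have t1: "t [^] (1::nat) = t" using XN.t_in by simp
  have "lam (X.sh t w) - lam w - (\<Sum>\<xi>\<in>\<Omega>. w \<xi>) = (\<Sum>\<xi>\<in>\<Omega>. w \<xi> * (lab (aX t \<xi>) - lab \<xi> - 1))"
    using X.sum_sh[OF XN.t_in, of w lab]
    by (simp add: lam_def sum_subtractf[symmetric] algebra_simps)
  moreover have "int p dvd (\<Sum>\<xi>\<in>\<Omega>. w \<xi> * (lab (aX t \<xi>) - lab \<xi> - 1))"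
  proof (rule X.dvd_sum_invariant[OF XN.subN])
    fix n x assume n: "n \<in> N"
    obtain n' where n': "n' \<in> N" "t \<otimes> n = n' \<otimes> t" using XN.pow_push[OF n, of 1] t1 by auto
    have "aX t (aX n x) = aX n' (aX t x)" using n n' XN.N_in XN.t_in X.act_mult by metis
    then show "w (aX n x) * (lab (aX t (aX n x)) - lab (aX n x) - 1) = w x * (lab (aX t x) - lab x - 1)"
      using w lab_N n n' by simp
  next
    fix x assume x: "x \<in> \<Omega>"
    obtain d where "lab (aX t x) - lab x - 1 = int (XN.per x) * d" using lab_pow[of x 1] t1 by auto
    then have "int (card (orb aX N x)) * (w x * (lab (aX t x) - lab x - 1))
       = (int (card (orb aX N x)) * int (XN.per x)) * (w x * d)" by simp
    then show "int p dvd int (card (orb aX N x)) * (w x * (lab (aX t x) - lab x - 1))"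
      using p_dvd_per[OF x] by (metis dvd_mult2)
  qed
  ultimately show ?thesis by simp
qed

text \<open>Along an orbit of \<open>N\<close> extended by \<open>t ^ j\<close> the labels grow in
  steps of \<open>j\<close>, so the sum involves the orbit length and the triangular number
  \<open>S\<close>. The factor two in the formula for \<open>S\<close> is where \<open>p\<close>
  must be odd or \<open>k\<close> at least two.\<close>

lemma lam_short:
  assumes j: "j dvd f" "j < f"
    and w: "\<And>n x. n \<in> N \<Longrightarrow> w (aX n x) = w x" and wt: "\<And>x. w (aX (t [^] j) x) = w x"
  shows "int p dvd lam w"
  unfolding lam_def
proof -
  interpret J: normalized_gset G N "t [^] j" \<Omega> aX
    by (rule normalized_gset.intro[OF XN.normalized_pow]) (rule X.finite_gset_axioms)
  have tj: "(t [^] j) [^] i = t [^] (j * i)" for i :: nat using XN.t_in X.nat_pow_pow by simp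
  have wti: "w (aX (t [^] (j * i)) x) = w x" for i :: nat and x
  proof (induction i)
    case (Suc i)
    have "t [^] (j * Suc i) = t [^] j \<otimes> t [^] (j * i)" using XN.t_in X.nat_pow_mult by simp
    then show ?case using Suc wt X.act_mult XN.pow_in by metis
  qed simp
  show "int p dvd (\<Sum>\<xi>\<in>\<Omega>. w \<xi> * lab \<xi>)"
  proof (rule X.dvd_sum_orbits[OF J.adjoin_subgroup])
    fix x assume x: "x \<in> \<Omega>"
    let ?c = "int (card (orb aX N x))" and ?r = "J.per x"
    have "\<exists>d. lab (aX (t [^] (j * i)) x) = lab x + int (j * i) + int (XN.per x) * d" for i :: nat
      using lab_pow[of x "j * i"] by (auto simp: dvd_def algebra_simps)
    then obtain d where d: "\<And>i. lab (aX (t [^] (j * i)) x) = lab x + int (j * i) + int (XN.per x) * d i"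
      by metis
    define S where "S = (\<Sum>i<?r. int i)"
    have "2 * (\<Sum>i<m. int i) = int m * (int m - 1)" for m
      by (induction m) (auto simp: algebra_simps)
    then have S2: "2 * S = int ?r * (int ?r - 1)" unfolding S_def .
    have cr: "?c * int ?r = int (card (orb aX J.A x))" using J.card_orb_adjoin[OF x] by simp
    have pc: "int p dvd ?c * int ?r" unfolding cr using minimal[OF j x] by simp
    have "(\<Sum>z\<in>orb aX J.A x. w z * lab z) = ?c * (\<Sum>i<?r. w (aX (t [^] (j * i)) x) * lab (aX (t [^] (j * i)) x))"
      using J.sum_orb_adjoin[OF x, of "\<lambda>z. w z * lab z"] w lab_N by (simp add: tj)
    also have "\<dots> = ?c * (\<Sum>i<?r. w x * (lab x + int j * int i + int (XN.per x) * d i))"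
      by (simp add: wti d)
    also have "(\<Sum>i<?r. w x * (lab x + int j * int i + int (XN.per x) * d i))
        = w x * (int ?r * lab x + int j * S + int (XN.per x) * (\<Sum>i<?r. d i))"
      unfolding sum_distrib_left[symmetric] by (simp add: S_def sum.distrib sum_distrib_left)
    also have "?c * \<dots> = w x * lab x * (?c * int ?r) + w x * (?c * int j * S) 
        + (?c * int (XN.per x)) * (w x * (\<Sum>i<?r. d i))"
      by (simp add: algebra_simps)
    finally have eq: "(\<Sum>z\<in>orb aX J.A x. w z * lab z) = \<dots>" .
    have "int p dvd ?c * int j * S"
    proof (cases "odd p")
      case True
      have "2 * (?c * int j * S) = (?c * int ?r) * (int j * (int ?r - 1))"
        using S2 by (simp add: mult.left_commute mult.commute)
      then have "int p dvd int 2 * (?c * int j * S)" using pc by (metis dvd_mult2 of_nat_numeral)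
      moreover have "\<not> p dvd 2" using True prime_p prime_ge_2_nat primes_dvd_imp_eq two_is_prime_nat
        by (metis even_numeral)
      ultimately show ?thesis using p_cancel by blast
    next
      case False
      then have p2: "p = 2" using prime_p primes_dvd_imp_eq two_is_prime_nat by blast
      show ?thesis
      proof (cases "even j")
        case True
        then obtain j' where j': "j = 2 * j'" by auto
        have "?c * int j * S = (?c * int ?r) * (int j' * (int ?r - 1))"
          using S2 j' by (simp add: mult.left_commute mult.commute)
        then show ?thesis using pc by (metis dvd_mult2)
      next
        case odd: False
        \<comment> \<open>An odd divisor of a power of two is one. The orbit is then one of the full
          extension, and \<open>long\<close> supplies the additional factor two.\<close>
        then have "j = 1" using j f_power p2 
          by (metis coprime_power_right_iff coprime_right_2_iff_odd dvd_refl coprime_common_divisor nat_dvd_1_iff_1)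
        then have "J.A = adjoin G N t" using XN.t_in by simp
        then have "p ^ k dvd card (orb aX J.A x)" using long[OF x] by simp
        moreover have "2 ^ 2 dvd p ^ k" using p2 pk False le_imp_power_dvd[of 2 k "2::nat"] by simp
        ultimately have "(4::nat) dvd card (orb aX J.A x)" by (auto dest: dvd_trans)
        then have "int 4 dvd ?c * int ?r" unfolding cr by (simp only: int_dvd_int_iff)
        moreover have "2 * (?c * S) = (?c * int ?r) * (int ?r - 1)" using S2 by (simp add: mult.left_commute mult.commute)
        ultimately have "4 dvd 2 * (?c * S)" by (metis dvd_mult2 of_nat_numeral)
        then have "2 * 2 dvd 2 * (?c * S)" by simp
        then have "2 dvd ?c * S" by (subst (asm) dvd_mult_cancel_left) simp
        then show ?thesis using p2 \<open>j = 1\<close> by simp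
      qed
    qed
    then show "int p dvd (\<Sum>z\<in>orb aX J.A x. w z * lab z)"
      unfolding eq using pc p_dvd_per[OF x] by (intro dvd_add) auto
  qed
qed

text \<open>The transpose of \<open>q\<close> applied to \<open>lam\<close>: the value of
  \<open>lam\<close> on the image of the basis vector at \<open>\<tau>\<close>.\<close>

definition psi :: "'t \<Rightarrow> int" where
  "psi \<tau> = (\<Sum>\<xi>\<in>\<Omega>. mq \<xi> \<tau> * lab \<xi>)"

lemma lam_q: "lam (q v) = (\<Sum>\<tau>\<in>T. v \<tau> * psi \<tau>)"
proof -
  have "lam (q v) = (\<Sum>\<xi>\<in>\<Omega>. \<Sum>\<tau>\<in>T. v \<tau> * (mq \<xi> \<tau> * lab \<xi>))"
    unfolding lam_def q_def sum_distrib_right by (intro sum.cong refl) (simp add: mult_ac)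
  also have "\<dots> = (\<Sum>\<tau>\<in>T. \<Sum>\<xi>\<in>\<Omega>. v \<tau> * (mq \<xi> \<tau> * lab \<xi>))" by (rule sum.swap)
  finally show ?thesis by (simp add: psi_def sum_distrib_left)
qed

lemma psi_N:
  assumes n: "n \<in> N" shows "psi (aT n \<tau>) = psi \<tau>"
proof -
  have g: "n \<in> carrier G" using n XN.N_in by blast
  have "psi (aT n \<tau>) = (\<Sum>\<xi>\<in>\<Omega>. mq (aX n \<xi>) (aT n \<tau>) * lab (aX n \<xi>))"
    unfolding psi_def by (rule sum.reindex_bij_betw[OF X.act_bij[OF g], symmetric])
  then show ?thesis using lab_N[OF n] mq_equiv[OF g] by (simp add: psi_def)
qed

lemma lam_q_orb:
  assumes "\<tau> \<in> T"
  shows "lam (q (indicator (orb aT N \<tau>))) = int (card (orb aT N \<tau>)) * psi \<tau>"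
proof -
  have "lam (q (indicator (orb aT N \<tau>))) = (\<Sum>z\<in>orb aT N \<tau>. psi z)"
    unfolding lam_q using T.fin_set T.orb_subset[OF XN.subN assms]
    by (simp add: indicator_def of_bool_def if_distrib[of "\<lambda>x. x * _"] sum.If_cases Int_absorb1)
  then show ?thesis using T.sum_orb_invariant[of N psi \<tau>] psi_N by simp
qed

lemma q_N_fixed:
  assumes v: "\<And>n. n \<in> N \<Longrightarrow> T.sh n v = v" and n: "n \<in> N"
  shows "q v (aX n x) = q v x"
  using q_sh[of n v] v[OF n] X.sh_eq_iff[of n "q v"] XN.N_in[OF n] by simp

text \<open>The image under \<open>q\<close> of the indicator of the \<open>N\<close>-orbit has sum
  zero, so \<open>lam_sh_t\<close> gives invariance there; the orbit length is prime to
  \<open>p\<close> and cancels.\<close>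

lemma psi_t:
  assumes \<tau>: "\<tau> \<in> T" "\<not> p dvd card (orb aT N \<tau>)"
  shows "int p dvd psi (aT t \<tau>) - psi \<tau>"
proof -
  have t1: "t [^] (1::nat) = t" using XN.t_in by simp
  let ?i = "indicator (orb aT N \<tau>) :: 't \<Rightarrow> int"
  have sh: "T.sh t ?i = indicator (orb aT N (aT t \<tau>))" using TN.sh_indicator_orb[of 1 \<tau>] t1 by simp
  have "X.sh t (q ?i) = q (indicator (orb aT N (aT t \<tau>)))" using q_sh[OF XN.t_in] sh by metis
  then have "int p dvd lam (q (indicator (orb aT N (aT t \<tau>)))) - lam (q ?i)"
    using lam_sh_t[of "q ?i", OF q_N_fixed[OF TN.sh_indicator_orb_N]] sum_q[of ?i] by simp
  moreover have "card (orb aT N (aT t \<tau>)) = card (orb aT N \<tau>)" using TN.card_orb_pow[of 1 \<tau>] t1 by simp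
  ultimately have "int p dvd int (card (orb aT N \<tau>)) * (psi (aT t \<tau>) - psi \<tau>)"
    using lam_q_orb \<tau> T.act_in XN.t_in by (simp add: right_diff_distrib)
  then show ?thesis using p_cancel \<tau> by blast
qed

text \<open>The indicator of the \<open>N\<close>-orbit is invariant under
  \<open>t ^ TN.per \<tau>\<close>, whose exponent is a proper divisor of \<open>f\<close>, so
  \<open>lam_short\<close> applies.\<close>

lemma psi_short:
  assumes \<tau>: "\<tau> \<in> T" "\<not> p dvd card (orb aT N \<tau>)" and s: "TN.per \<tau> < f"
  shows "int p dvd psi \<tau>"
proof -
  let ?i = "indicator (orb aT N \<tau>) :: 't \<Rightarrow> int"
  have "aT (t [^] f) \<tau> \<in> orb aT N \<tau>" using tf by (auto simp: orb_def)
  then have d: "TN.per \<tau> dvd f" by (simp add: TN.per_iff)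
  have "aT (t [^] TN.per \<tau>) \<tau> \<in> orb aT N \<tau>" by (simp add: TN.per_iff)
  then have "orb aT N (aT (t [^] TN.per \<tau>) \<tau>) = orb aT N \<tau>" by (simp add: TN.orb_sym)
  then have "T.sh (t [^] TN.per \<tau>) ?i = ?i" using TN.sh_indicator_orb by metis
  then have "X.sh (t [^] TN.per \<tau>) (q ?i) = q ?i" using q_sh[OF XN.pow_in] by metis
  then have inv: "q ?i (aX (t [^] TN.per \<tau>) x) = q ?i x" for x
    using X.sh_eq_iff[OF XN.pow_in] by simp
  have "int p dvd lam (q ?i)"
    by (rule lam_short[OF d s q_N_fixed[OF TN.sh_indicator_orb_N] inv])
  then have "int p dvd int (card (orb aT N \<tau>)) * psi \<tau>" unfolding lam_q_orb[OF \<tau>(1)] .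
  then show ?thesis by (rule p_cancel[OF \<tau>(2)])
qed

text \<open>Modulo \<open>p\<close>, only \<open>N\<close>-orbits of length prime to
  \<open>p\<close> count. There \<open>psi\<close> is constant along powers of \<open>t\<close>: it
  vanishes if the period is below \<open>f\<close>, and for period \<open>f\<close> it multiplies
  the sum covered by \<open>norm\<close>.\<close>

lemma p_dvd_lam_q:
  assumes v: "\<And>n. n \<in> N \<Longrightarrow> T.sh n v = v"
    and norm: "\<And>\<tau>. \<tau> \<in> T \<Longrightarrow> \<not> p dvd card (orb aT N \<tau>) \<Longrightarrow> int p dvd (\<Sum>i<f. v (aT (t [^] i) \<tau>))"
  shows "int p dvd lam (q v)"
  unfolding lam_q
proof (rule T.dvd_sum_orbits[OF XN.adjoin_subgroup])
  fix \<tau> assume \<tau>: "\<tau> \<in> T"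
  have vN: "v (aT n z) = v z" if "n \<in> N" for n z using v[OF that] T.sh_eq_iff XN.N_in[OF that] by blast
  have eq: "(\<Sum>z\<in>orb aT TN.A \<tau>. v z * psi z)
      = int (card (orb aT N \<tau>)) * (\<Sum>i<TN.per \<tau>. v (aT (t [^] i) \<tau>) * psi (aT (t [^] i) \<tau>))"
    using TN.sum_orb_adjoin[OF \<tau>, of "\<lambda>z. v z * psi z"] vN psi_N by simp
  show "int p dvd (\<Sum>z\<in>orb aT TN.A \<tau>. v z * psi z)"
  proof (cases "p dvd card (orb aT N \<tau>)")
    case True
    then show ?thesis unfolding eq by (simp add: dvd_mult2)
  next
    case np: False
    have psi_pow: "int p dvd psi (aT (t [^] i) \<tau>) - psi \<tau>" for i :: nat
    proof (induction i)
      case (Suc i)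
      have in_T: "aT (t [^] i) \<tau> \<in> T" by (rule T.act_in[OF XN.pow_in \<tau>])
      have np': "\<not> p dvd card (orb aT N (aT (t [^] i) \<tau>))" using np by (simp only: TN.card_orb_pow) simp
      have "t [^] Suc i = t \<otimes> t [^] i" by (rule X.nat_pow_Suc2[OF XN.t_in])
      then have "aT (t [^] Suc i) \<tau> = aT t (aT (t [^] i) \<tau>)"
        using T.act_mult[OF XN.t_in XN.pow_in] by metis
      then have "int p dvd psi (aT (t [^] Suc i) \<tau>) - psi (aT (t [^] i) \<tau>)"
        using psi_t[OF in_T np'] by metis
      then have "int p dvd (psi (aT (t [^] Suc i) \<tau>) - psi (aT (t [^] i) \<tau>)) + (psi (aT (t [^] i) \<tau>) - psi \<tau>)"
        using Suc by (rule dvd_add)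
      then show ?case by (simp only: diff_add_cancel add_diff_eq)
    qed simp
    have "int p dvd (\<Sum>i<TN.per \<tau>. v (aT (t [^] i) \<tau>) * (psi (aT (t [^] i) \<tau>) - psi \<tau>))"
      by (intro dvd_sum dvd_mult psi_pow)
    moreover have "int p dvd (\<Sum>i<TN.per \<tau>. v (aT (t [^] i) \<tau>)) * psi \<tau>"
    proof (cases "TN.per \<tau> < f")
      case True
      then show ?thesis using psi_short[OF \<tau> np] by simp
    next
      case False
      have "aT (t [^] f) \<tau> \<in> orb aT N \<tau>" using tf by (auto simp: orb_def)
      then have "TN.per \<tau> dvd f" by (simp add: TN.per_iff)
      then have "TN.per \<tau> = f" using False f_pos by (meson dvd_imp_le le_antisym not_le)
      then show ?thesis using norm[OF \<tau> np] by simp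
    qed
    ultimately have "int p dvd (\<Sum>i<TN.per \<tau>. v (aT (t [^] i) \<tau>) * (psi (aT (t [^] i) \<tau>) - psi \<tau>))
        + (\<Sum>i<TN.per \<tau>. v (aT (t [^] i) \<tau>)) * psi \<tau>" by (rule dvd_add)
    moreover have "\<dots> = (\<Sum>i<TN.per \<tau>. v (aT (t [^] i) \<tau>) * psi (aT (t [^] i) \<tau>))"
      by (simp add: sum_distrib_right sum_subtractf right_diff_distrib)
    ultimately show ?thesis unfolding eq by simp
  qed
qed

end

section \<open>An invariant lift with small norm, and the contradiction\<close>

context cyclic_situation
begin

definition E :: "'x \<Rightarrow> int" where
  "E = indicator (orb aX N x1)"

lemma E_N: "n \<in> N \<Longrightarrow> X.sh n E = E"
  unfolding E_def by (rule XN.sh_indicator_orb_N)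

lemma E_supported: "E \<in> supported \<Omega>"
  unfolding E_def by (rule supported_indicator[OF X.orb_subset[OF XN.subN x1(1)]])

lemma E_sum: "(\<Sum>\<xi>\<in>\<Omega>. E \<xi>) = int (card (orb aX N x1))"
  unfolding E_def using X.fin_set X.orb_subset[OF XN.subN x1(1)]
  by (simp add: indicator_def of_bool_def sum.If_cases Int_absorb1)

definition norm_lift :: "('t \<Rightarrow> int) \<Rightarrow> bool" where
  "norm_lift v \<longleftrightarrow> Rel (X.sh t E - E) v \<and> (\<forall>n\<in>N. T.sh n v = v)"

text \<open>Any lift fails to be \<open>N\<close>-invariant by a 1-cocycle of \<open>N\<close> with
  values in \<int>[Y]. Such a cocycle is the coboundary of some \<open>w\<close>, and subtracting
  \<open>alpha w\<close> repairs the lift.\<close>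

lemma ex_norm_lift: "\<exists>v. norm_lift v"
proof -
  have "(\<Sum>\<xi>\<in>\<Omega>. (X.sh t E - E) \<xi>) = 0" using X.sum_sh_1[OF XN.t_in, of E] by (simp add: sum_subtractf)
  moreover have "X.sh t E - E \<in> supported \<Omega>"
    by (intro supported_diff X.sh_supported XN.t_in E_supported)
  ultimately obtain v where v: "Rel (X.sh t E - E) v" using rel_ex by blast
  have fixed: "X.sh n (X.sh t E - E) = X.sh t E - E" if "n \<in> N" for n
    using XN.sh_pow_fixed[OF E_N that, of 1] E_N[OF that] XN.t_in by (simp add: X.sh_diff)
  have "\<exists>c\<in>supported Y. alpha c = T.sh n v - v" if n: "n \<in> N" for n
  proof -
    have "Rel (X.sh n (X.sh t E - E) - (X.sh t E - E)) (T.sh n v - v)"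
      using v rel_sh[OF XN.N_in[OF n] v] by (rule rel_diff[rotated])
    then have "Rel 0 (T.sh n v - v)" by (simp only: fixed[OF n] diff_self)
    then show ?thesis by (elim rel_zeroE) blast
  qed
  then obtain c where c_supp: "\<And>n. n \<in> N \<Longrightarrow> c n \<in> supported Y"
    and c: "\<And>n. n \<in> N \<Longrightarrow> alpha (c n) = T.sh n v - v" by metis
  have "\<exists>w\<in>supported Y. \<forall>n\<in>N. c n = Y.sh n w - w"
  proof (rule Y.cocycle_coboundary[OF XN.subN])
    show "finite N" using finG XN.N_in by (metis finite_subset subsetI)
    fix n m assume nm: "n \<in> N" "m \<in> N"
    have nm': "n \<otimes> m \<in> N" using subgroup.m_closed[OF XN.subN nm] .
    have "alpha (c (n \<otimes> m)) = T.sh (n \<otimes> m) v - v" by (rule c[OF nm'])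
    also have "\<dots> = (T.sh n v - v) + T.sh n (T.sh m v - v)"
      using nm XN.N_in by (simp add: T.sh_mult T.sh_diff del: minus_apply)
    also have "\<dots> = alpha (c n + Y.sh n (c m))"
      using nm XN.N_in by (simp only: alpha_add alpha_sh c)
    finally show "c (n \<otimes> m) = c n + Y.sh n (c m)"
      by (rule alpha_inj[rotated 2]) (use nm nm' XN.N_in c_supp in \<open>simp_all add: supported_add Y.sh_supported\<close>)
  qed (use c_supp in blast)
  then obtain w where w: "w \<in> supported Y" "\<And>n. n \<in> N \<Longrightarrow> c n = Y.sh n w - w" by blast
  have "Rel ((X.sh t E - E) - 0) (v - alpha w)" by (rule rel_diff[OF v rel_alpha[OF w(1)]])
  then have "Rel (X.sh t E - E) (v - alpha w)" by (simp only: diff_zero)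
  moreover have "T.sh n (v - alpha w) = v - alpha w" if n: "n \<in> N" for n
  proof -
    have "alpha (c n) = T.sh n (alpha w) - alpha w"
      unfolding w(2)[OF n] alpha_diff alpha_sh[OF XN.N_in[OF n]] ..
    then have "T.sh n (alpha w) - alpha w = T.sh n v - v" using c[OF n] by simp
    then show ?thesis unfolding T.sh_diff by (simp add: algebra_simps)
  qed
  ultimately show ?thesis unfolding norm_lift_def by blast
qed

text \<open>As \<open>t ^ f\<close> lies in \<open>N\<close> and \<open>v\<close> is
  \<open>N\<close>-invariant, only the exponent modulo \<open>f\<close> matters.\<close>

lemma sh_add_f:
  assumes "norm_lift v" shows "T.sh (t [^] (f * l + i)) v = T.sh (t [^] i) v"
proof -
  have N: "t [^] (f * l) \<in> N"
  proof (induction l)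
    case (Suc l)
    have "t [^] (f * Suc l) = t [^] f \<otimes> t [^] (f * l)" using XN.t_in X.nat_pow_mult by simp
    then show ?case using Suc tf subgroup.m_closed[OF XN.subN] by simp
  qed (use subgroup.one_closed[OF XN.subN] in simp)
  have "t [^] (f * l + i) = t [^] (f * l) \<otimes> t [^] i" using XN.t_in X.nat_pow_mult by simp
  then have "T.sh (t [^] (f * l + i)) v = T.sh (t [^] (f * l)) (T.sh (t [^] i) v)"
    using T.sh_mult[OF XN.pow_in XN.pow_in] by metis
  also have "\<dots> = T.sh (t [^] i) v"
    by (rule TN.sh_pow_fixed) (use assms N in \<open>simp_all add: norm_lift_def\<close>)
  finally show ?thesis .
qed

text \<open>The norm of \<open>t E - E\<close> telescopes to \<open>t ^ f E - E\<close>, which is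
  zero because \<open>t ^ f\<close> lies in \<open>N\<close>.\<close>

lemma norm_lift_kernel:
  assumes v: "norm_lift v"
  shows "\<exists>\<kappa>\<in>supported Y. alpha \<kappa> = (\<Sum>i<f. T.sh (t [^] i) v)"
proof -
  have "Rel (\<Sum>i<f. X.sh (t [^] i) (X.sh t E - E)) (\<Sum>i<f. T.sh (t [^] i) v)"
    by (intro rel_sum rel_sh XN.pow_in) (use v in \<open>simp add: norm_lift_def\<close>)
  moreover have "(\<Sum>i<f. X.sh (t [^] i) (X.sh t E - E)) = 0"
    unfolding X.sh_telescope[OF XN.t_in] E_N[OF tf] by simp
  ultimately have "Rel 0 (\<Sum>i<f. T.sh (t [^] i) v)" by (simp only:)
  then show ?thesis by (elim rel_zeroE) blast
qed

lemma kernel_N: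
  assumes v: "norm_lift v" and k: "\<kappa> \<in> supported Y" "alpha \<kappa> = (\<Sum>i<f. T.sh (t [^] i) v)" and n: "n \<in> N"
  shows "Y.sh n \<kappa> = \<kappa>"
proof (rule alpha_inj)
  have vN: "\<And>n. n \<in> N \<Longrightarrow> T.sh n v = v" using v by (simp add: norm_lift_def)
  have "alpha (Y.sh n \<kappa>) = (\<Sum>i<f. T.sh n (T.sh (t [^] i) v))"
    unfolding alpha_sh[OF XN.N_in[OF n]] k T.sh_sum ..
  also have "\<dots> = alpha \<kappa>" unfolding k by (intro sum.cong refl TN.sh_pow_fixed[OF vN n])
  finally show "alpha (Y.sh n \<kappa>) = alpha \<kappa>" .
qed (use k XN.N_in[OF n] in \<open>simp_all add: Y.sh_supported\<close>)

text \<open>Translation by \<open>t\<close> permutes the terms of the norm of \<open>v\<close>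
  cyclically, and \<open>alpha\<close> is injective.\<close>

lemma kernel_pow:
  assumes v: "norm_lift v" and k: "\<kappa> \<in> supported Y" "alpha \<kappa> = (\<Sum>i<f. T.sh (t [^] i) v)"
  shows "\<kappa> (aY (t [^] (i::nat)) y) = \<kappa> y"
proof -
  have "Y.sh t \<kappa> = \<kappa>"
  proof (rule alpha_inj)
    have "alpha (Y.sh t \<kappa>) = (\<Sum>i<f. T.sh (t [^] Suc i) v)"
      unfolding alpha_sh[OF XN.t_in] k T.sh_sum X.nat_pow_Suc2[OF XN.t_in] T.sh_mult[OF XN.t_in XN.pow_in] ..
    also have "\<dots> = (\<Sum>i<Suc f. T.sh (t [^] i) v) - T.sh (t [^] (0::nat)) v"
      unfolding sum.lessThan_Suc_shift by (simp only: add_diff_cancel_left')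
    \<comment> \<open>The exponent \<open>f * 1 + 0\<close> is \<open>f\<close> in the shape to
      which \<open>sh_add_f\<close> applies.\<close>
    also have "\<dots> = (\<Sum>i<f. T.sh (t [^] i) v) + (T.sh (t [^] (f * 1 + 0)) v - T.sh (t [^] (0::nat)) v)"
      by (simp del: plus_fun_apply)
    also have "\<dots> = alpha \<kappa>" unfolding sh_add_f[OF v] k by (simp del: plus_fun_apply)
    finally show "alpha (Y.sh t \<kappa>) = alpha \<kappa>" .
  qed (use k XN.t_in in \<open>simp_all add: Y.sh_supported\<close>)
  then have t: "\<kappa> (aY t y) = \<kappa> y" for y using Y.sh_eq_iff[OF XN.t_in] by simp
  show ?thesis
  proof (induction i arbitrary: y)
    case (Suc i)
    have "aY (t [^] Suc i) y = aY (t [^] i) (aY t y)"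
      using Y.act_mult[OF XN.pow_in XN.t_in] by simp
    then show ?case using Suc t by simp
  qed simp
qed

text \<open>Here the point \<open>x2\<close> enters: a power of an element stabilizing both \<open>x2\<close> and a point of the
  \<open>N\<close>-orbit of \<open>y\<close> generates the same coset group as \<open>t ^ per y\<close> up to an index prime to \<open>p\<close>, and on
  the stabilizer of \<open>x2\<close> the class of \<open>\<kappa>\<close> is a coboundary.\<close>

lemma kernel_divisible:
  assumes v: "norm_lift v" and k: "\<kappa> \<in> supported Y" "alpha \<kappa> = (\<Sum>i<f. T.sh (t [^] i) v)"
    and y: "y \<in> Y" "\<not> p dvd card (orb aY N y)"
  shows "int (f div YN.per y) dvd \<kappa> y"
proof -
  define j where "j = YN.per y"
  define L where "L = f div j"
  have vN: "\<And>n. n \<in> N \<Longrightarrow> T.sh n v = v" using v by (simp add: norm_lift_def)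
  have vRel: "Rel (X.sh t E - E) v" using v by (simp add: norm_lift_def)
  have "aY (t [^] f) y \<in> orb aY N y" using tf by (auto simp: orb_def)
  then have jf: "j dvd f" by (simp add: YN.per_iff j_def)
  then have f: "f = j * L" by (simp add: L_def)
  have tjy: "aY (t [^] j) y \<in> orb aY N y" by (simp add: YN.per_iff j_def)
  obtain n where n: "n \<in> N" "aX (t [^] j) x2 = aX n x2" using x2(2)[of j] by (auto simp: orb_def)
  have nc: "n \<in> carrier G" "inv n \<in> N" using n XN.N_in subgroup.m_inv_closed[OF XN.subN] by simp_all
  \<comment> \<open>Some \<open>n\<close> in \<open>N\<close> moves \<open>x2\<close> exactly as
    \<open>t ^ j\<close> does, so this element of the coset of \<open>t ^ j\<close> fixes
    \<open>x2\<close>.\<close>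
  define h where "h = inv n \<otimes> t [^] j"
  have h: "h \<in> carrier G" using nc XN.pow_in by (simp add: h_def)
  have hx2: "aX h x2 = x2" using nc n XN.pow_in by (simp add: h_def X.act_mult)
  have "\<exists>y'\<in>orb aY N y. \<exists>r::nat. \<not> p dvd r \<and> aY (h [^] r) y' = y'"
  proof (rule Y.ex_pow_fixing[OF finG h Y.orb_subset[OF XN.subN y(1)] _ y(2)])
    fix z assume z: "z \<in> orb aY N y"
    have "aY (t [^] j) z \<in> orb aY N (aY (t [^] j) y)" using z YN.pow_orb[of z y j] by simp
    then have "aY (t [^] j) z \<in> orb aY N y" using tjy YN.orb_sym by metis
    then show "aY h z \<in> orb aY N y"
      using YN.act_orb_N[OF nc(2)] nc XN.pow_in by (simp add: h_def Y.act_mult)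
  qed
  then obtain y' r where y': "y' \<in> orb aY N y" and r: "\<not> p dvd r" "aY (h [^] (r::nat)) y' = y'" by blast
  \<comment> \<open>This power fixes \<open>y'\<close> as well as \<open>x2\<close> and lies in the
    coset of \<open>t ^ (j * r)\<close> with \<open>r\<close> prime to \<open>p\<close>.\<close>
  define s where "s = h [^] r"
  have s: "s \<in> carrier G" using h by (simp add: s_def)
  have sx2: "aX s x2 = x2" unfolding s_def by (rule X.pow_fix[OF h hx2])
  have sy': "aY s y' = y'" using r by (simp add: s_def)
  obtain m where m: "m \<in> N" "s = m \<otimes> t [^] (j * r)"
    using XN.coset_pow[OF nc(2), of j r] by (auto simp: s_def h_def)
  define b where "b = int (card (orb aX N x1))"
  \<comment> \<open>The correction at \<open>x2\<close> makes the sum zero, so \<open>d\<close>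
    lifts; because \<open>s\<close> fixes \<open>x2\<close>, it does not affect
    \<open>s d - d\<close>.\<close>
  define d where "d = E - (\<lambda>\<xi>. b * indicator {x2} \<xi>)"
  have d_supp: "d \<in> supported \<Omega>"
    unfolding d_def using x2(1) by (intro supported_diff E_supported supported_scale supported_indicator) simp
  have "(\<Sum>\<xi>\<in>\<Omega>. indicator {x2} \<xi>) = (1::int)" using x2(1) X.fin_set by (simp add: indicator_def)
  then have "(\<Sum>\<xi>\<in>\<Omega>. d \<xi>) = 0" using E_sum by (simp add: d_def b_def sum_subtractf sum_distrib_left[symmetric])
  then obtain eh where eh: "Rel d eh" using rel_ex[OF d_supp] by blast
  have sd: "X.sh s d - d = (\<Sum>i<j * r. X.sh (t [^] i) (X.sh t E - E))"
  proof -
    have "X.sh s (indicator {x2}) = (indicator {x2} :: 'x \<Rightarrow> int)"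
      using X.sh_indicator[OF s, of "{x2}"] sx2 by simp
    then have "X.sh s d - d = X.sh s E - E" unfolding d_def X.sh_diff X.sh_scale by (simp add: fun_eq_iff)
    also have "X.sh s E = X.sh (t [^] (j * r)) E"
      using XN.sh_coset_pow[OF E_N m(1), of "j * r" 0] by (simp add: m(2))
    finally show ?thesis unfolding X.sh_telescope[OF XN.t_in] .
  qed
  have "Rel ((X.sh s d - d) - (\<Sum>i<j * r. X.sh (t [^] i) (X.sh t E - E)))
      ((T.sh s eh - eh) - (\<Sum>i<j * r. T.sh (t [^] i) v))"
    by (intro rel_diff rel_sum rel_sh s eh vRel XN.pow_in)
  then have "Rel 0 ((T.sh s eh - eh) - (\<Sum>i<j * r. T.sh (t [^] i) v))" by (simp only: sd diff_self)
  then obtain u where u: "u \<in> supported Y" "alpha u = (T.sh s eh - eh) - (\<Sum>i<j * r. T.sh (t [^] i) v)"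
    by (rule rel_zeroE)
  have shift_pow: "T.sh (s [^] l) (T.sh (t [^] i) v) = T.sh (t [^] (j * r * l + i)) v" for l i :: nat
  proof -
    obtain m' where m': "m' \<in> N" "s [^] l = m' \<otimes> t [^] (j * r * l)"
      using XN.coset_pow[OF m(1), of "j * r" l] m(2) by auto
    show ?thesis unfolding m'(2) by (rule TN.sh_coset_pow[OF vN m'(1)])
  qed
  \<comment> \<open>The translates of \<open>u\<close> by \<open>L\<close> powers of
    \<open>s\<close> involve \<open>f * r\<close> powers of \<open>t\<close>, that is
    \<open>r\<close> full norms of \<open>v\<close>. Adding \<open>r\<close> copies of
    \<open>\<kappa>\<close> cancels these and leaves the coboundary of \<open>eh\<close> at
    \<open>s ^ L\<close>, which vanishes at the fixed point \<open>y'\<close>.\<close>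
  define W where "W = (\<Sum>l<L. Y.sh (s [^] l) u) + (\<Sum>l<r. \<kappa>)"
  have W_supp: "W \<in> supported Y"
    unfolding W_def by (intro supported_add supported_sum Y.sh_supported u k X.nat_pow_closed s)
  have "(\<Sum>l<L. alpha (Y.sh (s [^] l) u)) = (\<Sum>l<L. T.sh (s [^] l) (T.sh s eh - eh)) 
      - (\<Sum>l<L. \<Sum>i<j * r. T.sh (s [^] l) (T.sh (t [^] i) v))"
    unfolding alpha_sh[OF X.nat_pow_closed[OF s]] u(2) T.sh_diff[of _ "T.sh s eh - eh"] T.sh_sum
    by (rule sum_subtractf)
  also have "(\<Sum>l<L. \<Sum>i<j * r. T.sh (s [^] l) (T.sh (t [^] i) v)) = (\<Sum>i<j * r * L. T.sh (t [^] i) v)"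
    unfolding shift_pow by (rule sum_lessThan_mult)
  also have "j * r * L = f * r" by (simp add: f)
  also have "(\<Sum>i<f * r. T.sh (t [^] i) v) = (\<Sum>l<r. alpha \<kappa>)"
    unfolding k(2) sum_lessThan_mult[symmetric] sh_add_f[OF v] ..
  finally have W: "alpha W = T.sh (s [^] L) eh - eh"
    unfolding W_def alpha_add alpha_sum T.sh_telescope[OF s] by (simp only: diff_add_cancel)
  have "W y' = 0"
    by (rule alpha_coboundary_vanishes_at_fixed[OF _ W_supp W Y.pow_fix[OF s sy']]) (simp add: s)
  moreover have "Y.sh (s [^] l) u y' = u y'" for l :: nat
    by (rule Y.sh_fixed_apply[OF _ Y.pow_fix[OF s sy']]) (simp add: s)
  ultimately have "int L * u y' + int r * \<kappa> y' = 0" by (simp add: W_def sum_fun_apply)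
  then have "int r * \<kappa> y' = int L * (- u y')" by simp
  then have "int L dvd int r * \<kappa> y'" by simp
  moreover have "coprime (int L) (int r)"
  proof -
    obtain c where "f = p ^ c" using f_power by blast
    then have "L dvd p ^ c" using f by (metis dvd_triv_right)
    moreover have "coprime (p ^ c) r" using r(1) prime_p prime_imp_coprime by (metis coprime_power_left_iff)
    ultimately show ?thesis using coprime_divisors[of L "p ^ c" r r] by simp
  qed
  ultimately have "int L dvd \<kappa> y'" using coprime_dvd_mult_right_iff by blast
  moreover have "\<kappa> y' = \<kappa> y"
  proof -
    obtain n' where n': "n' \<in> N" "y' = aY n' y" using y' by (auto simp: orb_def)
    then show ?thesis using kernel_N[OF v k n'(1)] Y.sh_eq_iff[OF XN.N_in[OF n'(1)]] by simp
  qed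
  ultimately show ?thesis by (simp add: L_def j_def)
qed


text \<open>Replacing \<open>v\<close> by \<open>v - alpha \<mu>\<close> subtracts the norm of
  \<open>\<mu>\<close> from \<open>\<kappa>\<close>. That norm meets each of the
  \<open>per y\<close> many \<open>N\<close>-orbits \<open>f div per y\<close> times, and
  \<open>kernel_divisible\<close> makes the required division exact.\<close>

lemma ex_norm_lift_small_kernel:
  "\<exists>v \<kappa>. norm_lift v \<and> \<kappa> \<in> supported Y \<and> alpha \<kappa> = (\<Sum>i<f. T.sh (t [^] i) v) \<and>
     (\<forall>y\<in>Y. \<not> p dvd card (orb aY N y) \<longrightarrow> \<kappa> y = 0)"
proof -
  obtain v where v: "norm_lift v" using ex_norm_lift by blast
  obtain \<kappa> where k: "\<kappa> \<in> supported Y" "alpha \<kappa> = (\<Sum>i<f. T.sh (t [^] i) v)"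
    using norm_lift_kernel[OF v] by blast
  obtain l :: "'y \<Rightarrow> int" where l_N: "\<And>n x. n \<in> N \<Longrightarrow> l (aY n x) = l x"
    and l_pow: "\<And>x (i::nat). int (YN.per x) dvd l (aY (t [^] i) x) - l x - int i"
    using YN.ex_label by blast
  \<comment> \<open>The condition on \<open>l\<close> selects one \<open>N\<close>-orbit, that of
    label zero, in each orbit of the extended group.\<close>
  define \<mu> where "\<mu> y = (if \<not> p dvd card (orb aY N y) \<and> int (YN.per y) dvd l y
    then \<kappa> y div int (f div YN.per y) else 0)" for y
  have mu_supp: "\<mu> \<in> supported Y" using k by (auto simp: supported_def \<mu>_def)
  have mu_N: "Y.sh n \<mu> = \<mu>" if n: "n \<in> N" for n
  proof -
    have "\<mu> (aY n y) = \<mu> y" for y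
    proof -
      have o: "aY n y \<in> orb aY N y" using n by (auto simp: orb_def)
      have "\<kappa> (aY n y) = \<kappa> y" using kernel_N[OF v k n] Y.sh_eq_iff[OF XN.N_in[OF n]] by simp
      then show ?thesis unfolding \<mu>_def by (simp only: YN.card_orb_N[OF o] YN.per_N[OF o] l_N[OF n])
    qed
    then show ?thesis using Y.sh_eq_iff[OF XN.N_in[OF n]] by simp
  qed
  define \<kappa>' where "\<kappa>' = \<kappa> - (\<Sum>i<f. Y.sh (t [^] i) \<mu>)"
  define v' where "v' = v - alpha \<mu>"
  have "norm_lift v'"
    unfolding norm_lift_def
  proof (intro conjI ballI)
    have "Rel (X.sh t E - E) v" using v by (simp add: norm_lift_def)
    then have "Rel ((X.sh t E - E) - 0) v'" unfolding v'_def by (rule rel_diff[OF _ rel_alpha[OF mu_supp]])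
    then show "Rel (X.sh t E - E) v'" by (simp only: diff_zero)
    fix n assume n: "n \<in> N"
    then have "T.sh n v = v" using v by (simp add: norm_lift_def)
    moreover have "T.sh n (alpha \<mu>) = alpha \<mu>" using alpha_sh[OF XN.N_in[OF n], of \<mu>] mu_N[OF n] by simp
    ultimately show "T.sh n v' = v'" unfolding v'_def T.sh_diff by simp
  qed
  moreover have "\<kappa>' \<in> supported Y"
    unfolding \<kappa>'_def by (intro supported_diff supported_sum Y.sh_supported k mu_supp XN.pow_in)
  moreover have "alpha \<kappa>' = (\<Sum>i<f. T.sh (t [^] i) v')"
    unfolding \<kappa>'_def v'_def alpha_diff k alpha_sum alpha_sh[OF XN.pow_in] T.sh_diff by (rule sum_subtractf[symmetric])
  moreover have "\<kappa>' y = 0" if y: "y \<in> Y" "\<not> p dvd card (orb aY N y)" for y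
  proof -
    let ?j = "YN.per y"
    have "aY (t [^] f) y \<in> orb aY N y" using tf by (auto simp: orb_def)
    then have jf: "?j dvd f" by (simp add: YN.per_iff)
    have "Y.sh (t [^] i) \<mu> y = (if int ?j dvd l y - int i then 1 else 0) * (\<kappa> y div int (f div ?j))" for i :: nat
    proof -
      define z where "z = aY (inv (t [^] i)) y"
      have yz: "y = aY (t [^] i) z" using Y.act_inv2[OF XN.pow_in] by (simp add: z_def)
      have 1: "card (orb aY N z) = card (orb aY N y)" unfolding yz by (rule YN.card_orb_pow[symmetric])
      have 2: "YN.per z = ?j" unfolding yz by (rule YN.per_pow[symmetric])
      have 3: "\<kappa> z = \<kappa> y" unfolding yz by (rule kernel_pow[OF v k, symmetric])
      have "int ?j dvd l y - l z - int i" using l_pow[of z i] 2 yz by simp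
      then have "int ?j dvd (l y - int i) - l z" by (simp add: algebra_simps)
      then have 4: "int ?j dvd l z \<longleftrightarrow> int ?j dvd l y - int i"
        by (metis dvd_diff_right_iff dvd_diff_commute)
      have "Y.sh (t [^] i) \<mu> y = \<mu> z" by (simp add: shift_def z_def)
      then show ?thesis using y(2) by (simp add: \<mu>_def 1 2 3 4)
    qed
    then have "(\<Sum>i<f. Y.sh (t [^] i) \<mu> y)
        = (\<Sum>i<f. if int ?j dvd l y - int i then 1 else 0) * (\<kappa> y div int (f div ?j))"
      by (simp only: sum_distrib_right)
    also have "\<dots> = int (f div ?j) * (\<kappa> y div int (f div ?j))"
      by (simp only: sum_residue_count[OF YN.per_pos jf])
    also have "\<dots> = \<kappa> y" using kernel_divisible[OF v k y] by simp
    finally show ?thesis by (simp add: \<kappa>'_def sum_fun_apply)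
  qed
  ultimately show ?thesis by blast
qed

text \<open>Sum \<open>alpha \<kappa>\<close> over the \<open>N\<close>-orbit of
  \<open>\<tau>\<close> and exchange the sums: each \<open>N\<close>-orbit in \<open>Y\<close>
  contributes a multiple of its length, and \<open>\<kappa>\<close> vanishes where this length is
  prime to \<open>p\<close>. The length of the orbit of \<open>\<tau>\<close> then cancels.\<close>

lemma p_dvd_alpha:
  assumes k: "\<And>n. n \<in> N \<Longrightarrow> Y.sh n \<kappa> = \<kappa>"
    and small: "\<And>y. y \<in> Y \<Longrightarrow> \<not> p dvd card (orb aY N y) \<Longrightarrow> \<kappa> y = 0"
    and \<tau>: "\<tau> \<in> T" "\<not> p dvd card (orb aT N \<tau>)"
  shows "int p dvd alpha \<kappa> \<tau>"
proof -
  define \<phi> where "\<phi> y = (\<Sum>z\<in>orb aT N \<tau>. ma z y)" for y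
  have phi_N: "\<phi> (aY n y) = \<phi> y" if n: "n \<in> N" for n y
  proof -
    have g: "n \<in> carrier G" "inv n \<in> N" using n XN.N_in subgroup.m_inv_closed[OF XN.subN] by simp_all
    have "bij_betw (aT n) (orb aT N \<tau>) (orb aT N \<tau>)"
      by (rule bij_betw_byWitness[where f' = "aT (inv n)"])
        (use g n TN.act_orb_N in auto)
    then have "\<phi> (aY n y) = (\<Sum>z\<in>orb aT N \<tau>. ma (aT n z) (aY n y))"
      unfolding \<phi>_def by (rule sum.reindex_bij_betw[symmetric])
    then show ?thesis by (simp only: ma_equiv[OF g(1)] \<phi>_def)
  qed
  have k_N: "\<kappa> (aY n y) = \<kappa> y" if "n \<in> N" for n y
    using k[OF that] Y.sh_eq_iff[OF XN.N_in[OF that]] by simp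
  have inv: "alpha \<kappa> (aT n z) = alpha \<kappa> z" if n: "n \<in> N" for n z
    using alpha_sh[OF XN.N_in[OF n], of \<kappa>] k[OF n] T.sh_eq_iff[OF XN.N_in[OF n], of "alpha \<kappa>"] by simp
  have "int (card (orb aT N \<tau>)) * alpha \<kappa> \<tau> = (\<Sum>z\<in>orb aT N \<tau>. alpha \<kappa> z)"
    by (rule T.sum_orb_invariant[symmetric]) (rule inv)
  also have "\<dots> = (\<Sum>z\<in>orb aT N \<tau>. \<Sum>y\<in>Y. \<kappa> y * ma z y)" by (simp add: alpha_def mult.commute)
  also have "\<dots> = (\<Sum>y\<in>Y. \<kappa> y * \<phi> y)" by (subst sum.swap) (simp add: \<phi>_def sum_distrib_left)
  finally have eq: "int (card (orb aT N \<tau>)) * alpha \<kappa> \<tau> = (\<Sum>y\<in>Y. \<kappa> y * \<phi> y)" .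
  have "int p dvd (\<Sum>y\<in>Y. \<kappa> y * \<phi> y)"
  proof (rule Y.dvd_sum_invariant[OF XN.subN])
    fix y assume y: "y \<in> Y"
    show "int p dvd int (card (orb aY N y)) * (\<kappa> y * \<phi> y)"
      using small[OF y] by (cases "p dvd card (orb aY N y)") (simp_all add: dvd_mult2)
  qed (simp add: k_N phi_N)
  then have "int p dvd int (card (orb aT N \<tau>)) * alpha \<kappa> \<tau>" unfolding eq .
  then show ?thesis by (rule p_cancel[OF \<tau>(2)])
qed

theorem contradiction: False
proof -
  obtain v \<kappa> where v: "norm_lift v" and k: "\<kappa> \<in> supported Y" "alpha \<kappa> = (\<Sum>i<f. T.sh (t [^] i) v)"
    and small: "\<And>y. y \<in> Y \<Longrightarrow> \<not> p dvd card (orb aY N y) \<Longrightarrow> \<kappa> y = 0"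
    using ex_norm_lift_small_kernel by metis
  have vN: "\<And>n. n \<in> N \<Longrightarrow> T.sh n v = v" and vRel: "Rel (X.sh t E - E) v"
    using v by (simp_all add: norm_lift_def)
  have "int p dvd lam (q v)"
  proof (rule p_dvd_lam_q[OF vN])
    fix \<tau> assume \<tau>: "\<tau> \<in> T" "\<not> p dvd card (orb aT N \<tau>)"
    \<comment> \<open>Starting at the last power keeps exponents natural: undoing
      \<open>t ^ i\<close> lowers \<open>f - 1\<close> to \<open>f - Suc i\<close>.\<close>
    define \<sigma> where "\<sigma> = aT (t [^] (f - 1)) \<tau>"
    have "card (orb aT N \<sigma>) = card (orb aT N \<tau>)" unfolding \<sigma>_def by (rule TN.card_orb_pow)
    then have "int p dvd alpha \<kappa> \<sigma>"
      by (intro p_dvd_alpha kernel_N[OF v k] small)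
        (use \<tau> in \<open>simp_all add: \<sigma>_def T.act_in[OF XN.pow_in]\<close>)
    moreover have "T.sh (t [^] i) v \<sigma> = v (aT (t [^] (f - Suc i)) \<tau>)" if "i < f" for i
    proof -
      have "\<sigma> = aT (t [^] i) (aT (t [^] (f - Suc i)) \<tau>)"
        using that by (simp add: \<sigma>_def TN.act_pow_add[symmetric])
      then show ?thesis using T.sh_apply_act[OF XN.pow_in] by simp
    qed
    then have "alpha \<kappa> \<sigma> = (\<Sum>i<f. v (aT (t [^] (f - Suc i)) \<tau>))"
      unfolding k(2) sum_fun_apply by (intro sum.cong) auto
    ultimately show "int p dvd (\<Sum>i<f. v (aT (t [^] i) \<tau>))"
      using sum.nat_diff_reindex[of "\<lambda>i. v (aT (t [^] i) \<tau>)" f] by simp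
  qed
  moreover have "lam (q v) = lam (X.sh t E) - lam E"
    unfolding relq[OF vRel] by (simp add: lam_def sum_subtractf left_diff_distrib)
  moreover have "int p dvd lam (X.sh t E) - lam E - (\<Sum>\<xi>\<in>\<Omega>. E \<xi>)"
  proof (rule lam_sh_t)
    show "E (aX n x) = E x" if "n \<in> N" for n x
      using E_N[OF that] X.sh_eq_iff[OF XN.N_in[OF that], of E] by simp
  qed
  ultimately have "int p dvd (\<Sum>\<xi>\<in>\<Omega>. E \<xi>)" by (metis dvd_diff_right_iff)
  then show False using x1(2) by (simp add: E_sum)
qed

end

section \<open>Reduction to a normal subgroup extended by a single element\<close>

lemma (in normalized_subgroup) adjoin_adjoin:
  assumes "j dvd (f::nat)"
  shows "adjoin G (adjoin G N (t [^] f)) (t [^] j) = adjoin G N (t [^] j)"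
proof
  obtain d where f: "f = j * d" using assms by blast
  show "adjoin G (adjoin G N (t [^] f)) (t [^] j) \<subseteq> adjoin G N (t [^] j)"
  proof
    fix g assume "g \<in> adjoin G (adjoin G N (t [^] f)) (t [^] j)"
    then obtain n and i i' :: nat where g: "n \<in> N" "g = n \<otimes> (t [^] f) [^] i \<otimes> (t [^] j) [^] i'"
      by (auto simp: adjoin_def)
    have "g = n \<otimes> (t [^] j) [^] (d * i + i')"
      using g N_in t_in by (simp add: f nat_pow_pow m_assoc nat_pow_mult algebra_simps)
    then show "g \<in> adjoin G N (t [^] j)" using g by (auto simp: adjoin_def)
  qed
  show "adjoin G N (t [^] j) \<subseteq> adjoin G (adjoin G N (t [^] f)) (t [^] j)"
  proof
    fix g assume "g \<in> adjoin G N (t [^] j)"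
    then obtain n and i :: nat where g: "n \<in> N" "g = n \<otimes> (t [^] j) [^] i" by (auto simp: adjoin_def)
    interpret F: normalized_subgroup G N "t [^] f" by (rule normalized_pow)
    have "n \<in> adjoin G N (t [^] f)" using F.N_subset_adjoin g by blast
    then show "g \<in> adjoin G (adjoin G N (t [^] f)) (t [^] j)" using g by (auto simp: adjoin_def)
  qed
qed

text \<open>Powers of \<open>t\<close> commute with \<open>t\<close>, so conjugation by
  \<open>t\<close> changes only the factor in \<open>N\<close>.\<close>

lemma (in normalized_subgroup) normalized_adjoin_pow: "normalized_subgroup G (adjoin G N (t [^] (f::nat))) t"
proof (intro normalized_subgroup.intro normalized_subgroup_axioms.intro)
  interpret F: normalized_subgroup G N "t [^] f" by (rule normalized_pow)
  show "subgroup (adjoin G N (t [^] f)) G" by (rule F.adjoin_subgroup)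
  fix g assume "g \<in> adjoin G N (t [^] f)"
  then obtain n and i :: nat where g: "n \<in> N" "g = n \<otimes> (t [^] f) [^] i" by (auto simp: adjoin_def)
  have comm: "(t [^] f) [^] i \<otimes> inv t = inv t \<otimes> (t [^] f) [^] i"
  proof -
    have "t \<otimes> (t [^] f) [^] i = (t [^] f) [^] i \<otimes> t" using t_in pow_mult_distrib
      by (metis nat_pow_Suc nat_pow_Suc2 nat_pow_pow)
    then show ?thesis using t_in by (metis inv_closed inv_solve_left inv_solve_right m_assoc m_closed nat_pow_closed)
  qed
  have "t \<otimes> g \<otimes> inv t = t \<otimes> n \<otimes> ((t [^] f) [^] i \<otimes> inv t)"
    using g N_in t_in by (simp add: m_assoc)
  also have "\<dots> = (t \<otimes> n \<otimes> inv t) \<otimes> (t [^] f) [^] i"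
    unfolding comm using g N_in t_in by (simp add: m_assoc)
  finally show "t \<otimes> g \<otimes> inv t \<in> adjoin G N (t [^] f)" using conj_in[OF g(1)] by (auto simp: adjoin_def)
qed (use fin t_in in simp_all)

context permutation_resolution
begin

text \<open>The point \<open>x1\<close> ensures that some enlargement of \<open>N0\<close> by powers
  of \<open>t\<close> has an orbit of length prime to \<open>p\<close>; \<open>x2\<close> has an
  \<open>N0\<close>-orbit stable under the whole group.\<close>

theorem no_resolution:
  assumes p: "Factorial_Ring.prime p" and pk: "k \<ge> 1" "odd p \<or> k \<ge> 2"
    and orbs: "\<And>x. x \<in> \<Omega> \<Longrightarrow> p ^ k dvd card (orb aX (carrier G) x)"
    and N0: "N0 \<lhd> G" and x1: "x1 \<in> \<Omega>" "\<And>n. n \<in> N0 \<Longrightarrow> aX n x1 = x1"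
    and x2: "x2 \<in> \<Omega>" "\<And>g. g \<in> carrier G \<Longrightarrow> aX g x2 \<in> orb aX N0 x2"
  shows False
proof -
  obtain t0 where t0: "t0 \<in> carrier G" "\<And>(r::nat) x. x \<in> \<Omega> \<Longrightarrow> aX (t0 [^] r) x = x \<Longrightarrow> p ^ k dvd r"
    using ex_element_with_long_orbits[OF p pk(1) x1(1) orbs] by blast
  have o: "order G \<noteq> 0" using finG X.order_gt_0_iff_finite by simp
  obtain e b where eb: "order G = p ^ e * b" "\<not> p dvd b"
    using multiplicity_decompose'[of "order G" p] o p not_prime_unit by metis
  \<comment> \<open>The \<open>p\<close>-part of \<open>t0\<close>. Since \<open>b\<close> is prime
    to \<open>p\<close>, the orbits of \<open>t\<close> on \<Omega> keep a length divisible by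
    \<open>p ^ k\<close>.\<close>
  define t where "t = t0 [^] b"
  have t: "t \<in> carrier G" using t0 by (simp add: t_def)
  have te: "t [^] (p ^ e) = \<one>"
    using t0 eb X.pow_order_eq_1[OF t0(1)] by (simp add: t_def X.nat_pow_pow mult.commute)
  have t_long: "p ^ k dvd r" if "x \<in> \<Omega>" "aX (t [^] r) x = x" for r :: nat and x
  proof -
    have "p ^ k dvd b * r" using t0(2)[OF that(1), of "b * r"] that t0(1) by (simp add: t_def X.nat_pow_pow)
    moreover have "coprime (p ^ k) b" using eb(2) p prime_imp_coprime by (metis coprime_power_left_iff)
    ultimately show ?thesis using coprime_dvd_mult_right_iff by blast
  qed
  interpret Z: normalized_subgroup G N0 t
    by (intro normalized_subgroup.intro normalized_subgroup_axioms.intro X.is_group)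
      (use finG t normal.inv_op_closed2[OF N0 t] normal_imp_subgroup[OF N0] in auto)
  \<comment> \<open>The least \<open>c\<close> with \<open>P c\<close> gives the largest suitable
    enlargement of \<open>N0\<close> and, through its minimality, the assumption
    \<open>minimal\<close>. Some \<open>c\<close> exists: for \<open>e\<close> nothing is adjoined,
    and \<open>N0\<close> fixes \<open>x1\<close>.\<close>
  define P where "P c \<longleftrightarrow> (\<exists>x\<in>\<Omega>. \<not> p dvd card (orb aX (adjoin G N0 (t [^] (p ^ c))) x))" for c :: nat
  have "P e"
  proof -
    have "adjoin G N0 (t [^] (p ^ e)) \<subseteq> N0" unfolding te using Z.N_in by (auto simp: adjoin_def)
    moreover have "\<one> \<in> adjoin G N0 (t [^] (p ^ e))"
      using subgroup.one_closed[OF Z.subN] unfolding te by (auto simp: adjoin_def intro!: exI[of _ \<one>])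
    ultimately have "orb aX (adjoin G N0 (t [^] (p ^ e))) x1 = {x1}" using x1(2) by (auto simp: orb_def intro!: image_eqI[of _ _ \<one>])
    then have "card (orb aX (adjoin G N0 (t [^] (p ^ e))) x1) = 1" by simp
    then show ?thesis unfolding P_def using x1(1) p by (metis not_prime_unit)
  qed
  define c where "c = (LEAST c. P c)"
  have Pc: "P c" unfolding c_def using \<open>P e\<close> by (rule LeastI)
  have Pmin: "\<not> P c'" if "c' < c" for c' using that unfolding c_def by (rule not_less_Least)
  define f where "f = p ^ c"
  define N where "N = adjoin G N0 (t [^] f)"
  interpret NS: normalized_subgroup G N t unfolding N_def by (rule Z.normalized_adjoin_pow)
  interpret F: normalized_subgroup G N0 "t [^] f" by (rule Z.normalized_pow)
  have adj: "adjoin G N (t [^] j) = adjoin G N0 (t [^] j)" if "j dvd f" for j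
    unfolding N_def by (rule Z.adjoin_adjoin[OF that])
  obtain z1 where z1: "z1 \<in> \<Omega>" "\<not> p dvd card (orb aX N z1)" using Pc by (auto simp: P_def N_def f_def)
  have "cyclic_situation G \<Omega> aX T aT Y aY Rel ma mq N t p k f z1 x2"
  proof (intro cyclic_situation.intro cyclic_situation_axioms.intro normalized_gset.intro)
    show "permutation_resolution G \<Omega> aX T aT Y aY Rel ma mq" by (rule permutation_resolution_axioms)
    show "t [^] f \<in> N" using F.pow_in_adjoin[of 1] t by (simp add: N_def)
    show "p ^ k dvd card (orb aX (adjoin G N t) x)" if x: "x \<in> \<Omega>" for x
    proof -
      let ?S = "orb aX (adjoin G N t) x"
      \<comment> \<open>Every orbit under the powers of \<open>t\<close> alone has length divisible
        by \<open>p ^ k\<close>, and \<open>?S\<close> is a union of such orbits.\<close>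
      interpret C: normalized_gset G "{\<one>}" t \<Omega> aX
        by (intro normalized_gset.intro normalized_subgroup.intro normalized_subgroup_axioms.intro 
            X.is_group X.finite_gset_axioms X.triv_subgroup) (use finG t in auto)
      have orb1: "orb aX {\<one>} z = {z}" for z by (simp add: orb_def)
      have orbC: "p ^ k dvd card (orb aX C.A z)" if "z \<in> \<Omega>" for z
      proof -
        have "aX (t [^] C.per z) z \<in> orb aX {\<one>} z" by (simp add: C.per_iff)
        then have "p ^ k dvd C.per z" using orb1 t_long[OF that] by simp
        then show ?thesis using C.card_orb_adjoin[OF that] by (simp add: orb1)
      qed
      have "int (p ^ k) dvd (\<Sum>z\<in>\<Omega>. indicator ?S z)"
      proof (rule X.dvd_sum_invariant[OF C.adjoin_subgroup])
        fix g z assume "g \<in> C.A"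
        then obtain i :: nat where "g = t [^] i" using t by (auto simp: adjoin_def)
        then have g: "g \<in> adjoin G N t" "g \<in> carrier G" using NS.pow_in_adjoin t by simp_all
        have "aX g z \<in> orb aX (adjoin G N t) z" using g by (auto simp: orb_def)
        then have "aX g z \<in> ?S \<longleftrightarrow> z \<in> ?S"
          using X.orb_eq[OF NS.adjoin_subgroup] X.orb_self[OF NS.adjoin_subgroup] by metis
        then show "indicator ?S (aX g z) = (indicator ?S z :: int)" by (simp add: indicator_def)
      next
        fix z assume "z \<in> \<Omega>"
        then show "int (p ^ k) dvd int (card (orb aX C.A z)) * indicator ?S z"
          using orbC by (simp add: dvd_mult2 del: of_nat_power)
      qed
      moreover have "(\<Sum>z\<in>\<Omega>. indicator ?S z) = int (card ?S)"
        using X.fin_set X.orb_subset[OF NS.adjoin_subgroup x]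
        by (simp add: indicator_def of_bool_def sum.If_cases Int_absorb1)
      ultimately show ?thesis by (simp only: int_dvd_int_iff)
    qed
    show "p dvd card (orb aX (adjoin G N (t [^] j)) x)" if j: "j dvd f" "j < f" "x \<in> \<Omega>" for j x
    proof -
      obtain c' where c': "j = p ^ c'" "c' \<le> c" using j(1) divides_primepow_nat[OF p, of j c] unfolding f_def by auto
      then have "c' < c" using that(2) by (cases "c' = c") (auto simp: f_def)
      then show ?thesis unfolding adj[OF j(1)] unfolding c'(1) using Pmin[of c'] that(3) by (simp add: P_def)
    qed
    show "aX (t [^] i) x2 \<in> orb aX N x2" for i :: nat
    proof -
      have "N0 \<subseteq> N" unfolding N_def by (rule F.N_subset_adjoin)
      then show ?thesis using x2(2)[of "t [^] i"] t by (auto simp: orb_def)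
    qed
  qed (use p pk f_def z1 x2(1) X.finite_gset_axioms T.finite_gset_axioms Y.finite_gset_axioms
      NS.normalized_subgroup_axioms in auto)
  then show False by (rule cyclic_situation.contradiction)
qed

end

section \<open>From lattices to resolutions\<close>

text \<open>Additivity is asked only on supported functions, since \<open>gmap\<close> and
  \<open>glattice\<close> say nothing outside \<open>vecs n\<close>.\<close>

definition additive_on :: "'x set \<Rightarrow> (('x \<Rightarrow> int) \<Rightarrow> ('y \<Rightarrow> int)) \<Rightarrow> bool" where
  "additive_on A f \<longleftrightarrow> (\<forall>v\<in>supported A. \<forall>w\<in>supported A. f (v + w) = f v + f w)"

lemma additive_onD: "additive_on A f \<Longrightarrow> v \<in> supported A \<Longrightarrow> w \<in> supported A \<Longrightarrow> f (v + w) = f v + f w"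
  by (simp add: additive_on_def)

lemma additive_on_zero: assumes "additive_on A f" shows "f 0 = 0"
  using additive_onD[OF assms, of 0 0] by simp

lemma additive_on_diff:
  assumes f: "additive_on A f" and v: "v \<in> supported A" and w: "w \<in> supported A"
  shows "f (v - w) = f v - f w"
proof -
  have "f ((v - w) + w) = f (v - w) + f w" by (rule additive_onD[OF f supported_diff[OF v w] w])
  then show ?thesis by (simp only: diff_add_cancel) (simp only: add_diff_cancel)
qed

lemma additive_on_scale:
  assumes f: "additive_on A f" and v: "v \<in> supported A"
  shows "f (\<lambda>x. c * v x) = (\<lambda>x. c * f v x)"
proof -
  have nat: "f (\<lambda>x. int n * v x) = (\<lambda>x. int n * f v x)" for n
  proof (induction n)
    case 0 then show ?case using additive_on_zero[OF f] by (simp add: zero_fun_def)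
  next
    case (Suc n)
    have "(\<lambda>x. int (Suc n) * v x) = (\<lambda>x. int n * v x) + v" by (simp add: fun_eq_iff algebra_simps)
    then have "f (\<lambda>x. int (Suc n) * v x) = f (\<lambda>x. int n * v x) + f v"
      using additive_onD[OF f supported_scale[OF v] v] by metis
    then show ?case using Suc by (simp add: fun_eq_iff algebra_simps)
  qed
  show ?thesis
  proof (cases "c \<ge> 0")
    case True then show ?thesis using nat[of "nat c"] by simp
  next
    case False
    have "(\<lambda>x. c * v x) = 0 - (\<lambda>x. int (nat (- c)) * v x)" using False by (simp add: fun_eq_iff)
    then have "f (\<lambda>x. c * v x) = f 0 - f (\<lambda>x. int (nat (- c)) * v x)"
      using additive_on_diff[OF f supported_0 supported_scale[OF v]] by metis
    then show ?thesis unfolding nat additive_on_zero[OF f] using False by (simp add: fun_eq_iff)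
  qed
qed

lemma additive_on_lincomb:
  assumes f: "additive_on A f" and b: "\<And>i. i \<in> I \<Longrightarrow> b i \<in> supported A"
  shows "f (\<Sum>i\<in>I. (\<lambda>x. c i * b i x)) = (\<Sum>i\<in>I. (\<lambda>x. c i * f (b i) x))"
  using b
proof (induction I rule: infinite_finite_induct)
  case (insert j I)
  have "f ((\<lambda>x. c j * b j x) + (\<Sum>i\<in>I. (\<lambda>x. c i * b i x)))
      = f (\<lambda>x. c j * b j x) + f (\<Sum>i\<in>I. (\<lambda>x. c i * b i x))"
    using insert.prems by (intro additive_onD[OF f] supported_scale supported_sum) auto
  also have "f (\<lambda>x. c j * b j x) = (\<lambda>x. c j * f (b j) x)"
    using insert.prems by (intro additive_on_scale[OF f]) auto
  finally show ?case
    unfolding sum.insert[OF insert.hyps] using insert.IH insert.prems by simp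
qed (simp_all only: sum.infinite sum.empty additive_on_zero[OF f] not_False_eq_True)

lemma additive_on_lincomb_apply:
  assumes "additive_on A f" and "\<And>i. i \<in> I \<Longrightarrow> b i \<in> supported A"
  shows "f (\<Sum>i\<in>I. (\<lambda>x. c i * b i x)) y = (\<Sum>i\<in>I. c i * f (b i) y)"
  using additive_on_lincomb[OF assms, where c = c] by (simp add: sum_fun_apply)

lemma vecs_eq: "vecs n = supported {..<n}"
  by (auto simp: vecs_def supported_def)

lemma supported_expand:
  assumes "finite A" "v \<in> supported A"
  shows "v = (\<Sum>i\<in>A. (\<lambda>x. v i * indicator {i} x))"
proof
  fix x
  show "v x = (\<Sum>i\<in>A. (\<lambda>x. v i * indicator {i} x)) x"
    using assms by (simp add: sum_fun_apply indicator_def of_bool_def supported_def if_distrib cong: if_cong)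
qed

lemma additive_on_expand:
  assumes "finite A" "additive_on A f" "v \<in> supported A"
  shows "f v y = (\<Sum>i\<in>A. v i * f (indicator {i}) y)"
  using additive_on_lincomb_apply[OF assms(2), of A "\<lambda>i. indicator {i}", where c = v and y = y] supported_expand[OF assms(1,3)]
  by (simp add: supported_indicator)

lemma additive_on_comp:
  assumes "additive_on A f" "additive_on B g" "\<And>v. v \<in> supported A \<Longrightarrow> f v \<in> supported B"
  shows "additive_on A (\<lambda>v. g (f v))"
  using assms by (simp add: additive_on_def)

lemma gmapD:
  assumes "gmap G (n, a) (m, b) f"
  shows "\<And>v. v \<in> supported {..<n} \<Longrightarrow> f v \<in> supported {..<m}"
    and "additive_on {..<n} f"
    and "\<And>g v. g \<in> carrier G \<Longrightarrow> v \<in> supported {..<n} \<Longrightarrow> f (a g v) = b g (f v)"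
  using assms by (auto simp: gmap_def additive_on_def vecs_eq plus_fun_def)

lemma glatticeD:
  assumes "glattice G (n, a)"
  shows "\<And>g v. g \<in> carrier G \<Longrightarrow> v \<in> supported {..<n} \<Longrightarrow> a g v \<in> supported {..<n}"
    and "\<And>g. g \<in> carrier G \<Longrightarrow> additive_on {..<n} (a g)"
    and "\<And>v. v \<in> supported {..<n} \<Longrightarrow> a \<one>\<^bsub>G\<^esub> v = v"
    and "\<And>g h v. g \<in> carrier G \<Longrightarrow> h \<in> carrier G \<Longrightarrow> v \<in> supported {..<n} \<Longrightarrow>
      a (g \<otimes>\<^bsub>G\<^esub> h) v = a g (a h v)"
  using assms by (auto simp: glattice_def additive_on_def vecs_eq plus_fun_def)

text \<open>\<open>\<beta>\<close> is the permuted basis, \<open>co\<close> takes coordinates in it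
  and \<open>\<pi>\<close> permutes its indices. Indices from \<open>n\<close> on stay fixed, so
  that \<open>\<pi>\<close> acts on the whole type as \<open>finite_gset\<close> demands.\<close>

lemma (in group) permutation_lattice_coordinates:
  assumes lat: "glattice G (n, a)" and perm: "permutation_lattice G (n, a)"
  obtains \<beta> :: "nat \<Rightarrow> nat \<Rightarrow> int" and co and \<pi> where
    "finite_gset G {..<n} \<pi>" "\<And>g i. i \<ge> n \<Longrightarrow> \<pi> g i = i"
    "\<And>i. i < n \<Longrightarrow> \<beta> i \<in> supported {..<n}"
    "\<And>g i. g \<in> carrier G \<Longrightarrow> i < n \<Longrightarrow> a g (\<beta> i) = \<beta> (\<pi> g i)"
    "\<And>v. v \<in> supported {..<n} \<Longrightarrow> co v \<in> supported {..<n}"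
    "additive_on {..<n} co"
    "\<And>i. i < n \<Longrightarrow> co (\<beta> i) = indicator {i}"
    "\<And>v. v \<in> supported {..<n} \<Longrightarrow> v = (\<Sum>i<n. (\<lambda>x. co v i * \<beta> i x))"
    "\<And>g v i. g \<in> carrier G \<Longrightarrow> v \<in> supported {..<n} \<Longrightarrow> co (a g v) (\<pi> g i) = co v i"
proof -
  note L = glatticeD[OF lat]
  from perm obtain \<beta> :: "nat \<Rightarrow> nat \<Rightarrow> int" where B: "(\<forall>i<n. \<beta> i \<in> supported {..<n}) \<and>
      (\<forall>v\<in>supported {..<n}. \<exists>!c. (\<forall>i\<ge>n. c i = 0) \<and> v = (\<lambda>k. \<Sum>i<n. c i * \<beta> i k)) \<and>
      (\<forall>g\<in>carrier G. \<forall>i<n. \<exists>j<n. a g (\<beta> i) = \<beta> j)"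
    unfolding permutation_lattice_def vecs_eq prod.case by (elim exE)
  have b: "\<And>i. i < n \<Longrightarrow> \<beta> i \<in> supported {..<n}" and
    u: "\<And>v. v \<in> supported {..<n} \<Longrightarrow> \<exists>!c. (\<forall>i\<ge>n. c i = 0) \<and> v = (\<lambda>k. \<Sum>i<n. c i * \<beta> i k)" and
    pm: "\<And>g i. g \<in> carrier G \<Longrightarrow> i < n \<Longrightarrow> \<exists>j<n. a g (\<beta> i) = \<beta> j"
    by (rule B[THEN conjunct1, rule_format], assumption,
        rule B[THEN conjunct2, THEN conjunct1, rule_format], assumption,
        rule B[THEN conjunct2, THEN conjunct2, rule_format])
  define lin where "lin c = (\<Sum>i<n. (\<lambda>x. c i * \<beta> i x))" for c :: "nat \<Rightarrow> int"
  have lin_alt: "lin c = (\<lambda>k. \<Sum>i<n. c i * \<beta> i k)" for c by (simp add: lin_def fun_eq_iff sum_fun_apply)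
  define co where "co v = (THE c. (\<forall>i\<ge>n. c i = 0) \<and> v = (\<lambda>k. \<Sum>i<n. c i * \<beta> i k))" for v
  have co: "co v \<in> supported {..<n}" "v = lin (co v)" if "v \<in> supported {..<n}" for v
    using theI'[OF u[OF that]] unfolding co_def lin_alt supported_def by auto
  have co_eq: "co (lin c) = c" if c: "c \<in> supported {..<n}" for c
  proof -
    have s: "lin c \<in> supported {..<n}" unfolding lin_def by (intro supported_sum supported_scale b) simp
    show ?thesis unfolding co_def
      by (rule the1_equality[OF u[OF s]]) (use c in \<open>auto simp: lin_alt supported_def\<close>)
  qed
  have lin_add: "lin (c + d) = lin c + lin d" for c d
    by (simp add: lin_alt fun_eq_iff sum.distrib distrib_right)
  have co_add: "additive_on {..<n} co"
    unfolding additive_on_def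
  proof (intro ballI)
    fix v w :: "nat \<Rightarrow> int" assume vw: "v \<in> supported {..<n}" "w \<in> supported {..<n}"
    have "v + w = lin (co v + co w)" using co(2)[OF vw(1)] co(2)[OF vw(2)] lin_add by metis
    then show "co (v + w) = co v + co w" using co_eq supported_add co(1) vw by metis
  qed
  have lin_ind: "lin (indicator {i}) = \<beta> i" if "i < n" for i
    using that by (simp add: lin_alt fun_eq_iff indicator_def of_bool_def if_distrib[of "\<lambda>x. x * _"] cong: if_cong)
  have co_b: "co (\<beta> i) = indicator {i}" if "i < n" for i
    using co_eq[of "indicator {i}"] lin_ind[OF that] supported_indicator[of "{i}" "{..<n}"] that by simp
  have b_inj: "i = j" if ij: "i < n" "j < n" "\<beta> i = \<beta> j" for i j
  proof -
    have "(indicator {i} :: nat \<Rightarrow> int) i = indicator {j} i" using co_b ij by metis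
    then show ?thesis by (simp add: indicator_def split: if_splits)
  qed
  define \<pi> where "\<pi> g i = (if i < n then THE j. j < n \<and> a g (\<beta> i) = \<beta> j else i)" for g i
  have pi: "\<pi> g i < n" "a g (\<beta> i) = \<beta> (\<pi> g i)" if g: "g \<in> carrier G" and i: "i < n" for g i
  proof -
    obtain j where j: "j < n" "a g (\<beta> i) = \<beta> j" using pm[OF g i] by blast
    have "(THE j. j < n \<and> a g (\<beta> i) = \<beta> j) = j"
      by (rule the_equality) (use j b_inj in auto)
    then show "\<pi> g i < n" "a g (\<beta> i) = \<beta> (\<pi> g i)" using j i by (simp_all add: \<pi>_def)
  qed
  have pi_out: "\<pi> g i = i" if "i \<ge> n" for g i using that by (simp add: \<pi>_def)
  have gset: "finite_gset G {..<n} \<pi>"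
  proof (intro finite_gset.intro finite_gset_axioms.intro is_group)
    show "\<pi> \<one> i = i" for i
    proof (cases "i < n")
      case True
      then have "\<beta> (\<pi> \<one> i) = \<beta> i" using pi(2)[of \<one> i] L(3)[OF b] by simp
      then show ?thesis using b_inj pi(1) True by simp
    qed (simp add: pi_out)
    show "\<pi> (g \<otimes> h) i = \<pi> g (\<pi> h i)" if gh: "g \<in> carrier G" "h \<in> carrier G" for g h i
    proof (cases "i < n")
      case True
      have hi: "\<pi> h i < n" by (rule pi(1)[OF gh(2) True])
      have "\<beta> (\<pi> (g \<otimes> h) i) = a (g \<otimes> h) (\<beta> i)" using pi(2)[of "g \<otimes> h" i] gh True by simp
      also have "\<dots> = a g (a h (\<beta> i))" by (rule L(4)[OF gh b[OF True]])
      also have "\<dots> = \<beta> (\<pi> g (\<pi> h i))" using pi(2)[OF gh(2) True] pi(2)[OF gh(1) hi] by simp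
      finally show ?thesis using b_inj pi(1) gh True hi by simp
    qed (simp add: pi_out)
  qed (use pi in auto)
  have equi: "co (a g v) (\<pi> g i) = co v i" if g: "g \<in> carrier G" and v: "v \<in> supported {..<n}" for g v i
  proof -
    interpret P: finite_gset G "{..<n}" \<pi> by (rule gset)
    have "a g v = a g (lin (co v))" using co(2)[OF v] by simp
    also have "\<dots> = (\<Sum>j<n. (\<lambda>x. co v j * a g (\<beta> j) x))"
      unfolding lin_def by (rule additive_on_lincomb[OF L(2)[OF g]]) (use b in simp)
    also have "\<dots> = (\<Sum>j<n. (\<lambda>x. co v j * \<beta> (\<pi> g j) x))" using pi(2)[OF g] by simp
    finally have "co (a g v) (\<pi> g i) = (\<Sum>j<n. co v j * co (\<beta> (\<pi> g j)) (\<pi> g i))"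
      using additive_on_lincomb_apply[OF co_add, of "{..<n}" "\<lambda>j. \<beta> (\<pi> g j)", where c = "co v" and y = "\<pi> g i"] b pi(1)[OF g] by simp
    also have "\<dots> = (\<Sum>j<n. co v j * (if j = i then 1 else 0))"
    proof (rule sum.cong[OF refl])
      fix j assume "j \<in> {..<n}"
      then have "co (\<beta> (\<pi> g j)) (\<pi> g i) = (if j = i then 1 else 0)"
        using co_b[of "\<pi> g j"] pi(1)[OF g] P.act_eq_iff[OF g, of i j] by (auto simp: indicator_def)
      then show "co v j * co (\<beta> (\<pi> g j)) (\<pi> g i) = co v j * (if j = i then 1 else 0)" by simp
    qed
    also have "\<dots> = co v i"
      using co(1)[OF v] by (cases "i < n") (simp_all add: supported_def if_distrib cong: if_cong)
    finally show ?thesis .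
  qed
  have "v = (\<Sum>i<n. (\<lambda>x. co v i * \<beta> i x))" if "v \<in> supported {..<n}" for v
    using co(2)[OF that] by (simp only: lin_def[symmetric])
  then show thesis
    using that[of \<pi> \<beta> co] gset pi_out b pi(2) co(1) co_add co_b equi by blast
qed

text \<open>On the first block \<open>D\<close> is the transposed inverse, so
  \<open>D (inv g)\<close> brings back the matrix of \<open>g\<close>, read by rows.\<close>

lemma (in group) dsum_dual_act:
  assumes "glattice G (n, a)" "glattice G (m, c)"
  defines "D \<equiv> snd (dsum (dual_lattice G (n, a)) (m, c))"
  shows "i < n \<Longrightarrow> D g v i = (\<Sum>j<n. v j * a (inv g) (indicator {i}) j)"
    and "g \<in> carrier G \<Longrightarrow> i < n \<Longrightarrow>
      D (inv g) (indicator {i}) = (\<Sum>k<n. (\<lambda>x. a g (indicator {k}) i * indicator {k} x))"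
proof -
  have ind: "(\<lambda>k. if k = i then 1 else 0) = (indicator {i} :: nat \<Rightarrow> int)" for i
    by (auto simp: indicator_def)
  show 1: "D g v i = (\<Sum>j<n. v j * a (inv g) (indicator {i}) j)" if "i < n" for g v i
    using that by (simp add: D_def dsum_def dual_lattice_def ind)
  show "D (inv g) (indicator {i}) = (\<Sum>k<n. (\<lambda>x. a g (indicator {k}) i * indicator {k} x))"
    if g: "g \<in> carrier G" and i: "i < n"
  proof
    fix x
    have rhs: "(\<Sum>k<n. (\<lambda>x. a g (indicator {k}) i * indicator {k} x)) x = (if x < n then a g (indicator {x}) i else 0)"
      by (simp add: sum_fun_apply indicator_def of_bool_def if_distrib[of "\<lambda>z. _ * z"] cong: if_cong)
    show "D (inv g) (indicator {i}) x = (\<Sum>k<n. (\<lambda>x. a g (indicator {k}) i * indicator {k} x)) x"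
    proof (cases "x < n")
      case True
      then have "D (inv g) (indicator {i}) x = (\<Sum>j<n. indicator {i} j * a g (indicator {x}) j)"
        using 1[of x "inv g" "indicator {i}"] g by simp
      also have "\<dots> = a g (indicator {x}) i"
        using i by (simp add: indicator_def of_bool_def if_distrib[of "\<lambda>z. z * _"] cong: if_cong)
      finally show ?thesis using rhs True by simp
    next
      case False
      have "(\<lambda>k. indicator {i} (k + n)) = (0 :: nat \<Rightarrow> int)" using i by (auto simp: indicator_def)
      moreover have "c (inv g) 0 = 0" using additive_on_zero[OF glatticeD(2)[OF assms(2)]] g by simp
      ultimately show ?thesis unfolding rhs using False
        by (simp add: D_def dsum_def dual_lattice_def)
    qed
  qed
qed

text \<open>Dualizing \<open>0 \<rightarrow> J \<oplus> M' \<rightarrow> R \<rightarrow> F \<rightarrow> 0\<close> gives \<open>0 \<rightarrow> \<int>[Y] \<rightarrow> \<int>[T] \<rightarrow> I \<oplus> M'\<degree> \<rightarrow> 0\<close>.  The relation \<open>Rel w v\<close>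
  says that \<open>v\<close> lifts \<open>(w, 0)\<close>, and \<open>mq\<close> is the matrix of the map to \<open>I\<close>.\<close>

lemma (in group) quasi_invertible_resolution:
  fixes aX :: "'a \<Rightarrow> 'x \<Rightarrow> 'x" and fI :: "(nat \<Rightarrow> int) \<Rightarrow> 'x \<Rightarrow> int"
  assumes finG: "finite (carrier G)" and gX: "finite_gset G \<Omega> aX"
    and lat: "glattice G (n, a)"
    and fI_add: "additive_on {..<n} fI"
    and fI_supp: "\<And>v. v \<in> supported {..<n} \<Longrightarrow> fI v \<in> supported \<Omega>"
    and fI_sum: "\<And>v. v \<in> supported {..<n} \<Longrightarrow> (\<Sum>\<xi>\<in>\<Omega>. fI v \<xi>) = 0"
    and fI_inj: "inj_on fI (supported {..<n})"
    and fI_surj: "\<And>w. w \<in> supported \<Omega> \<Longrightarrow> (\<Sum>\<xi>\<in>\<Omega>. w \<xi>) = 0 \<Longrightarrow> \<exists>v\<in>supported {..<n}. fI v = w"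
    and fI_sh: "\<And>g v. g \<in> carrier G \<Longrightarrow> v \<in> supported {..<n} \<Longrightarrow> fI (a g v) = shift G aX g (fI v)"
    and qi: "quasi_invertible G (dual_lattice G (n, a))"
  shows "\<exists>nR \<pi>R nF \<pi>F Rel ma mq.
    permutation_resolution G \<Omega> aX {..<nR::nat} \<pi>R {..<nF::nat} \<pi>F Rel ma mq"
proof -
  note L = glatticeD[OF lat]
  obtain M' N where M'N: "glattice G M'" "quasi_permutation G N" "glat_iso G N (dsum (dual_lattice G (n, a)) M')"
    using qi unfolding quasi_invertible_def by blast
  obtain m c where M': "M' = (m, c)" by (cases M')
  obtain nN aN where N: "N = (nN, aN)" by (cases N)
  obtain R F where RF: "glattice G R" "glattice G F" "permutation_lattice G R" "permutation_lattice G F" "short_exact G N R F"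
    using M'N(2) unfolding quasi_permutation_def by blast
  obtain nR aR where R: "R = (nR, aR)" by (cases R)
  obtain nF aF where F: "F = (nF, aF)" by (cases F)
  define D where "D = snd (dsum (dual_lattice G (n, a)) (m, c))"
  have Dd: "dsum (dual_lattice G (n, a)) (m, c) = (n + m, D)" by (simp add: D_def dsum_def dual_lattice_def)
  note DA = dsum_dual_act[OF lat M'N(1)[unfolded M'], folded D_def]
  obtain \<theta> where \<theta>: "gmap G (nN, aN) (n + m, D) \<theta>" "bij_betw \<theta> (supported {..<nN}) (supported {..<n + m})"
    using M'N(3) unfolding glat_iso_def M' N Dd vecs_eq by auto
  note TH = gmapD[OF \<theta>(1)]
  obtain f h where f: "gmap G (nN, aN) (nR, aR) f" and h: "gmap G (nR, aR) (nF, aF) h"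
    and f_inj: "inj_on f (supported {..<nN})" and h_surj: "h ` supported {..<nR} = supported {..<nF}"
    and exact: "{x \<in> supported {..<nR}. h x = (\<lambda>_. 0)} = f ` supported {..<nN}"
    using RF(5) unfolding short_exact_def N R F vecs_eq by auto
  note FD = gmapD[OF f] and HD = gmapD[OF h]
  have lN: "glattice G (nN, aN)" using M'N(2) by (simp add: quasi_permutation_def N)
  note LN = glatticeD[OF lN] and LR = glatticeD[OF RF(1)[unfolded R]]
  obtain \<beta>R coR \<pi>R where gR: "finite_gset G {..<nR} \<pi>R" and \<pi>R_out: "\<And>g i. i \<ge> nR \<Longrightarrow> \<pi>R g i = i"
    and \<beta>R: "\<And>i. i < nR \<Longrightarrow> \<beta>R i \<in> supported {..<nR}"
    and \<pi>R: "\<And>g i. g \<in> carrier G \<Longrightarrow> i < nR \<Longrightarrow> aR g (\<beta>R i) = \<beta>R (\<pi>R g i)"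
    and coR: "\<And>v. v \<in> supported {..<nR} \<Longrightarrow> coR v \<in> supported {..<nR}"
    and coR_add: "additive_on {..<nR} coR"
    and coR_b: "\<And>i. i < nR \<Longrightarrow> coR (\<beta>R i) = indicator {i}"
    and R_exp: "\<And>v. v \<in> supported {..<nR} \<Longrightarrow> v = (\<Sum>i<nR. (\<lambda>x. coR v i * \<beta>R i x))"
    and coR_eq: "\<And>g v i. g \<in> carrier G \<Longrightarrow> v \<in> supported {..<nR} \<Longrightarrow> coR (aR g v) (\<pi>R g i) = coR v i"
    by (rule permutation_lattice_coordinates[OF RF(1,3)[unfolded R]]) blast
  obtain \<beta>F coF \<pi>F where gF: "finite_gset G {..<nF} \<pi>F"
    and \<beta>F: "\<And>i. i < nF \<Longrightarrow> \<beta>F i \<in> supported {..<nF}"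
    and coF: "\<And>v. v \<in> supported {..<nF} \<Longrightarrow> coF v \<in> supported {..<nF}"
    and coF_add: "additive_on {..<nF} coF"
    and coF_b: "\<And>i. i < nF \<Longrightarrow> coF (\<beta>F i) = indicator {i}"
    and F_exp: "\<And>v. v \<in> supported {..<nF} \<Longrightarrow> v = (\<Sum>i<nF. (\<lambda>x. coF v i * \<beta>F i x))"
    and coF_eq: "\<And>g v i. g \<in> carrier G \<Longrightarrow> v \<in> supported {..<nF} \<Longrightarrow> coF (aF g v) (\<pi>F g i) = coF v i"
    by (rule permutation_lattice_coordinates[OF RF(2,4)[unfolded F]]) blast
  interpret X: finite_gset G \<Omega> aX by (rule gX)
  interpret T: finite_gset G "{..<nR}" \<pi>R by (rule gR)
  interpret Y: finite_gset G "{..<nF}" \<pi>F by (rule gF)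
  have hf: "h (f z) = 0" if "z \<in> supported {..<nN}" for z
    using exact that by (auto simp: zero_fun_def)
  have ker: "\<exists>z\<in>supported {..<nN}. f z = r" if "r \<in> supported {..<nR}" "h r = 0" for r
  proof -
    have "r \<in> f ` supported {..<nN}" unfolding exact[symmetric] using that by (simp add: zero_fun_def)
    then show ?thesis by (auto simp: image_iff)
  qed
  have "\<exists>z\<in>supported {..<nN}. \<theta> z = indicator {i}" if "i < n" for i
  proof -
    have "indicator {i} \<in> \<theta> ` supported {..<nN}"
      unfolding bij_betw_imp_surj_on[OF \<theta>(2)] using that by (intro supported_indicator) simp
    then show ?thesis by (auto simp: image_iff)
  qed
  \<comment> \<open>These elements correspond under \<open>\<theta>\<close> to the basis of the
    summand J.\<close>
  then obtain z where z: "\<And>i. i < n \<Longrightarrow> z i \<in> supported {..<nN}" "\<And>i. i < n \<Longrightarrow> \<theta> (z i) = indicator {i}" by metis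
  have "\<exists>r\<in>supported {..<nR}. h r = \<beta>F y" if "y < nF" for y
  proof -
    have "\<beta>F y \<in> h ` supported {..<nR}" using \<beta>F[OF that] h_surj by simp
    then show ?thesis by (auto simp: image_iff)
  qed
  \<comment> \<open>Preimages of the basis of F define an additive section of \<open>h\<close>, in
    general not an equivariant one.\<close>
  then obtain r where r: "\<And>y. y < nF \<Longrightarrow> r y \<in> supported {..<nR}" "\<And>y. y < nF \<Longrightarrow> h (r y) = \<beta>F y" by metis
  have coF_h: "additive_on {..<nR} (\<lambda>v. coF (h v))" by (rule additive_on_comp[OF HD(2) coF_add HD(1)])
  have coR_f: "additive_on {..<nN} (\<lambda>v. coR (f v))" by (rule additive_on_comp[OF FD(2) coR_add FD(1)])
  have coF_h_exp: "coF (h v) y = (\<Sum>\<tau><nR. coR v \<tau> * coF (h (\<beta>R \<tau>)) y)" if v: "v \<in> supported {..<nR}" for v y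
    using additive_on_lincomb_apply[OF coF_h, of "{..<nR}" \<beta>R, where c = "coR v" and y = y] \<beta>R R_exp[OF v] by simp
  \<comment> \<open>The transpose of \<open>h\<close> in the permuted bases: row
    \<open>\<tau>\<close> lists the coordinates of the image of
    \<open>\<beta>R \<tau>\<close>.\<close>
  define ma where "ma \<tau> y = (if \<tau> < nR then coF (h (\<beta>R \<tau>)) y else 0)" for \<tau> y
  \<comment> \<open>The coordinate functional of index \<open>\<tau>\<close> on R, pulled back along
    \<open>f\<close> and restricted to J, is an element of the dual of J, that is, of I in its
    coordinates.\<close>
  define mu where "mu \<tau> i = (if i < n then coR (f (z i)) \<tau> else 0)" for \<tau> i
  define mq where "mq \<xi> \<tau> = fI (mu \<tau>) \<xi>" for \<xi> \<tau>
  \<comment> \<open>Here \<open>v\<close> is a functional on R whose pullback along \<open>f\<close>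
    is given by \<open>\<mu>\<close> on J and is zero on \<open>M'\<close>; this is why the
    right-hand sum stops at \<open>n\<close>.\<close>
  define Rel where "Rel w v \<longleftrightarrow> v \<in> supported {..<nR} \<and> (\<exists>\<mu>\<in>supported {..<n}. w = fI \<mu> \<and>
    (\<forall>x\<in>supported {..<nN}. (\<Sum>\<tau><nR. v \<tau> * coR (f x) \<tau>) = (\<Sum>i<n. \<mu> i * \<theta> x i)))" for w v
  have mu_supp: "mu \<tau> \<in> supported {..<n}" for \<tau> by (simp add: mu_def supported_def)
  have pull: "coR v (\<pi>R g \<tau>) = coR (aR (inv g) v) \<tau>" if g: "g \<in> carrier G" and v: "v \<in> supported {..<nR}" for g v \<tau>
  proof -
    have "aR g (aR (inv g) v) = v" using LR(3)[OF v] LR(4)[of g "inv g" v] g v by simp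
    then show ?thesis using coR_eq[OF g LR(1)[of "inv g" v], of \<tau>] g v by simp
  qed
  have f_inv: "aR (inv g) (f x) = f (aN (inv g) x)" if "g \<in> carrier G" "x \<in> supported {..<nN}" for g x
    using FD(3)[of "inv g" x] that by simp
  \<comment> \<open>Since \<open>\<theta>\<close> is injective, the translate of \<open>z i\<close>
    is the combination of the \<open>z k\<close> with coefficients from the matrix of
    \<open>g\<close>.\<close>
  have mu_equiv: "mu (\<pi>R g \<tau>) = a g (mu \<tau>)" if g: "g \<in> carrier G" for g \<tau>
  proof
    fix i
    show "mu (\<pi>R g \<tau>) i = a g (mu \<tau>) i"
    proof (cases "i < n")
      case True
      let ?Z = "\<Sum>k<n. (\<lambda>x. a g (indicator {k}) i * z k x)"
      have Zs: "?Z \<in> supported {..<nN}" by (intro supported_sum supported_scale z) simp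
      have gz: "aN (inv g) (z i) \<in> supported {..<nN}" using LN(1)[of "inv g"] g z True by simp
      have "\<theta> (aN (inv g) (z i)) = D (inv g) (indicator {i})" using TH(3)[of "inv g" "z i"] g z True by simp
      also have "\<dots> = (\<Sum>k<n. (\<lambda>x. a g (indicator {k}) i * indicator {k} x))" by (rule DA(2)[OF g True])
      also have "\<dots> = (\<Sum>k<n. (\<lambda>x. a g (indicator {k}) i * \<theta> (z k) x))" using z(2) by simp
      also have "\<dots> = \<theta> ?Z" by (rule additive_on_lincomb[OF TH(2), symmetric]) (use z in simp)
      finally have "aN (inv g) (z i) = ?Z"
        by (rule inj_onD[OF bij_betw_imp_inj_on[OF \<theta>(2)] _ gz Zs])
      then have "mu (\<pi>R g \<tau>) i = coR (f ?Z) \<tau>"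
        using True pull[OF g FD(1)[OF z(1)]] f_inv[OF g z(1)] by (simp add: mu_def)
      also have "\<dots> = (\<Sum>k<n. a g (indicator {k}) i * coR (f (z k)) \<tau>)"
        by (rule additive_on_lincomb_apply[OF coR_f]) (use z in simp)
      also have "\<dots> = (\<Sum>k<n. mu \<tau> k * a g (indicator {k}) i)" by (simp add: mu_def mult.commute)
      also have "\<dots> = a g (mu \<tau>) i"
        using additive_on_expand[OF _ L(2)[OF g] mu_supp[of \<tau>], of i] by simp
      finally show ?thesis .
    next
      case False
      then show ?thesis using L(1)[OF g mu_supp, of \<tau>] by (simp add: mu_def supported_def)
    qed
  qed
  have "permutation_resolution G \<Omega> aX {..<nR} \<pi>R {..<nF} \<pi>F Rel ma mq"
  proof (intro permutation_resolution.intro permutation_resolution_axioms.intro gX gR gF finG)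
    show "ma (\<pi>R g \<tau>) (\<pi>F g y) = ma \<tau> y" if g: "g \<in> carrier G" for g \<tau> y
    proof (cases "\<tau> < nR")
      case True
      then have "\<pi>R g \<tau> < nR" using T.act_in[OF g] by simp
      then have "ma (\<pi>R g \<tau>) (\<pi>F g y) = coF (h (aR g (\<beta>R \<tau>))) (\<pi>F g y)" using \<pi>R[OF g True] by (simp add: ma_def)
      also have "\<dots> = coF (h (\<beta>R \<tau>)) y"
        using HD(3)[OF g \<beta>R[OF True]] coF_eq[OF g HD(1)[OF \<beta>R[OF True]]] by simp
      finally show ?thesis using True by (simp add: ma_def)
    next
      case False
      then show ?thesis using \<pi>R_out[of \<tau> g] by (simp add: ma_def)
    qed
    \<comment> \<open>A functional on F that vanishes after composition with the surjection
      \<open>h\<close> is zero; \<open>r\<close> provides the preimages.\<close>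
    show "u = 0" if u: "u \<in> supported {..<nF}" and 0: "\<And>\<tau>. (\<Sum>y\<in>{..<nF}. ma \<tau> y * u y) = 0" for u
    proof
      fix y
      show "u y = 0 y"
      proof (cases "y < nF")
        case True
        have "u y = (\<Sum>y'<nF. coF (h (r y)) y' * u y')"
          using True by (simp add: r(2) coF_b indicator_def of_bool_def if_distrib[of "\<lambda>x. x * _"] cong: if_cong)
        also have "\<dots> = (\<Sum>y'<nF. \<Sum>\<tau><nR. coR (r y) \<tau> * (ma \<tau> y' * u y'))"
          unfolding coF_h_exp[OF r(1)[OF True]] sum_distrib_right
          by (intro sum.cong refl) (simp add: ma_def)
        also have "\<dots> = (\<Sum>\<tau><nR. coR (r y) \<tau> * (\<Sum>y'<nF. ma \<tau> y' * u y'))"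
          by (subst sum.swap) (simp add: sum_distrib_left)
        also have "\<dots> = 0" using 0 by simp
        finally show ?thesis by simp
      qed (use u in \<open>simp add: supported_def\<close>)
    qed
    show "mq (aX g \<xi>) (\<pi>R g \<tau>) = mq \<xi> \<tau>" if g: "g \<in> carrier G" for g \<xi> \<tau>
      unfolding mq_def mu_equiv[OF g] fI_sh[OF g mu_supp] by (rule X.sh_apply_act[OF g])
    show "(\<Sum>\<xi>\<in>\<Omega>. mq \<xi> \<tau>) = 0" for \<tau> unfolding mq_def by (rule fI_sum[OF mu_supp])
    show "\<exists>v. Rel w v" if w: "w \<in> supported \<Omega>" "(\<Sum>\<xi>\<in>\<Omega>. w \<xi>) = 0" for w
    proof -
      obtain \<mu> where \<mu>: "\<mu> \<in> supported {..<n}" "fI \<mu> = w" using fI_surj[OF w] by blast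
      \<comment> \<open>An additive projection of R onto the kernel of \<open>h\<close>, which is
        the image of \<open>f\<close>. Along it the functional given by \<open>\<mu>\<close> extends
        from that image to all of R.\<close>
      define \<rho> where "\<rho> v = v - (\<Sum>y<nF. (\<lambda>x. coF (h v) y * r y x))" for v
      have \<rho>_supp: "\<rho> v \<in> supported {..<nR}" if "v \<in> supported {..<nR}" for v
        unfolding \<rho>_def by (intro supported_diff supported_sum supported_scale that r) simp
      have h\<rho>: "h (\<rho> v) = 0" if v: "v \<in> supported {..<nR}" for v
      proof -
        have "h (\<rho> v) = h v - h (\<Sum>y<nF. (\<lambda>x. coF (h v) y * r y x))"
          unfolding \<rho>_def by (intro additive_on_diff[OF HD(2) v] supported_sum supported_scale r) simp
        also have "h (\<Sum>y<nF. (\<lambda>x. coF (h v) y * r y x)) = (\<Sum>y<nF. (\<lambda>x. coF (h v) y * h (r y) x))"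
          by (rule additive_on_lincomb[OF HD(2)]) (use r in simp)
        also have "\<dots> = (\<Sum>y<nF. (\<lambda>x. coF (h v) y * \<beta>F y x))" using r(2) by simp
        also have "\<dots> = h v" by (rule F_exp[OF HD(1)[OF v], symmetric])
        finally show ?thesis by (simp only: diff_self)
      qed
      have "\<exists>x\<in>supported {..<nN}. f x = \<rho> (\<beta>R \<tau>)" if "\<tau> < nR" for \<tau>
        using ker[OF \<rho>_supp h\<rho>] \<beta>R[OF that] by blast
      then obtain \<zeta> where \<zeta>: "\<And>\<tau>. \<tau> < nR \<Longrightarrow> \<zeta> \<tau> \<in> supported {..<nN}" "\<And>\<tau>. \<tau> < nR \<Longrightarrow> f (\<zeta> \<tau>) = \<rho> (\<beta>R \<tau>)" by metis
      define v where "v \<tau> = (if \<tau> < nR then \<Sum>i<n. \<mu> i * \<theta> (\<zeta> \<tau>) i else 0)" for \<tau>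
      have "(\<Sum>\<tau><nR. v \<tau> * coR (f x) \<tau>) = (\<Sum>i<n. \<mu> i * \<theta> x i)" if x: "x \<in> supported {..<nN}" for x
      proof -
        let ?c = "coR (f x)" and ?Z = "\<Sum>\<tau><nR. (\<lambda>j. coR (f x) \<tau> * \<zeta> \<tau> j)"
        have Zs: "?Z \<in> supported {..<nN}" by (intro supported_sum supported_scale \<zeta>) simp
        have \<rho>_add: "additive_on {..<nR} \<rho>"
          unfolding additive_on_def
        proof (intro ballI)
          fix v w :: "nat \<Rightarrow> int" assume vw: "v \<in> supported {..<nR}" "w \<in> supported {..<nR}"
          have "coF (h (v + w)) = coF (h v) + coF (h w)" by (rule additive_onD[OF coF_h vw])
          then show "\<rho> (v + w) = \<rho> v + \<rho> w"
            unfolding \<rho>_def by (simp add: fun_eq_iff sum_fun_apply distrib_right sum.distrib)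
        qed
        have "f ?Z = (\<Sum>\<tau><nR. (\<lambda>j. ?c \<tau> * f (\<zeta> \<tau>) j))" by (rule additive_on_lincomb[OF FD(2)]) (use \<zeta> in simp)
        also have "\<dots> = (\<Sum>\<tau><nR. (\<lambda>j. ?c \<tau> * \<rho> (\<beta>R \<tau>) j))" using \<zeta>(2) by simp
        also have "\<dots> = \<rho> (\<Sum>\<tau><nR. (\<lambda>j. ?c \<tau> * \<beta>R \<tau> j))"
          by (rule additive_on_lincomb[OF \<rho>_add, symmetric]) (use \<beta>R in simp)
        also have "(\<Sum>\<tau><nR. (\<lambda>j. ?c \<tau> * \<beta>R \<tau> j)) = f x" by (rule R_exp[OF FD(1)[OF x], symmetric])
        also have "\<rho> (f x) = f x"
          unfolding \<rho>_def hf[OF x] additive_on_zero[OF coF_add] by (simp add: fun_eq_iff sum_fun_apply)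
        finally have "?Z = x" by (rule inj_onD[OF f_inj _ Zs x])
        then have "\<theta> x i = (\<Sum>\<tau><nR. ?c \<tau> * \<theta> (\<zeta> \<tau>) i)" for i
          using additive_on_lincomb_apply[OF TH(2), of "{..<nR}" \<zeta>, where c = ?c and y = i] \<zeta>(1) by simp
        then have "(\<Sum>i<n. \<mu> i * \<theta> x i) = (\<Sum>i<n. \<Sum>\<tau><nR. \<mu> i * (?c \<tau> * \<theta> (\<zeta> \<tau>) i))"
          by (simp add: sum_distrib_left)
        also have "\<dots> = (\<Sum>\<tau><nR. \<Sum>i<n. \<mu> i * (?c \<tau> * \<theta> (\<zeta> \<tau>) i))" by (rule sum.swap)
        also have "\<dots> = (\<Sum>\<tau><nR. v \<tau> * ?c \<tau>)" by (simp add: v_def sum_distrib_left sum_distrib_right mult_ac)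
        finally show ?thesis by simp
      qed
      then have "Rel w v" unfolding Rel_def using \<mu> by (auto simp: v_def supported_def)
      then show ?thesis by blast
    qed
    show "Rel (w - w') (v - v')" if wv: "Rel w v" "Rel w' v'" for w v w' v'
    proof -
      obtain \<mu> \<mu>' where \<mu>: "\<mu> \<in> supported {..<n}" "w = fI \<mu>" "\<mu>' \<in> supported {..<n}" "w' = fI \<mu>'"
        "\<And>x. x \<in> supported {..<nN} \<Longrightarrow> (\<Sum>\<tau><nR. v \<tau> * coR (f x) \<tau>) = (\<Sum>i<n. \<mu> i * \<theta> x i)"
        "\<And>x. x \<in> supported {..<nN} \<Longrightarrow> (\<Sum>\<tau><nR. v' \<tau> * coR (f x) \<tau>) = (\<Sum>i<n. \<mu>' i * \<theta> x i)"
        using wv unfolding Rel_def by blast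
      have "w - w' = fI (\<mu> - \<mu>')" using additive_on_diff[OF fI_add \<mu>(1,3)] \<mu>(2,4) by simp
      moreover have "\<mu> - \<mu>' \<in> supported {..<n}" by (rule supported_diff[OF \<mu>(1,3)])
      moreover have "(\<Sum>\<tau><nR. (v - v') \<tau> * coR (f x) \<tau>) = (\<Sum>i<n. (\<mu> - \<mu>') i * \<theta> x i)"
        if "x \<in> supported {..<nN}" for x
        using \<mu>(5,6)[OF that] by (simp add: left_diff_distrib sum_subtractf)
      moreover have "v - v' \<in> supported {..<nR}" using wv by (intro supported_diff) (simp_all add: Rel_def)
      ultimately show ?thesis unfolding Rel_def by blast
    qed
    show "Rel (X.sh g w) (T.sh g v)" if g: "g \<in> carrier G" and wv: "Rel w v" for g w v
    proof -
      obtain \<mu> where \<mu>: "\<mu> \<in> supported {..<n}" "w = fI \<mu>"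
        "\<And>x. x \<in> supported {..<nN} \<Longrightarrow> (\<Sum>\<tau><nR. v \<tau> * coR (f x) \<tau>) = (\<Sum>i<n. \<mu> i * \<theta> x i)"
        using wv unfolding Rel_def by blast
      have "(\<Sum>\<tau><nR. T.sh g v \<tau> * coR (f x) \<tau>) = (\<Sum>i<n. a g \<mu> i * \<theta> x i)" if x: "x \<in> supported {..<nN}" for x
      proof -
        have gx: "aN (inv g) x \<in> supported {..<nN}" using LN(1)[of "inv g" x] g x by simp
        have "(\<Sum>\<tau><nR. T.sh g v \<tau> * coR (f x) \<tau>) = (\<Sum>\<tau><nR. v \<tau> * coR (f x) (\<pi>R g \<tau>))"
          by (rule T.sum_sh[OF g])
        also have "\<dots> = (\<Sum>\<tau><nR. v \<tau> * coR (f (aN (inv g) x)) \<tau>)"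
          by (simp only: pull[OF g FD(1)[OF x]] f_inv[OF g x])
        also have "\<dots> = (\<Sum>i<n. \<mu> i * \<theta> (aN (inv g) x) i)" by (rule \<mu>(3)[OF gx])
        also have "\<dots> = (\<Sum>i<n. \<mu> i * D (inv g) (\<theta> x) i)" using TH(3)[of "inv g" x] g x by simp
        also have "\<dots> = (\<Sum>i<n. \<Sum>j<n. \<mu> i * (\<theta> x j * a g (indicator {i}) j))"
          using DA(1)[of _ "inv g" "\<theta> x"] g by (simp add: sum_distrib_left)
        also have "\<dots> = (\<Sum>j<n. \<Sum>i<n. \<mu> i * (\<theta> x j * a g (indicator {i}) j))" by (rule sum.swap)
        also have "\<dots> = (\<Sum>j<n. a g \<mu> j * \<theta> x j)"
          using additive_on_expand[OF _ L(2)[OF g] \<mu>(1)] by (simp add: sum_distrib_left sum_distrib_right mult_ac)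
        finally show ?thesis .
      qed
      moreover have "X.sh g w = fI (a g \<mu>)" unfolding \<mu>(2) by (rule fI_sh[OF g \<mu>(1), symmetric])
      moreover have "T.sh g v \<in> supported {..<nR}" using wv by (intro T.sh_supported[OF g]) (simp add: Rel_def)
      ultimately show ?thesis unfolding Rel_def using L(1)[OF g \<mu>(1)] by blast
    qed
    show "\<exists>u\<in>supported {..<nF}. v = (\<lambda>\<tau>. \<Sum>y\<in>{..<nF}. ma \<tau> y * u y)" if R0: "Rel 0 v" for v
    proof -
      obtain \<mu> where \<mu>: "\<mu> \<in> supported {..<n}" "0 = fI \<mu>"
        "\<And>x. x \<in> supported {..<nN} \<Longrightarrow> (\<Sum>\<tau><nR. v \<tau> * coR (f x) \<tau>) = (\<Sum>i<n. \<mu> i * \<theta> x i)"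
        using R0 unfolding Rel_def by blast
      have "fI \<mu> = fI 0" using \<mu>(2) additive_on_zero[OF fI_add] by simp
      then have "\<mu> = 0" by (rule inj_onD[OF fI_inj _ \<mu>(1) supported_0])
      then have v0: "(\<Sum>\<tau><nR. v \<tau> * coR (f x) \<tau>) = 0" if "x \<in> supported {..<nN}" for x
        using \<mu>(3)[OF that] by simp
      have vs: "v \<in> supported {..<nR}" using R0 by (simp add: Rel_def)
      \<comment> \<open>A functional vanishing on the kernel of \<open>h\<close> factors through
        \<open>h\<close>, and its values on the basis of F are read off at the preimages
        \<open>r y\<close>.\<close>
      define u where "u y = (if y < nF then \<Sum>\<tau><nR. v \<tau> * coR (r y) \<tau> else 0)" for y
      have "v \<tau> = (\<Sum>y<nF. ma \<tau> y * u y)" for \<tau>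
      proof (cases "\<tau> < nR")
        case True
        let ?c = "coF (h (\<beta>R \<tau>))"
        let ?S = "\<Sum>y<nF. (\<lambda>x. ?c y * r y x)"
        have Ss: "?S \<in> supported {..<nR}" by (intro supported_sum supported_scale r) simp
        have "h (\<beta>R \<tau> - ?S) = h (\<beta>R \<tau>) - h ?S" by (rule additive_on_diff[OF HD(2) \<beta>R[OF True] Ss])
        also have "h ?S = (\<Sum>y<nF. (\<lambda>x. ?c y * h (r y) x))"
          by (rule additive_on_lincomb[OF HD(2)]) (use r in simp)
        also have "\<dots> = (\<Sum>y<nF. (\<lambda>x. ?c y * \<beta>F y x))" using r(2) by simp
        also have "\<dots> = h (\<beta>R \<tau>)" by (rule F_exp[OF HD(1)[OF \<beta>R[OF True]], symmetric])
        finally have "h (\<beta>R \<tau> - ?S) = 0" by (simp only: diff_self)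
        then obtain x where x: "x \<in> supported {..<nN}" "f x = \<beta>R \<tau> - ?S"
          using ker[OF supported_diff[OF \<beta>R[OF True] Ss]] by blast
        have "coR (f x) = coR (\<beta>R \<tau>) - coR ?S" unfolding x(2) by (rule additive_on_diff[OF coR_add \<beta>R[OF True] Ss])
        moreover have "coR ?S \<tau>' = (\<Sum>y<nF. ?c y * coR (r y) \<tau>')" for \<tau>'
          by (rule additive_on_lincomb_apply[OF coR_add]) (use r in simp)
        ultimately have "0 = (\<Sum>\<tau>'<nR. v \<tau>' * (indicator {\<tau>} \<tau>' - (\<Sum>y<nF. ?c y * coR (r y) \<tau>')))"
          using v0[OF x(1)] coR_b[OF True] by simp
        also have "\<dots> = (\<Sum>\<tau>'<nR. v \<tau>' * indicator {\<tau>} \<tau>') - (\<Sum>\<tau>'<nR. \<Sum>y<nF. v \<tau>' * (?c y * coR (r y) \<tau>'))"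
          by (simp add: right_diff_distrib sum_subtractf sum_distrib_left)
        also have "(\<Sum>\<tau>'<nR. v \<tau>' * indicator {\<tau>} \<tau>') = v \<tau>"
          using True by (simp add: indicator_def of_bool_def if_distrib[of "\<lambda>x. _ * x"] cong: if_cong)
        also have "(\<Sum>\<tau>'<nR. \<Sum>y<nF. v \<tau>' * (?c y * coR (r y) \<tau>')) = (\<Sum>y<nF. ma \<tau> y * u y)"
          using True by (subst sum.swap) (simp add: u_def ma_def sum_distrib_left sum_distrib_right mult_ac)
        finally show ?thesis by simp
      qed (use vs in \<open>simp add: ma_def supported_def\<close>)
      moreover have "u \<in> supported {..<nF}" by (simp add: u_def supported_def)
      ultimately show ?thesis by blast
    qed
    show "Rel 0 (\<lambda>\<tau>. \<Sum>y\<in>{..<nF}. ma \<tau> y * u y)" if u: "u \<in> supported {..<nF}" for u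
    proof -
      have "(\<Sum>\<tau><nR. (\<Sum>y<nF. ma \<tau> y * u y) * coR (f x) \<tau>) = 0" if x: "x \<in> supported {..<nN}" for x
      proof -
        have "(\<Sum>\<tau><nR. (\<Sum>y<nF. ma \<tau> y * u y) * coR (f x) \<tau>)
            = (\<Sum>\<tau><nR. \<Sum>y<nF. u y * (coR (f x) \<tau> * coF (h (\<beta>R \<tau>)) y))"
          unfolding sum_distrib_right by (intro sum.cong refl) (simp add: ma_def)
        also have "\<dots> = (\<Sum>y<nF. u y * (\<Sum>\<tau><nR. coR (f x) \<tau> * coF (h (\<beta>R \<tau>)) y))"
          by (subst sum.swap) (simp add: sum_distrib_left)
        also have "\<dots> = (\<Sum>y<nF. u y * coF (h (f x)) y)" by (simp only: coF_h_exp[OF FD(1)[OF x]])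
        also have "\<dots> = 0" unfolding hf[OF x] additive_on_zero[OF coF_add] by simp
        finally show ?thesis .
      qed
      moreover have "(\<lambda>\<tau>. \<Sum>y<nF. ma \<tau> y * u y) \<in> supported {..<nR}" by (simp add: supported_def ma_def)
      moreover have "0 = fI 0" using additive_on_zero[OF fI_add] by simp
      ultimately show ?thesis unfolding Rel_def by (intro conjI bexI[of _ 0]) simp_all
    qed
    show "(\<Sum>\<tau>\<in>{..<nR}. mq \<xi> \<tau> * v \<tau>) = w \<xi>" if wv: "Rel w v" for w v \<xi>
    proof -
      obtain \<mu> where \<mu>: "\<mu> \<in> supported {..<n}" "w = fI \<mu>"
        "\<And>x. x \<in> supported {..<nN} \<Longrightarrow> (\<Sum>\<tau><nR. v \<tau> * coR (f x) \<tau>) = (\<Sum>i<n. \<mu> i * \<theta> x i)"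
        using wv unfolding Rel_def by blast
      \<comment> \<open>Evaluating the defining relation at \<open>z i\<close> recovers the
        coordinate of \<open>\<mu>\<close> at \<open>i\<close>.\<close>
      have "(\<Sum>\<tau><nR. (\<lambda>i. v \<tau> * mu \<tau> i)) = \<mu>"
      proof
        fix i
        show "(\<Sum>\<tau><nR. (\<lambda>i. v \<tau> * mu \<tau> i)) i = \<mu> i"
        proof (cases "i < n")
          case True
          have "(\<Sum>\<tau><nR. (\<lambda>i. v \<tau> * mu \<tau> i)) i = (\<Sum>\<tau><nR. v \<tau> * coR (f (z i)) \<tau>)"
            using True by (simp add: sum_fun_apply mu_def)
          also have "\<dots> = (\<Sum>k<n. \<mu> k * indicator {i} k)" using \<mu>(3)[OF z(1)[OF True]] z(2)[OF True] by simp
          also have "\<dots> = \<mu> i" using True by (simp add: indicator_def of_bool_def if_distrib[of "\<lambda>x. _ * x"] cong: if_cong)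
          finally show ?thesis .
        qed (use \<mu>(1) in \<open>simp add: sum_fun_apply mu_def supported_def\<close>)
      qed
      then show ?thesis
        using additive_on_lincomb_apply[OF fI_add, of "{..<nR}" mu, where c = v and y = \<xi>] mu_supp \<mu>(2)
        by (simp add: mq_def mult.commute)
    qed
  qed
  then show ?thesis by blast
qed

section \<open>Coset lattices\<close>

text \<open>Pairs outside \<open>coset_basis\<close> are fixed, which makes this an action on the
  whole type.\<close>

definition coset_act :: "('g, 'b) monoid_scheme \<Rightarrow> 'g set set \<Rightarrow> 'g \<Rightarrow> 'g set \<times> 'g set \<Rightarrow> 'g set \<times> 'g set" where
  "coset_act G \<H> g x = (if x \<in> coset_basis G \<H> then (fst x, g <#\<^bsub>G\<^esub> snd x) else x)"

text \<open>If four does not divide \<open>d\<close>, then \<open>d\<close> or its half is odd and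
  exceeds one, so it has an odd prime factor.\<close>

lemma ex_odd_prime_or_four_dvd:
  assumes "(d::nat) \<ge> 3"
  shows "\<exists>p k. Factorial_Ring.prime p \<and> k \<ge> 1 \<and> (odd p \<or> k \<ge> 2) \<and> p ^ k dvd d"
proof (cases "4 dvd d")
  case True
  then show ?thesis using two_is_prime_nat by (intro exI[of _ 2] exI[of _ "2::nat"]) simp
next
  case False
  obtain s where s: "odd s" "s dvd d" "s > 1"
  proof (cases "even d")
    case True
    then obtain s where d: "d = 2 * s" by blast
    then have "odd s" using False by auto
    moreover have "s > 1" using assms d by simp
    ultimately show thesis using that d by simp
  next
    case False
    then show thesis using that[of d] assms by simp
  qed
  obtain p where p: "Factorial_Ring.prime p" "p dvd s" using prime_factor_nat[of s] s by auto
  then have "odd p" using s by (meson dvd_trans)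
  then show ?thesis using p s by (intro exI[of _ p] exI[of _ "1::nat"]) (auto intro: dvd_trans)
qed

context group
begin

lemma coset_act_mem:
  assumes \<H>: "\<forall>H\<in>\<H>. subgroup H G" and g: "g \<in> carrier G" and x: "x \<in> coset_basis G \<H>"
  shows "coset_act G \<H> g x \<in> coset_basis G \<H>"
proof -
  obtain H k where Hk: "x = (H, k <# H)" "H \<in> \<H>" "k \<in> carrier G" using x by (auto simp: coset_basis_def)
  have "H \<subseteq> carrier G" using \<H> Hk subgroup.subset by blast
  then have "coset_act G \<H> g x = (H, (g \<otimes> k) <# H)" using x Hk g by (simp add: coset_act_def lcos_m_assoc)
  then show ?thesis using Hk g by (auto simp: coset_basis_def)
qed

lemma finite_gset_coset_act:
  assumes fin: "finite (carrier G)" and \<H>: "finite \<H>" "\<forall>H\<in>\<H>. subgroup H G"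
  shows "finite_gset G (coset_basis G \<H>) (coset_act G \<H>)"
proof (intro finite_gset.intro finite_gset_axioms.intro is_group)
  have "coset_basis G \<H> = (\<lambda>(H, g). (H, g <# H)) ` (\<H> \<times> carrier G)" by (auto simp: coset_basis_def)
  then show "finite (coset_basis G \<H>)" using fin \<H> by simp
  have sub: "snd x \<subseteq> carrier G" if "x \<in> coset_basis G \<H>" for x
    using that \<H> l_coset_subset_G subgroup.subset by (auto simp: coset_basis_def) blast
  show "coset_act G \<H> \<one> x = x" for x
    using sub[of x] by (simp add: coset_act_def lcos_mult_one)
  show "coset_act G \<H> (g \<otimes> h) x = coset_act G \<H> g (coset_act G \<H> h x)"
    if "g \<in> carrier G" "h \<in> carrier G" for g h x
  proof (cases "x \<in> coset_basis G \<H>")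
    case True
    then have "coset_act G \<H> h x \<in> coset_basis G \<H>" using coset_act_mem[OF \<H>(2)] that by blast
    then show ?thesis using True sub[OF True] that by (simp add: coset_act_def lcos_m_assoc)
  qed (simp add: coset_act_def)
qed (use coset_act_mem[OF \<H>(2)] in blast)

lemma perm_vecs_eq: "perm_vecs G \<H> = supported (coset_basis G \<H>)"
  by (auto simp: perm_vecs_def supported_def)

lemma perm_act_eq:
  assumes fin: "finite (carrier G)" and \<H>: "finite \<H>" "\<forall>H\<in>\<H>. subgroup H G"
    and g: "g \<in> carrier G" and v: "v \<in> supported (coset_basis G \<H>)"
  shows "perm_act G \<H> g v = shift G (coset_act G \<H>) g v"
  using v by (auto simp: perm_act_def shift_def coset_act_def supported_def fun_eq_iff)

text \<open>The orbit is a copy of the coset space of some member of \<H>, and its size is one of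
  the indices entering \<open>dG\<close>.\<close>

lemma card_orb_coset_act:
  assumes fin: "finite (carrier G)" and \<H>: "finite \<H>" "\<forall>H\<in>\<H>. subgroup H G"
    and x: "x \<in> coset_basis G \<H>"
  shows "dG G \<H> dvd card (orb (coset_act G \<H>) (carrier G) x)"
proof -
  interpret finite_gset G "coset_basis G \<H>" "coset_act G \<H>" by (rule finite_gset_coset_act[OF fin \<H>])
  obtain H k where Hk: "x = (H, k <# H)" "H \<in> \<H>" "k \<in> carrier G" using x by (auto simp: coset_basis_def)
  have H: "subgroup H G" using Hk \<H> by blast
  have H': "H \<subseteq> carrier G" using H subgroup.subset by blast
  have x0: "(H, H) \<in> coset_basis G \<H>" using Hk lcos_mult_one[OF H'] unfolding coset_basis_def by force
  have "x \<in> orb (coset_act G \<H>) (carrier G) (H, H)"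
    unfolding orb_def using Hk x0 by (auto simp: coset_act_def intro!: image_eqI[of _ _ k])
  then have "orb (coset_act G \<H>) (carrier G) x = orb (coset_act G \<H>) (carrier G) (H, H)"
    by (rule orb_eq[OF subgroup_self])
  also have "\<dots> = Pair H ` (lcosets H)" using x0 by (auto simp: orb_def LCOSETS_def coset_act_def)
  finally have "card (orb (coset_act G \<H>) (carrier G) x) = card (lcosets H)" by (simp add: card_image inj_on_def)
  moreover have "card (lcosets H) = card (carrier G) div card H"
  proof -
    have "card H > 0" using fin H' H subgroup.one_closed finite_subset card_gt_0_iff by blast
    then show ?thesis using l_lagrange[OF fin H] by (metis order_def nonzero_mult_div_cancel_right less_irrefl)
  qed
  ultimately show ?thesis using Hk(2) by (simp add: dG_def)
qed

lemma core_iff: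
  assumes H: "H \<subseteq> carrier G"
  shows "x \<in> core G H \<longleftrightarrow> x \<in> carrier G \<and> (\<forall>g\<in>carrier G. inv g \<otimes> x \<otimes> g \<in> H)"
proof -
  have *: "x \<in> (g <# H) #> inv g \<longleftrightarrow> x \<in> carrier G \<and> inv g \<otimes> x \<otimes> g \<in> H" if g: "g \<in> carrier G" for g
  proof
    assume "x \<in> (g <# H) #> inv g"
    then obtain h where h: "h \<in> H" "x = g \<otimes> h \<otimes> inv g" by (auto simp: l_coset_def r_coset_def)
    then have hc: "h \<in> carrier G" using H by blast
    have "inv g \<otimes> x \<otimes> g = h"
      unfolding h(2) using g hc by (simp add: m_assoc) (simp add: m_assoc[symmetric])
    then show "x \<in> carrier G \<and> inv g \<otimes> x \<otimes> g \<in> H" using h g hc by simp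
  next
    assume a: "x \<in> carrier G \<and> inv g \<otimes> x \<otimes> g \<in> H"
    have "x = g \<otimes> (inv g \<otimes> x \<otimes> g) \<otimes> inv g"
      using a g by (simp add: m_assoc) (simp add: m_assoc[symmetric])
    then show "x \<in> (g <# H) #> inv g" using a by (auto simp: l_coset_def r_coset_def)
  qed
  then show ?thesis unfolding core_def using one_closed by blast
qed

lemma core_subset: "H \<subseteq> carrier G \<Longrightarrow> core G H \<subseteq> H"
  using core_iff[of H] by (metis inv_one l_one one_closed r_one subsetI)

lemma core_normal:
  assumes H: "subgroup H G" shows "core G H \<lhd> G"
proof -
  have Hc: "H \<subseteq> carrier G" using H subgroup.subset by blast
  note iff = core_iff[OF Hc]
  have "subgroup (core G H) G"
  proof (rule subgroupI)
    show "core G H \<subseteq> carrier G" by (auto simp: iff)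
    have "\<one> \<in> core G H" unfolding iff using subgroup.one_closed[OF H] by simp
    then show "core G H \<noteq> {}" by blast
    show "inv x \<in> core G H" if "x \<in> core G H" for x
      unfolding iff
    proof (intro conjI ballI)
      have x: "x \<in> carrier G" using that iff by blast
      then show "inv x \<in> carrier G" by simp
      fix g assume g: "g \<in> carrier G"
      have "inv (inv g \<otimes> x \<otimes> g) \<in> H" using that g iff subgroup.m_inv_closed[OF H] by blast
      moreover have "inv (inv g \<otimes> x \<otimes> g) = inv g \<otimes> inv x \<otimes> g" using g x by (simp add: inv_mult_group m_assoc)
      ultimately show "inv g \<otimes> inv x \<otimes> g \<in> H" by simp
    qed
    show "x \<otimes> y \<in> core G H" if xy: "x \<in> core G H" "y \<in> core G H" for x y
      unfolding iff
    proof (intro conjI ballI)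
      have c: "x \<in> carrier G" "y \<in> carrier G" using xy iff by blast+
      then show "x \<otimes> y \<in> carrier G" by simp
      fix g assume g: "g \<in> carrier G"
      have "(inv g \<otimes> x \<otimes> g) \<otimes> (inv g \<otimes> y \<otimes> g) \<in> H" using xy g iff subgroup.m_closed[OF H] by blast
      moreover have "(inv g \<otimes> x \<otimes> g) \<otimes> (inv g \<otimes> y \<otimes> g) = inv g \<otimes> (x \<otimes> y) \<otimes> g"
      proof -
        have "g \<otimes> (inv g \<otimes> (y \<otimes> g)) = y \<otimes> g" using g c by (simp add: m_assoc[symmetric])
        then show ?thesis using g c by (simp add: m_assoc)
      qed
      ultimately show "inv g \<otimes> (x \<otimes> y) \<otimes> g \<in> H" by simp
    qed
  qed
  moreover have "k \<otimes> x \<otimes> inv k \<in> core G H" if k: "k \<in> carrier G" and x: "x \<in> core G H" for k x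
    unfolding iff
  proof (intro conjI ballI)
    have xc: "x \<in> carrier G" using x iff by blast
    then show "k \<otimes> x \<otimes> inv k \<in> carrier G" using k by simp
    fix g assume g: "g \<in> carrier G"
    have "inv (inv k \<otimes> g) \<otimes> x \<otimes> (inv k \<otimes> g) \<in> H" using x iff k g by blast
    moreover have "inv (inv k \<otimes> g) \<otimes> x \<otimes> (inv k \<otimes> g) = inv g \<otimes> (k \<otimes> x \<otimes> inv k) \<otimes> g"
      using k g xc by (simp add: inv_mult_group m_assoc)
    ultimately show "inv g \<otimes> (k \<otimes> x \<otimes> inv k) \<otimes> g \<in> H" by simp
  qed
  ultimately show ?thesis unfolding normal_inv_iff by blast
qed

text \<open>Sum zero determines the coefficient at one chosen basis element \<open>x0\<close>, so
  the remaining coefficients are free coordinates on I.\<close>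

lemma ex_I_lattice:
  assumes fin: "finite (carrier G)" and \<H>: "finite \<H>" "\<forall>H\<in>\<H>. subgroup H G" and ne: "\<H> \<noteq> {}"
  shows "\<exists>M. is_I_lattice G \<H> M"
proof -
  let ?\<Omega> = "coset_basis G \<H>"
  interpret P: finite_gset G ?\<Omega> "coset_act G \<H>" by (rule finite_gset_coset_act[OF fin \<H>])
  obtain x0 where x0: "x0 \<in> ?\<Omega>" using ne one_closed unfolding coset_basis_def by blast
  define n where "n = card (?\<Omega> - {x0})"
  obtain e where e: "bij_betw e {..<n} (?\<Omega> - {x0})"
    using ex_bij_betw_nat_finite[of "?\<Omega> - {x0}"] P.fin_set unfolding n_def atLeast0LessThan by blast
  define ie where "ie = inv_into {..<n} e"
  have e_in: "e i \<in> ?\<Omega>" "e i \<noteq> x0" "ie (e i) = i" if "i < n" for i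
    using that bij_betwE[OF e] bij_betw_inv_into_left[OF e] by (auto simp: ie_def)
  have ie: "ie b < n" "e (ie b) = b" if "b \<in> ?\<Omega>" "b \<noteq> x0" for b
    using that bij_betwE[OF bij_betw_inv_into[OF e]] bij_betw_inv_into_right[OF e] by (auto simp: ie_def)
  define f where "f v = (\<lambda>b. if b = x0 then - (\<Sum>i<n. v i) else if b \<in> ?\<Omega> then v (ie b) else 0)" for v :: "nat \<Rightarrow> int"
  define rs where "rs w = (\<lambda>i. if i < n then w (e i) else 0 :: int)" for w :: "'a set \<times> 'a set \<Rightarrow> int"
  have split: "(\<Sum>b\<in>?\<Omega>. w b) = w x0 + (\<Sum>i<n. w (e i))" for w :: "'a set \<times> 'a set \<Rightarrow> int"
    using sum.remove[OF P.fin_set x0, of w] sum.reindex_bij_betw[OF e, of w] by simp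
  define I where "I = {w \<in> supported ?\<Omega>. (\<Sum>b\<in>?\<Omega>. w b) = 0}"
  have f_I: "f v \<in> I" for v
  proof -
    have "(\<Sum>i<n. f v (e i)) = (\<Sum>i<n. v i)" by (intro sum.cong refl) (simp add: f_def e_in)
    then have "(\<Sum>b\<in>?\<Omega>. f v b) = 0" unfolding split by (simp add: f_def)
    moreover have "f v \<in> supported ?\<Omega>" using x0 by (auto simp: f_def supported_def)
    ultimately show ?thesis by (simp add: I_def)
  qed
  have f_rs: "f (rs w) = w" if w: "w \<in> I" for w
  proof
    fix b
    have "(\<Sum>i<n. rs w i) = (\<Sum>i<n. w (e i))" by (simp add: rs_def)
    then have "w x0 = - (\<Sum>i<n. rs w i)" using w unfolding I_def split by simp
    then show "f (rs w) b = w b" using w ie[of b] by (cases b) (auto simp: f_def rs_def I_def supported_def)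
  qed
  have rs_f: "rs (f v) = v" if "v \<in> vecs n" for v
    using that e_in by (auto simp: rs_def f_def vecs_def fun_eq_iff)
  have rs_vecs: "rs w \<in> vecs n" for w by (simp add: rs_def vecs_def)
  have f_add: "f (v + w) = f v + f w" for v w by (auto simp: f_def fun_eq_iff sum.distrib)
  have rs_add: "rs (v + w) = rs v + rs w" for v w by (auto simp: rs_def fun_eq_iff)
  have sh_I: "P.sh g w \<in> I" if "g \<in> carrier G" "w \<in> I" for g w
    using that P.sh_supported P.sum_sh_1 by (simp add: I_def)
  define a where "a g v = rs (P.sh g (f v))" for g v
  have fa: "f (a g v) = P.sh g (f v)" if "g \<in> carrier G" for g v
    unfolding a_def by (rule f_rs[OF sh_I[OF that f_I]])
  have "glattice G (n, a)"
    unfolding glattice_def prod.case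
  proof (intro conjI ballI)
    show "a g v \<in> vecs n" for g v unfolding a_def by (rule rs_vecs)
    show "a g (\<lambda>i. v i + w i) = (\<lambda>i. a g v i + a g w i)" for g v w
    proof -
      have "a g (v + w) = a g v + a g w" by (simp only: a_def f_add P.sh_add rs_add)
      then show ?thesis by (simp only: plus_fun_def)
    qed
    show "a \<one> v = v" if "v \<in> vecs n" for v unfolding a_def using rs_f[OF that] by simp
    show "a (g \<otimes> h) v = a g (a h v)" if "g \<in> carrier G" "h \<in> carrier G" for g h v
      unfolding a_def[of g] fa[OF that(2)] unfolding a_def P.sh_mult[OF that] ..
  qed
  moreover have "inj_on f (vecs n)" using rs_f by (metis inj_onI)
  moreover have "f ` vecs n = {x \<in> perm_vecs G \<H>. (\<Sum>b\<in>?\<Omega>. x b) = 0}"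
  proof -
    have "f ` vecs n = I" using f_I f_rs rs_vecs by (metis (no_types, lifting) image_iff subset_antisym subsetI)
    then show ?thesis by (simp add: I_def perm_vecs_eq)
  qed
  moreover have "f (a g v) = perm_act G \<H> g (f v)" if "g \<in> carrier G" for g v
    using fa[OF that] perm_act_eq[OF fin \<H> that, of "f v"] f_I[of v] by (simp add: I_def)
  moreover have "f v \<in> perm_vecs G \<H>" for v using f_I[of v] by (simp add: I_def perm_vecs_eq)
  moreover have "f (\<lambda>i. v i + w i) = (\<lambda>b. f v b + f w b)" for v w
    using f_add[of v w] by (simp only: plus_fun_def)
  ultimately have "is_I_lattice G \<H> (n, a)"
    unfolding is_I_lattice_def fst_conv snd_conv by (intro conjI exI[of _ f] ballI) auto
  then show ?thesis by blast
qed

text \<open>The core of \<open>H1\<close> serves as \<open>N0\<close>: it is normal, it fixes the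
  trivial coset of \<open>H1\<close>, and by \<open>prod\<close> it is transitive on the cosets of
  \<open>H2\<close>.\<close>

lemma not_quasi_invertible_dual:
  assumes fin: "finite (carrier G)" and \<H>: "finite \<H>" "\<forall>H\<in>\<H>. subgroup H G" and d: "dG G \<H> \<ge> 3"
    and H1: "H1 \<in> \<H>" and H2: "H2 \<in> \<H>" and prod: "core G H1 <#> H2 = carrier G"
    and M: "is_I_lattice G \<H> M"
  shows "\<not> quasi_invertible G (dual_lattice G M)"
proof
  assume qi: "quasi_invertible G (dual_lattice G M)"
  obtain n a where Ma: "M = (n, a)" by (cases M)
  let ?\<Omega> = "coset_basis G \<H>" and ?a = "coset_act G \<H>"
  note gX = finite_gset_coset_act[OF fin \<H>]
  interpret P: finite_gset G ?\<Omega> ?a by (rule gX)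
  obtain f where f: "\<forall>v\<in>supported {..<n}. f v \<in> supported ?\<Omega>"
    "\<forall>v\<in>supported {..<n}. \<forall>w\<in>supported {..<n}. f (\<lambda>i. v i + w i) = (\<lambda>b. f v b + f w b)"
    "\<forall>g\<in>carrier G. \<forall>v\<in>supported {..<n}. f (a g v) = perm_act G \<H> g (f v)"
    "inj_on f (supported {..<n})"
    "f ` supported {..<n} = {x \<in> supported ?\<Omega>. (\<Sum>b\<in>?\<Omega>. x b) = 0}"
    and lat: "glattice G (n, a)"
    using M unfolding is_I_lattice_def Ma vecs_eq perm_vecs_eq fst_conv snd_conv by (elim conjE exE)
  have sub: "f v \<in> {x \<in> supported ?\<Omega>. (\<Sum>b\<in>?\<Omega>. x b) = 0}" if "v \<in> supported {..<n}" for v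
    unfolding f(5)[symmetric] using that by (rule imageI)
  have "\<exists>nR \<pi>R nF \<pi>F Rel ma mq.
    permutation_resolution G ?\<Omega> ?a {..<nR::nat} \<pi>R {..<nF::nat} \<pi>F Rel ma mq"
  proof (rule quasi_invertible_resolution[OF fin gX lat])
    show "additive_on {..<n} f" unfolding additive_on_def plus_fun_def using f(2) by blast
    show "\<exists>v\<in>supported {..<n}. f v = w" if "w \<in> supported ?\<Omega>" "(\<Sum>b\<in>?\<Omega>. w b) = 0" for w
    proof -
      have "w \<in> f ` supported {..<n}" unfolding f(5) using that by simp
      then show ?thesis by (auto simp: image_iff)
    qed
    show "f (a g v) = P.sh g (f v)" if "g \<in> carrier G" "v \<in> supported {..<n}" for g v
      using f(1,3) that perm_act_eq[OF fin \<H> that(1)] by simp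
  qed (use sub f(4) qi Ma in auto)
  then obtain nR nF :: nat and \<pi>R \<pi>F Rel ma mq where
    res: "permutation_resolution G ?\<Omega> ?a {..<nR} \<pi>R {..<nF} \<pi>F Rel ma mq" by blast
  obtain p k where p: "Factorial_Ring.prime p" "k \<ge> 1" "odd p \<or> k \<ge> 2" "p ^ k dvd dG G \<H>"
    using ex_odd_prime_or_four_dvd[OF d] by blast
  have c1: "H1 \<subseteq> carrier G" and c2: "H2 \<subseteq> carrier G" using \<H> H1 H2 subgroup.subset by blast+
  have x1: "(H1, H1) \<in> ?\<Omega>" using H1 lcos_mult_one[OF c1] unfolding coset_basis_def by force
  have x2: "(H2, H2) \<in> ?\<Omega>" using H2 lcos_mult_one[OF c2] unfolding coset_basis_def by force
  show False
  proof (rule permutation_resolution.no_resolution[OF res p(1-3) _ core_normal x1 _ x2])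
    show "p ^ k dvd card (orb ?a (carrier G) x)" if "x \<in> ?\<Omega>" for x
      using p(4) card_orb_coset_act[OF fin \<H> that] by (rule dvd_trans)
    show "subgroup H1 G" using \<H> H1 by blast
    show "?a g (H1, H1) = (H1, H1)" if "g \<in> core G H1" for g
    proof -
      have "g \<in> H1" using core_subset[OF c1] that by blast
      then show ?thesis using x1 coset_join3[of g H1] \<H> H1 c1 by (auto simp: coset_act_def)
    qed
    show "?a g (H2, H2) \<in> orb ?a (core G H1) (H2, H2)" if g: "g \<in> carrier G" for g
    proof -
      obtain u h where uh: "u \<in> core G H1" "h \<in> H2" "g = u \<otimes> h"
      proof -
        have "g \<in> core G H1 <#> H2" using g by (simp only: prod)
        then show thesis using that by (auto simp: set_mult_def)
      qed
      have uc: "u \<in> carrier G" using uh(1) by (simp add: core_iff[OF c1])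
      have "g <# H2 = u <# (h <# H2)" using uh uc c2 by (simp add: lcos_m_assoc subsetD)
      also have "h <# H2 = H2" using coset_join3[of h H2] uh(2) c2 \<H> H2 by auto
      finally show ?thesis using x2 uh(1) by (auto simp: orb_def coset_act_def)
    qed
  qed
qed

end

text \<open>The existence conjunct ensures that the statement about all coordinate models of I does
  not hold vacuously.\<close>

theorem theorem5p6:
  fixes G :: "('g, 'b) monoid_scheme" and \<H> :: "'g set set"
  assumes "group G" and "finite (carrier G)"
    and "\<forall>H\<in>\<H>. subgroup H G"
    and "reduced \<H>" and "card \<H> \<ge> 2" and "dG G \<H> \<ge> 3"
    and "\<exists>\<H>'\<subseteq>\<H>. card \<H>' = 2 \<and> special G \<H>'"
  shows "(\<exists>M. is_I_lattice G \<H> M) \<and>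
         (\<forall>M. is_I_lattice G \<H> M \<longrightarrow> \<not> quasi_invertible G (dual_lattice G M))"
proof -
  interpret group G by (rule assms(1))
  have fin\<H>: "finite \<H>" "\<H> \<noteq> {}" using assms(5) by (auto intro: card_ge_0_finite)
  obtain \<H>' where \<H>': "\<H>' \<subseteq> \<H>" "card \<H>' = 2" "special G \<H>'" using assms(7) by blast
  obtain H1 H2 where H: "\<H>' = {H1, H2}" "H1 \<noteq> H2" using \<H>'(2) by (auto simp: card_2_iff)
  \<comment> \<open>Whichever of the two products is the whole group,
    \<open>not_quasi_invertible_dual\<close> applies after naming the subgroups accordingly.\<close>
  have "core G H1 <#>\<^bsub>G\<^esub> H2 = carrier G \<or> core G H2 <#>\<^bsub>G\<^esub> H1 = carrier G"
    using \<H>'(3) H unfolding special_def by blast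
  moreover have mem: "H1 \<in> \<H>" "H2 \<in> \<H>" using \<H>'(1) H(1) by simp_all
  note NQ = not_quasi_invertible_dual[OF assms(2) fin\<H>(1) assms(3,6)]
  ultimately have "\<not> quasi_invertible G (dual_lattice G M)" if "is_I_lattice G \<H> M" for M
    using NQ[OF mem _ that] NQ[OF mem(2,1) _ that] by (elim disjE)
  then show ?thesis using ex_I_lattice[OF assms(2) fin\<H>(1) assms(3) fin\<H>(2)] by blast
qed

end
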